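(* Let $\Omega\subset\mathbb R^2$ be a bounded Lipschitz domain with first Betti number $\beta_1$. Then there is a finite-dimensional space $\mathscr H_\infty$ of smooth vector fields ($\mathscr H_\infty\subset C^\infty(\overline\Omega)\otimes\mathbb V$) with $\dim\mathscr H_\infty=1+\beta_1$ such that $$\{\boldsymbol u\in H(\operatorname{grad}\operatorname{rot};\Omega):\operatorname{grad}\operatorname{rot}\boldsymbol u=0\}=\operatorname{grad}H^1(\Omega)\oplus\mathscr H_\infty .$$
   Context: $\mathbb V=\mathbb R^2$; a domain is open and connected; $\operatorname{rot}\boldsymbol v=\partial_1v_2-\partial_2v_1$; $H(\operatorname{grad}\operatorname{rot};\Omega)=\{\boldsymbol v\in L^2(\Omega)\otimes\mathbb V:\operatorname{grad}\operatorname{rot}\boldsymbol v\in L^2(\Omega)\otimes\mathbb V\}$, derivatives in the sense of distributions. The sum is a direct sum of vector spaces. *)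

theory Defs
  imports
    "HOL-Analysis.Analysis"
    "HOL-Homology.Homology"
    "HOL-Library.Function_Algebras"
    "HOL-Library.Extended_Nat"
begin

section \<open>Bounded Lipschitz domains in the plane\<close>

text \<open>
  Near every boundary point, after an orthogonal change of coordinates \<open>T\<close>, the set is the part
  of a ball that lies strictly above the graph of a Lipschitz function. Translations of the
  coordinates need not be mentioned, as they can be absorbed into \<open>\<phi>\<close>. A domain is nonempty.
\<close>

definition bounded_lipschitz_domain :: "(real^2) set \<Rightarrow> bool" where
  "bounded_lipschitz_domain \<Omega> \<longleftrightarrow>
     open \<Omega> \<and> connected \<Omega> \<and> \<Omega> \<noteq> {} \<and> bounded \<Omega> \<and>
     (\<forall>x\<in>frontier \<Omega>. \<exists>r>0. \<exists>T :: real^2 \<Rightarrow> real^2. \<exists>\<phi> :: real \<Rightarrow> real. \<exists>L.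
        orthogonal_transformation T \<and> L-lipschitz_on UNIV \<phi> \<and>
        \<Omega> \<inter> ball x r = {y \<in> ball x r. \<phi> (T y $ 1) < T y $ 2})"


section \<open>Betti numbers\<close>

text \<open>
  The (torsion-free) rank of an abelian group, written multiplicatively: the supremum of the
  cardinalities of its finite \<open>\<int>\<close>-linearly independent subsets. It takes values in \<open>enat\<close>, so that
  infinite rank is \<open>\<infinity>\<close>.
\<close>

definition int_independent :: "('a, 'b) monoid_scheme \<Rightarrow> 'a set \<Rightarrow> bool" where
  "int_independent G S \<longleftrightarrow>
     finite S \<and> S \<subseteq> carrier G \<and>
     (\<forall>n :: 'a \<Rightarrow> int. finprod G (\<lambda>g. g [^]\<^bsub>G\<^esub> n g) S = \<one>\<^bsub>G\<^esub> \<longrightarrow> (\<forall>g\<in>S. n g = 0))"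

definition abelian_rank :: "('a, 'b) monoid_scheme \<Rightarrow> enat" where
  "abelian_rank G = (SUP S \<in> {S. int_independent G S}. enat (card S))"

definition betti_number :: "int \<Rightarrow> 'a topology \<Rightarrow> enat" where
  "betti_number p X = abelian_rank (homology_group p X)"


section \<open>Smooth functions\<close>

fun Ck_on :: "nat \<Rightarrow> ('a::real_normed_vector) set \<Rightarrow> ('a \<Rightarrow> 'b::real_normed_vector) \<Rightarrow> bool" where
  "Ck_on 0 S f \<longleftrightarrow> continuous_on S f"
| "Ck_on (Suc k) S f \<longleftrightarrow>
     (\<forall>x\<in>S. f differentiable (at x)) \<and>
     (\<forall>v. Ck_on k S (\<lambda>x. frechet_derivative f (at x) v))"

definition smooth :: "('a::real_normed_vector \<Rightarrow> 'b::real_normed_vector) \<Rightarrow> bool" where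
  "smooth f \<longleftrightarrow> (\<forall>k. Ck_on k UNIV f)"

definition pderivative :: "2 \<Rightarrow> (real^2 \<Rightarrow> real) \<Rightarrow> real^2 \<Rightarrow> real" where
  "pderivative i f x = frechet_derivative f (at x) (axis i 1)"

text \<open>
  \<open>C\<^sup>\<infinity>(closure \<Omega>) \<otimes> \<real>\<^sup>2\<close>: restrictions to the closure of \<open>\<Omega>\<close> of smooth fields on the whole plane.
  A field on the closure is encoded as a total function vanishing outside, so that two such fields
  are equal as functions iff they agree on the closure. If \<open>\<Omega>\<close> is open, this is the
  case iff they agree almost everywhere in \<open>\<Omega>\<close>.
\<close>

definition smooth_fields :: "(real^2) set \<Rightarrow> (real^2 \<Rightarrow> real^2) set" where
  "smooth_fields \<Omega> =
     {v. \<exists>w. smooth w \<and> (\<forall>x. v x = (if x \<in> closure \<Omega> then w x else 0))}"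


section \<open>Distributions\<close>

definition test_functions :: "(real^2) set \<Rightarrow> (real^2 \<Rightarrow> real) set" where
  "test_functions \<Omega> =
     {\<phi>. smooth \<phi> \<and> compact (closure {x. \<phi> x \<noteq> 0}) \<and> closure {x. \<phi> x \<noteq> 0} \<subseteq> \<Omega>}"

text \<open>
  A distribution on \<open>\<Omega>\<close> is represented by a functional of which only the values on
  \<open>test_functions \<Omega>\<close> matter.
\<close>

type_synonym distribution = "(real^2 \<Rightarrow> real) \<Rightarrow> real"

definition eq_distr :: "(real^2) set \<Rightarrow> distribution \<Rightarrow> distribution \<Rightarrow> bool" where
  "eq_distr \<Omega> S T \<longleftrightarrow> (\<forall>\<phi>\<in>test_functions \<Omega>. S \<phi> = T \<phi>)"

definition regular_distr :: "(real^2) set \<Rightarrow> (real^2 \<Rightarrow> real) \<Rightarrow> distribution" where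
  "regular_distr \<Omega> f = (\<lambda>\<phi>. LINT x|lebesgue_on \<Omega>. f x * \<phi> x)"

definition partial_distr :: "2 \<Rightarrow> distribution \<Rightarrow> distribution" where
  "partial_distr i T = (\<lambda>\<phi>. - T (pderivative i \<phi>))"

definition rot_distr :: "(real^2) set \<Rightarrow> (real^2 \<Rightarrow> real^2) \<Rightarrow> distribution" where
  "rot_distr \<Omega> v = (\<lambda>\<phi>. partial_distr 1 (regular_distr \<Omega> (\<lambda>x. v x $ 2)) \<phi>
                      - partial_distr 2 (regular_distr \<Omega> (\<lambda>x. v x $ 1)) \<phi>)"

definition has_gradient_distr ::
    "(real^2) set \<Rightarrow> distribution \<Rightarrow> (real^2 \<Rightarrow> real^2) \<Rightarrow> bool" where
  "has_gradient_distr \<Omega> T g \<longleftrightarrow>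
     (\<forall>i. eq_distr \<Omega> (partial_distr i T) (regular_distr \<Omega> (\<lambda>x. g x $ i)))"


section \<open>Function spaces\<close>

text \<open>
  An element of \<open>L\<^sup>2(\<Omega>)\<close> is a class of functions modulo equality almost everywhere in \<open>\<Omega>\<close>. The sets
  \<open>L2\<close>, \<open>H1\<close>, \<open>H_grad_rot\<close>, \<open>ker_grad_rot\<close> and \<open>grad_H1\<close> below consist of all representatives of the
  classes in question, with arbitrary values outside \<open>\<Omega>\<close>. They are closed under changes on null
  sets and outside \<open>\<Omega>\<close>, so equality of two of them is equality of the sets of classes.
\<close>

definition L2 :: "(real^2) set \<Rightarrow> (real^2 \<Rightarrow> 'b::euclidean_space) set" where
  "L2 \<Omega> = {f. f \<in> borel_measurable (lebesgue_on \<Omega>) \<and>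
              integrable (lebesgue_on \<Omega>) (\<lambda>x. (norm (f x))\<^sup>2)}"

definition H1 :: "(real^2) set \<Rightarrow> (real^2 \<Rightarrow> real) set" where
  "H1 \<Omega> = {p \<in> L2 \<Omega>. \<exists>g\<in>L2 \<Omega>. has_gradient_distr \<Omega> (regular_distr \<Omega> p) g}"

definition grad_H1 :: "(real^2) set \<Rightarrow> (real^2 \<Rightarrow> real^2) set" where
  "grad_H1 \<Omega> = {g \<in> L2 \<Omega>. \<exists>p\<in>H1 \<Omega>. has_gradient_distr \<Omega> (regular_distr \<Omega> p) g}"

definition H_grad_rot :: "(real^2) set \<Rightarrow> (real^2 \<Rightarrow> real^2) set" where
  "H_grad_rot \<Omega> = {v \<in> L2 \<Omega>. \<exists>g\<in>L2 \<Omega>. has_gradient_distr \<Omega> (rot_distr \<Omega> v) g}"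

definition ker_grad_rot :: "(real^2) set \<Rightarrow> (real^2 \<Rightarrow> real^2) set" where
  "ker_grad_rot \<Omega> = {u \<in> H_grad_rot \<Omega>. has_gradient_distr \<Omega> (rot_distr \<Omega> u) (\<lambda>x. 0)}"


section \<open>Spaces of vector fields\<close>

global_interpretation fields: vector_space "\<lambda>c (f :: real^2 \<Rightarrow> real^2) x. c *\<^sub>R f x"
  by unfold_locales (auto simp: fun_eq_iff algebra_simps)

text \<open>
  \<open>U = V \<oplus> W\<close>, up to equality almost everywhere, for a set \<open>V\<close> of representatives as above and a
  space \<open>W\<close> of fields that are determined by their classes, such as a subspace of
  \<open>smooth_fields \<Omega>\<close>. Then \<open>V\<close> and \<open>W\<close> meet only in the zero class iff the only common
  function is \<open>0\<close>, although \<open>V\<close> contains many representatives of the zero class.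
\<close>

definition is_direct_sum ::
    "(real^2 \<Rightarrow> real^2) set \<Rightarrow> (real^2 \<Rightarrow> real^2) set \<Rightarrow> (real^2 \<Rightarrow> real^2) set \<Rightarrow> bool" where
  "is_direct_sum U V W \<longleftrightarrow> U = {v + w | v w. v \<in> V \<and> w \<in> W} \<and> V \<inter> W = {0}"

end

theory Submission imports Defs "HOL-Computational_Algebra.Polynomial"
begin

text \<open>
  The kernel consists of the fields with constant rotation; subtracting a multiple of
  \<open>(- x\<^sub>2 / 2, x\<^sub>1 / 2)\<close> leaves the rotation-free fields. Near every point of its closure \<open>\<Omega>\<close> is a
  starlike region above a graph, where a rotation-free square integrable field has a square
  integrable potential, given explicitly by line integrals. Potentials on charts around nearby points
  \<open>x\<close>, \<open>y\<close> differ by a constant \<open>h x y\<close>, and \<open>h\<close> is an Alexander--Spanier cocycle at a small scale.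
  Gluing the potentials with a partition of unity \<open>\<rho>\<close> exhibits the field as a gradient minus the
  Whitney form \<open>\<Sum> h d c \<rho>\<^sub>d grad \<rho>\<^sub>c\<close>, which is smooth up to the boundary. A cocycle can be summed
  along singular 1-chains; its Whitney form is a gradient iff \<open>h\<close> is a coboundary at a small scale,
  and iff all periods of \<open>h\<close> over singular cycles vanish. Conversely every real functional on cycles
  modulo boundaries is the period map of a cocycle, because the charts are contractible. So for a maximal
  independent family of cycles the Whitney forms of a dual family of cocycles, together with the
  rotation field, span \<open>H\<close>. No finiteness of the homology has to be known in advance: all Whitney
  forms lie in the span of the finitely many fields \<open>\<rho>\<^sub>d grad \<rho>\<^sub>c\<close>.
\<close>

subsection \<open>Smooth functions and directional derivatives\<close>

text \<open>The boundary is only Lipschitz, yet potentials must be square integrable up to it. Line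
  integrals give this without regularity theory: above a graph every point is reached from a slab of
  fixed height along vertical segments that stay inside, and Cauchy--Schwarz on segments bounds the
  result in the square mean.

  A cocycle is a function of pairs of points of \<Omega>, not of members of a cover, so the same
  object can be summed along paths, pulled back to simplices and evaluated at the centres of the
  partition. It is closed only up to a scale, and scale is lost on the way: a Whitney form that is a
  gradient makes \<open>h\<close> a coboundary at scale \<open>\<rho>3\<close>, whereas the converse
  starts from a coboundary at the larger scale \<open>\<rho>2\<close>. The circle closes through the
  periods, which do not see the scale, since a path can be subdivided as finely as desired.

  Maximality of an independent family of integral cycles controls only some nonzero multiple of each
  cycle. Real periods are insensitive to such multiples, and because the reals are divisible every
  assignment of periods on the family extends to all chains.\<close>

definition dd :: "'a::real_normed_vector \<Rightarrow> ('a \<Rightarrow> 'b::real_normed_vector) \<Rightarrow> 'a \<Rightarrow> 'b" where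
  "dd v f x = frechet_derivative f (at x) v"

lemma pderivative_eq_dd: "pderivative i f = dd (axis i 1) f"
  by (auto simp: fun_eq_iff pderivative_def dd_def)

lemma dd_eqI: "(f has_derivative f') (at x) \<Longrightarrow> dd v f x = f' v"
  by (simp add: dd_def frechet_derivative_at[symmetric])

lemma Ck_on_Suc_imp: "Ck_on (Suc k) S f \<Longrightarrow> Ck_on k S f"
proof (induction k arbitrary: f)
  case 0
  then show ?case
    by (auto intro!: continuous_at_imp_continuous_on differentiable_imp_continuous_within)
next
  case (Suc k)
  then show ?case by (metis Ck_on.simps(2))
qed

lemma Ck_on_UNIV_Suc_iff:
  "Ck_on (Suc k) UNIV f \<longleftrightarrow> (\<forall>x. f differentiable (at x)) \<and> (\<forall>v. Ck_on k UNIV (dd v f))"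
  by (simp add: dd_def[abs_def])

lemma Ck_on_add:
  "Ck_on k UNIV f \<Longrightarrow> Ck_on k UNIV g \<Longrightarrow> Ck_on k UNIV (\<lambda>x. f x + g x)"
proof (induction k arbitrary: f g)
  case 0
  then show ?case by (auto intro!: continuous_intros)
next
  case (Suc k)
  have "((\<lambda>x. f x + g x) has_derivative (\<lambda>v. dd v f x + dd v g x)) (at x)" for x
    using Suc.prems unfolding Ck_on_UNIV_Suc_iff dd_def
    by (intro has_derivative_add) (auto simp flip: frechet_derivative_works)
  then have "dd v (\<lambda>x. f x + g x) = (\<lambda>x. dd v f x + dd v g x)" for v
    using dd_eqI by blast
  then show ?case
    using Suc unfolding Ck_on_UNIV_Suc_iff by (auto intro!: derivative_intros)
qed

text \<open>One induction serves products, scalar multiples and inner products. In the product rule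
  each summand keeps one factor undifferentiated; \<open>Ck_on_Suc_imp\<close> lowers its order to
  \<open>k\<close>.\<close>

lemma Ck_on_bilinear:
  assumes "bounded_bilinear pr"
  shows "Ck_on k UNIV f \<Longrightarrow> Ck_on k UNIV g \<Longrightarrow> Ck_on k UNIV (\<lambda>x. pr (f x) (g x))"
proof (induction k arbitrary: f g)
  case 0
  then show ?case by (auto intro!: bounded_bilinear.continuous_on[OF assms])
next
  case (Suc k)
  have d: "((\<lambda>x. pr (f x) (g x)) has_derivative
      (\<lambda>v. pr (f x) (dd v g x) + pr (dd v f x) (g x))) (at x)" for x
    using Suc.prems unfolding Ck_on_UNIV_Suc_iff dd_def
    by (auto intro!: bounded_bilinear.FDERIV[OF assms] simp flip: frechet_derivative_works)
  then have "dd v (\<lambda>x. pr (f x) (g x)) = (\<lambda>x. pr (f x) (dd v g x) + pr (dd v f x) (g x))" for v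
    by (auto simp: fun_eq_iff dd_eqI[OF d])
  with d Suc show ?case
    using Ck_on_Suc_imp[OF Suc.prems(1)] Ck_on_Suc_imp[OF Suc.prems(2)]
    unfolding Ck_on_UNIV_Suc_iff
    by (auto intro!: Ck_on_add differentiableI simp: Ck_on_UNIV_Suc_iff)
qed

lemma smooth_differentiable: "smooth f \<Longrightarrow> f differentiable (at x)"
  unfolding smooth_def by (metis Ck_on_UNIV_Suc_iff)

lemma smooth_has_derivative: "smooth f \<Longrightarrow> (f has_derivative (\<lambda>v. dd v f x)) (at x)"
  unfolding dd_def using smooth_differentiable frechet_derivative_works by blast

lemma smooth_dd: "smooth f \<Longrightarrow> smooth (dd v f)"
  unfolding smooth_def by (metis Ck_on_UNIV_Suc_iff)

lemma smooth_pderivative: "smooth f \<Longrightarrow> smooth (pderivative i f)"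
  by (simp add: pderivative_eq_dd smooth_dd)

lemma smooth_continuous_on: "smooth f \<Longrightarrow> continuous_on S f"
  unfolding smooth_def by (metis Ck_on.simps(1) continuous_on_subset subset_UNIV)

text \<open>The smooth functions are the greatest class of differentiable functions closed under
  directional derivatives. Exhibiting such a class replaces an induction on \<open>k\<close>
  whenever the derivatives are known explicitly.\<close>

lemma smooth_coinduct [consumes 1, case_names differentiable dd]:
  assumes "P f" and "\<And>f x. P f \<Longrightarrow> f differentiable (at x)" and "\<And>f v. P f \<Longrightarrow> P (dd v f)"
  shows "smooth f"
proof -
  have "P f \<Longrightarrow> Ck_on k UNIV f" for f k
  proof (induction k arbitrary: f)
    case 0
    then show ?case using assms(2)
      by (auto intro!: continuous_at_imp_continuous_on differentiable_imp_continuous_within)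
  next
    case (Suc k)
    then show ?case using assms(2,3) unfolding Ck_on_UNIV_Suc_iff by blast
  qed
  then show ?thesis using assms(1) by (simp add: smooth_def)
qed

lemma dd_linear_combination:
  assumes "smooth f"
  shows "dd (a *\<^sub>R v + b *\<^sub>R w) f x = a *\<^sub>R dd v f x + b *\<^sub>R dd w f x"
proof -
  have "linear (\<lambda>v. dd v f x)"
    using smooth_has_derivative[OF assms] has_derivative_linear by blast
  from linear_add[OF this] linear_scale[OF this] show ?thesis by metis
qed

lemma dd_const [simp]: "dd v (\<lambda>x. c) = (\<lambda>x. 0)"
  by (auto simp: fun_eq_iff intro!: dd_eqI)

lemma smooth_const [simp]: "smooth (\<lambda>x. c)"
  by (rule smooth_coinduct[where P="\<lambda>f. \<exists>c. f = (\<lambda>x. c)"]) auto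

lemma smooth_add: "smooth f \<Longrightarrow> smooth g \<Longrightarrow> smooth (\<lambda>x. f x + g x)"
  by (simp add: smooth_def Ck_on_add)

lemma smooth_bilinear:
  "bounded_bilinear pr \<Longrightarrow> smooth f \<Longrightarrow> smooth g \<Longrightarrow> smooth (\<lambda>x. pr (f x) (g x))"
  by (simp add: smooth_def Ck_on_bilinear)

lemmas smooth_mult = smooth_bilinear[OF bounded_bilinear_mult]
lemmas smooth_scaleR = smooth_bilinear[OF bounded_bilinear_scaleR]
lemmas smooth_inner = smooth_bilinear[OF bounded_bilinear_inner]

lemma smooth_diff: "smooth f \<Longrightarrow> smooth g \<Longrightarrow> smooth (\<lambda>x. f x - g x)"
  using smooth_add[OF _ smooth_scaleR[OF smooth_const[of "-1"]], of f g] by simp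

lemma smooth_sum: "(\<And>i. i \<in> I \<Longrightarrow> smooth (f i)) \<Longrightarrow> smooth (\<lambda>x. \<Sum>i\<in>I. f i x)"
  by (induction I rule: infinite_finite_induct) (auto simp: smooth_add)

lemma smooth_prod:
  fixes f :: "'i \<Rightarrow> 'a::real_normed_vector \<Rightarrow> real"
  shows "(\<And>i. i \<in> I \<Longrightarrow> smooth (f i)) \<Longrightarrow> smooth (\<lambda>x. \<Prod>i\<in>I. f i x)"
  by (induction I rule: infinite_finite_induct) (auto simp: smooth_mult)

lemma smooth_affine:
  assumes "bounded_linear A" "smooth g"
  shows "smooth (\<lambda>x. g (A x + c))"
proof -
  have d: "((\<lambda>x. g (A x + c)) has_derivative (\<lambda>v. dd (A v) g (A x + c))) (at x)" if "smooth g" for g x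
    by (rule has_derivative_compose[OF _ smooth_has_derivative[OF that], where f="\<lambda>x. A x + c"])
       (auto intro!: derivative_eq_intros bounded_linear_imp_has_derivative assms)
  show ?thesis
  proof (rule smooth_coinduct[where P="\<lambda>f. \<exists>g. smooth g \<and> f = (\<lambda>x. g (A x + c))"])
    show "\<exists>ga. smooth ga \<and> (\<lambda>x. g (A x + c)) = (\<lambda>x. ga (A x + c))" using assms by blast
    show "\<exists>g. smooth g \<and> f = (\<lambda>x. g (A x + c)) \<Longrightarrow> f differentiable at x" for f x
      using d differentiableI by blast
    show "\<exists>g. smooth g \<and> f = (\<lambda>x. g (A x + c)) \<Longrightarrow> \<exists>g. smooth g \<and> dd v f = (\<lambda>x. g (A x + c))" for f v
      using smooth_dd dd_eqI[OF d] by fast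
  qed
qed

lemma smooth_linear: "bounded_linear A \<Longrightarrow> smooth A"
proof -
  assume A: "bounded_linear A"
  have "dd v A = (\<lambda>x. A v)" for v
    using bounded_linear_imp_has_derivative[OF A] by (auto simp: fun_eq_iff dd_eqI)
  then show "smooth A"
    unfolding smooth_def
    by (metis A Ck_on_Suc_imp Ck_on_UNIV_Suc_iff bounded_linear_imp_differentiable smooth_const smooth_def)
qed

text \<open>The induction on \<open>k\<close> ranges over all \<open>g\<close> at once, because the
  chain rule produces \<open>dd 1 g\<close> composed with the same \<open>q\<close>, times a
  derivative of \<open>q\<close> that is smooth to every order.\<close>

lemma smooth_compose_real:
  fixes g :: "real \<Rightarrow> real" and q :: "'a::real_normed_vector \<Rightarrow> real"
  assumes "smooth g" "smooth q"
  shows "smooth (\<lambda>x. g (q x))"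
proof -
  have d: "((\<lambda>x. g (q x)) has_derivative (\<lambda>v. dd 1 g (q x) * dd v q x)) (at x)" if "smooth g"
    for g :: "real \<Rightarrow> real" and x
  proof -
    have "dd (dd v q x) g (q x) = dd 1 g (q x) * dd v q x" for v
      using dd_linear_combination[OF that, of "dd v q x" 1 0 0 "q x"] by simp
    then show ?thesis
      using has_derivative_compose[OF smooth_has_derivative[OF assms(2), of x] smooth_has_derivative[OF that]]
      by simp
  qed
  have "smooth g \<Longrightarrow> Ck_on k UNIV (\<lambda>x. g (q x))" for g :: "real \<Rightarrow> real" and k
  proof (induction k arbitrary: g)
    case 0
    then show ?case
      using smooth_continuous_on[of g UNIV] smooth_continuous_on[OF assms(2), of UNIV]
      by (auto intro: continuous_on_compose2)
  next
    case (Suc k)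
    have "dd v (\<lambda>x. g (q x)) = (\<lambda>x. dd 1 g (q x) * dd v q x)" for v
      using dd_eqI[OF d[OF Suc.prems]] by blast
    then show ?case
      using Suc.IH[OF smooth_dd[OF Suc.prems]] smooth_dd[OF assms(2)] d[OF Suc.prems]
      unfolding Ck_on_UNIV_Suc_iff smooth_def
      by (auto intro!: Ck_on_bilinear[OF bounded_bilinear_mult] differentiableI)
  qed
  then show ?thesis using assms(1) by (simp add: smooth_def)
qed

text \<open>The derivative of 1/q is a smooth function times two copies of 1/q, so order
  \<open>k\<close> of 1/q yields order \<open>k + 1\<close>.\<close>

lemma smooth_inverse:
  fixes q :: "'a::real_normed_vector \<Rightarrow> real"
  assumes "smooth q" "\<And>x. q x \<noteq> 0"
  shows "smooth (\<lambda>x. inverse (q x))"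
proof -
  have d: "((\<lambda>x. inverse (q x)) has_derivative (\<lambda>v. (- dd v q x) * (inverse (q x) * inverse (q x)))) (at x)" for x
    by (rule has_derivative_eq_rhs, rule Deriv.has_derivative_inverse[OF assms(2) smooth_has_derivative[OF assms(1)]])
       (simp add: fun_eq_iff)
  have "Ck_on k UNIV (\<lambda>x. inverse (q x))" for k
  proof (induction k)
    case 0
    then show ?case
      using smooth_continuous_on[OF assms(1), of UNIV] assms(2) by (auto intro!: continuous_intros)
  next
    case (Suc k)
    have "dd v (\<lambda>x. inverse (q x)) = (\<lambda>x. (- dd v q x) * (inverse (q x) * inverse (q x)))" for v
      using dd_eqI[OF d] by blast
    moreover have "smooth (\<lambda>x. - dd v q x)" for v
      using smooth_diff[OF smooth_const[of 0] smooth_dd[OF assms(1), of v]] by simp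
    moreover have "(\<lambda>x. inverse (q x)) differentiable (at x)" for x
      using d differentiableI by blast
    moreover have "Ck_on k UNIV (\<lambda>x. (- dd v q x) * (inverse (q x) * inverse (q x)))" if "smooth (\<lambda>x. - dd v q x)" for v
      using that Suc by (intro Ck_on_bilinear[OF bounded_bilinear_mult]) (auto simp: smooth_def)
    ultimately show ?case
      unfolding Ck_on_UNIV_Suc_iff by auto
  qed
  then show ?thesis by (simp add: smooth_def)
qed

lemma dd_mult:
  fixes f g :: "'a::real_normed_vector \<Rightarrow> real"
  assumes "smooth f" "smooth g"
  shows "dd v (\<lambda>x. f x * g x) x = f x * dd v g x + dd v f x * g x"
  by (rule dd_eqI has_derivative_mult smooth_has_derivative assms)+

lemma dd_sum:
  assumes "\<And>i. i \<in> I \<Longrightarrow> smooth (f i)"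
  shows "dd v (\<lambda>x. \<Sum>i\<in>I. f i x) x = (\<Sum>i\<in>I. dd v (f i) x)"
  by (rule dd_eqI has_derivative_sum smooth_has_derivative assms)+

lemma dd_diff:
  assumes "smooth f" "smooth g"
  shows "dd v (\<lambda>x. f x - g x) x = dd v f x - dd v g x"
  by (rule dd_eqI has_derivative_diff smooth_has_derivative assms)+

lemma dd_cong_open:
  assumes "open U" "x \<in> U" "\<And>y. y \<in> U \<Longrightarrow> f y = g y" "smooth g"
  shows "dd v f x = dd v g x"
  by (rule dd_eqI) (rule has_derivative_transform_within_open[OF smooth_has_derivative[OF assms(4)] assms(1,2)],
    simp add: assms(3))

subsection \<open>Bump functions\<close>

text \<open>The polynomial makes the family closed under differentiation, which sends
  \<open>p\<close> to X^2 (p - p').\<close>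

definition flat_exp :: "real poly \<Rightarrow> real \<Rightarrow> real" where
  "flat_exp p t = (if t > 0 then poly p (1 / t) * exp (- (1 / t)) else 0)"

lemma tendsto_poly_times_exp_minus: "((\<lambda>y::real. poly p y * exp (- y)) \<longlongrightarrow> 0) at_top"
proof -
  have "((\<lambda>y::real. \<Sum>i\<le>degree p. Polynomial.coeff p i * (y ^ i / exp y)) \<longlongrightarrow> (\<Sum>i\<le>degree p. Polynomial.coeff p i * 0)) at_top"
    by (intro tendsto_sum tendsto_mult tendsto_const tendsto_power_div_exp_0)
  then show ?thesis
    by (simp add: poly_altdef sum_distrib_right exp_minus divide_inverse mult.assoc)
qed

lemma flat_exp_has_derivative:
  "(flat_exp p has_real_derivative flat_exp ([:0, 0, 1:] * (p - pderiv p)) t) (at t)"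
proof -
  consider "t > 0" | "t < 0" | "t = 0" by linarith
  then show ?thesis
  proof cases
    case 1
    have "((\<lambda>t. poly p (1 / t) * exp (- (1 / t))) has_real_derivative
        flat_exp ([:0, 0, 1:] * (p - pderiv p)) t) (at t)"
      using 1 unfolding flat_exp_def
      by (auto intro!: derivative_eq_intros DERIV_chain'[OF _ poly_DERIV]
          simp: field_simps power2_eq_square)
    then show ?thesis
      by (rule has_field_derivative_transform_within_open[where S="{0<..}"]) (use 1 in \<open>auto simp: flat_exp_def\<close>)
  next
    case 2
    have "((\<lambda>t. 0) has_real_derivative flat_exp ([:0, 0, 1:] * (p - pderiv p)) t) (at t)"
      using 2 by (auto simp: flat_exp_def)
    then show ?thesis
      by (rule has_field_derivative_transform_within_open[where S="{..<0}"]) (use 2 in \<open>auto simp: flat_exp_def\<close>)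
  next
    \<comment> \<open>At 0 the difference quotient is a function of the same kind with
      \<open>p\<close> replaced by X p, because 1/h is the argument of the polynomial; it tends to 0
      from the right and vanishes on the left.\<close>
    case 3
    have "((\<lambda>y::real. poly ([:0,1:] * p) y * exp (- y)) \<longlongrightarrow> 0) at_top"
      by (rule tendsto_poly_times_exp_minus)
    then have "((\<lambda>h::real. poly ([:0,1:] * p) (inverse h) * exp (- (inverse h))) \<longlongrightarrow> 0) (at_right 0)"
      by (rule filterlim_compose[OF _ filterlim_inverse_at_top_right])
    then have "((\<lambda>h. flat_exp p h / h) \<longlongrightarrow> 0) (at_right 0)"
      by (rule Lim_transform_eventually)
         (auto simp: flat_exp_def eventually_at_filter field_simps)
    moreover have "((\<lambda>h. flat_exp p h / h) \<longlongrightarrow> 0) (at_left 0)"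
      by (rule Lim_transform_eventually[OF tendsto_const])
         (auto simp: flat_exp_def eventually_at_filter)
    ultimately have "((\<lambda>h. flat_exp p h / h) \<longlongrightarrow> 0) (at 0)"
      by (simp add: filterlim_split_at)
    then show ?thesis using 3 by (simp add: DERIV_def flat_exp_def)
  qed
qed

lemma smooth_flat_exp: "smooth (flat_exp p)"
\<comment> \<open>The factor \<open>c\<close> takes up the direction of differentiation, which is a
  number here.\<close>
proof (rule smooth_coinduct[where P="\<lambda>f. \<exists>p c. f = (\<lambda>t. c * flat_exp p t)"])
  have d: "((\<lambda>t. c * flat_exp p t) has_derivative
      (\<lambda>v. v * (c * flat_exp ([:0, 0, 1:] * (p - pderiv p)) t))) (at t)" for p t and c :: real
    using DERIV_cmult[OF flat_exp_has_derivative, of c p t]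
    unfolding has_field_derivative_def
    by (rule has_derivative_eq_rhs) (simp only: fun_eq_iff mult.commute, simp)
  show "\<exists>q c. flat_exp p = (\<lambda>t. c * flat_exp q t)"
    by (intro exI[of _ p] exI[of _ 1]) simp
  show "\<exists>p c. f = (\<lambda>t. c * flat_exp p t) \<Longrightarrow> f differentiable at x" for f x
    using d differentiableI by blast
  show "\<exists>p c. f = (\<lambda>t. c * flat_exp p t) \<Longrightarrow> \<exists>p c. dd v f = (\<lambda>t. c * flat_exp p t)" for f and v :: real
  proof -
    assume "\<exists>p c. f = (\<lambda>t. c * flat_exp p t)"
    then obtain p c where f: "f = (\<lambda>t. c * flat_exp p t)" by blast
    have "dd v f = (\<lambda>t. (v * c) * flat_exp ([:0, 0, 1:] * (p - pderiv p)) t)"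
      unfolding f using dd_eqI[OF d] by (simp add: fun_eq_iff mult.assoc)
    then show ?thesis by blast
  qed
qed

definition bump :: "real \<Rightarrow> real \<Rightarrow> real \<Rightarrow> real" where
  "bump a b t = flat_exp 1 (t - a) * flat_exp 1 (b - t)"

lemma bump_nonneg: "bump a b t \<ge> 0" and bump_pos_iff: "bump a b t > 0 \<longleftrightarrow> a < t \<and> t < b"
  by (auto simp: bump_def flat_exp_def)

lemma smooth_bump: "smooth (bump a b)"
  unfolding bump_def
  using smooth_affine[OF bounded_linear_ident smooth_flat_exp, of 1 "-a"]
    smooth_affine[OF bounded_linear_minus[OF bounded_linear_ident] smooth_flat_exp, of 1 b]
  by (auto intro!: smooth_mult)

text \<open>The standard smooth transition from 0 to 1. The denominator is positive since
  \<open>t\<close> or \<open>1 - t\<close> is.\<close>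

definition step :: "real \<Rightarrow> real" where
  "step t = flat_exp 1 t * inverse (flat_exp 1 t + flat_exp 1 (1 - t))"

lemma step_le_0: "t \<le> 0 \<Longrightarrow> step t = 0" and step_ge_1: "t \<ge> 1 \<Longrightarrow> step t = 1"
  by (auto simp: step_def flat_exp_def)

lemma smooth_step: "smooth step"
proof -
  have pos: "flat_exp 1 t + flat_exp 1 (1 - t) > 0" for t
    by (auto simp: flat_exp_def intro: add_pos_pos)
  have "smooth (\<lambda>t. flat_exp 1 (1 - t))"
    using smooth_affine[OF bounded_linear_minus[OF bounded_linear_ident] smooth_flat_exp, of 1 1] by simp
  then show ?thesis unfolding step_def[abs_def] using pos[THEN less_imp_neq]
    by (intro smooth_mult smooth_inverse smooth_add smooth_flat_exp) metis+
qed

text \<open>The squared distance keeps the function smooth at the centre. The argument of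
  \<open>step\<close> is at least 1 up to distance r and at most 0 from distance sqrt 2 r on; the
  bound 3/2 r used below avoids the root.\<close>

definition plateau :: "'a::real_inner \<Rightarrow> real \<Rightarrow> 'a \<Rightarrow> real" where
  "plateau c r x = step (2 - (inverse r)\<^sup>2 * ((x - c) \<bullet> (x - c)))"

lemma smooth_plateau: "smooth (plateau c r)"
proof -
  have "smooth (\<lambda>x. x - c)"
    by (rule smooth_diff[OF smooth_linear[OF bounded_linear_ident] smooth_const])
  then show ?thesis unfolding plateau_def
    by (intro smooth_compose_real[OF smooth_step] smooth_diff smooth_mult smooth_const) (auto intro!: smooth_inner)
qed

lemma plateau_eq_1: assumes "r > 0" "dist c x \<le> r" shows "plateau c r x = 1"
proof -
  have "(dist x c)\<^sup>2 \<le> r\<^sup>2" using assms by (intro power_mono) (auto simp: dist_commute)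
  then have "(x - c) \<bullet> (x - c) \<le> r\<^sup>2" by (simp add: dist_norm dot_square_norm)
  then show ?thesis using assms unfolding plateau_def
    by (intro step_ge_1) (simp add: field_simps power_inverse)
qed

lemma plateau_eq_0: assumes "r > 0" "dist c x \<ge> 3 / 2 * r" shows "plateau c r x = 0"
proof -
  have "(3/2 * r)\<^sup>2 \<le> (dist x c)\<^sup>2" using assms by (intro power_mono) (auto simp: dist_commute)
  moreover have "(3/2 * r)\<^sup>2 = 9/4 * r\<^sup>2" by (simp add: power2_eq_square)
  ultimately have "2 * r\<^sup>2 \<le> (x - c) \<bullet> (x - c)"
    using zero_le_power2[of r] unfolding dist_norm dot_square_norm by linarith
  then show ?thesis using assms unfolding plateau_def
    by (intro step_le_0) (simp add: field_simps power_inverse)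
qed

text \<open>Each new member is its plateau times the product of the factors 1 - plateau of the
  earlier ones, so the sum telescopes. It equals 1 wherever some plateau does, and no division by a
  sum is needed.\<close>

lemma smooth_partition_of_unity:
  fixes N :: "'a::real_inner set"
  assumes "finite N" "r > 0"
  shows "\<exists>\<rho>. (\<forall>c\<in>N. smooth (\<rho> c) \<and> (\<forall>x. dist c x \<ge> 2 * r \<longrightarrow> \<rho> c x = 0)) \<and>
     (\<forall>x. (\<Sum>c\<in>N. \<rho> c x) = 1 - (\<Prod>c\<in>N. (1 - plateau c r x)))"
  using assms(1)
proof (induction N)
  case empty
  then show ?case by simp
next
  case (insert c N)
  then obtain \<rho> where \<rho>: "\<forall>c\<in>N. smooth (\<rho> c) \<and> (\<forall>x. dist c x \<ge> 2 * r \<longrightarrow> \<rho> c x = 0)"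
    "\<forall>x. (\<Sum>c\<in>N. \<rho> c x) = 1 - (\<Prod>c\<in>N. (1 - plateau c r x))" by blast
  define \<rho>' where "\<rho>' = \<rho>(c := (\<lambda>x. plateau c r x * (\<Prod>c\<in>N. (1 - plateau c r x))))"
  have "smooth (\<rho>' c)"
    unfolding \<rho>'_def by (auto intro!: smooth_mult smooth_plateau smooth_prod smooth_diff)
  moreover have "\<rho>' c x = 0" if "dist c x \<ge> 2 * r" for x
    using that assms(2) by (simp add: \<rho>'_def plateau_eq_0)
  moreover have "(\<Sum>d\<in>insert c N. \<rho>' d x) = 1 - (\<Prod>c\<in>insert c N. (1 - plateau c r x))" for x
  proof -
    have "(\<Sum>d\<in>N. \<rho>' d x) = (\<Sum>d\<in>N. \<rho> d x)"
      using insert.hyps by (intro sum.cong) (auto simp: \<rho>'_def)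
    then show ?thesis using insert.hyps \<rho>(2) by (simp add: \<rho>'_def algebra_simps)
  qed
  moreover have "\<rho>' d = \<rho> d" if "d \<in> N" for d using that insert.hyps by (auto simp: \<rho>'_def)
  ultimately show ?case using \<rho>(1) by (intro exI[of _ \<rho>']) auto
qed

subsection \<open>Line integrals\<close>

text \<open>A Lebesgue integral over the whole line with an indicator, so that it applies to merely
  integrable \<open>f\<close> for almost every \<open>x\<close> and Fubini's theorem can be used
  directly.\<close>

definition lint :: "'a::euclidean_space \<Rightarrow> real \<Rightarrow> real \<Rightarrow> ('a \<Rightarrow> real) \<Rightarrow> 'a \<Rightarrow> real" where
  "lint v a b f x = (LINT t|lborel. indicator {a..b} t * f (x + t *\<^sub>R v))"

lemma smooth_continuous_on_compose:
  "smooth f \<Longrightarrow> continuous_on S h \<Longrightarrow> continuous_on S (\<lambda>x. f (h x))"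
  using continuous_on_compose2[OF smooth_continuous_on[of f UNIV]] by blast

lemma lint_eq_integral:
  assumes "continuous_on UNIV f"
  shows "lint v a b f x = integral {a..b} (\<lambda>t. f (x + t *\<^sub>R v))"
proof -
  have "continuous_on {a..b} (\<lambda>t. f (x + t *\<^sub>R v))"
    by (rule continuous_on_compose2[OF assms]) (auto intro!: continuous_intros)
  then have "set_integrable lborel {a..b} (\<lambda>t. f (x + t *\<^sub>R v))"
    by (rule borel_integrable_atLeastAtMost')
  from set_borel_integral_eq_integral(2)[OF this] show ?thesis
    by (simp add: lint_def set_lebesgue_integral_def)
qed

lemma lint_has_derivative:
  fixes f :: "'a::euclidean_space \<Rightarrow> real"
  assumes "smooth f"
  shows "(lint v a b f has_derivative (\<lambda>w. lint v a b (dd w f) x)) (at x)"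
proof -
  \<comment> \<open>\<open>leibniz_rule\<close> asks for the derivative as a jointly continuous
    function with values in the bounded linear maps.\<close>
  define D where "D x t = Blinfun (\<lambda>w. dd w f (x + t *\<^sub>R v))" for x t
  have bl: "bounded_linear (\<lambda>w. dd w f y)" for y
    using smooth_has_derivative[OF assms] has_derivative_bounded_linear by blast
  have D: "blinfun_apply (D x t) = (\<lambda>w. dd w f (x + t *\<^sub>R v))" for x t
    unfolding D_def by (rule bounded_linear_Blinfun_apply[OF bl])
  have der: "((\<lambda>x. f (x + t *\<^sub>R v)) has_derivative D x t) (at x within UNIV)" for x t
    unfolding D
    by (rule has_derivative_compose[OF _ smooth_has_derivative[OF assms], where f="\<lambda>x. x + t *\<^sub>R v"])
       (auto intro!: derivative_eq_intros)
  have cD: "continuous_on (UNIV \<times> cbox a b) (\<lambda>(x, t). D x t)"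
    unfolding case_prod_beta
    by (rule continuous_on_blinfun_componentwise, unfold D)
       (rule smooth_continuous_on_compose[OF smooth_dd[OF assms]], intro continuous_intros)
  have cD': "continuous_on (cbox a b) (D x)"
  proof -
    have "continuous_on (cbox a b) (\<lambda>t. case (x, t) of (x, t) \<Rightarrow> D x t)"
      by (rule continuous_on_compose2[OF cD]) (auto intro!: continuous_intros)
    then show ?thesis by simp
  qed
  have fi: "(\<lambda>t. f (x + t *\<^sub>R v)) integrable_on cbox a b" for x
    by (rule integrable_continuous, rule smooth_continuous_on_compose[OF assms], intro continuous_intros)
  have *: "((\<lambda>x. integral (cbox a b) (\<lambda>t. f (x + t *\<^sub>R v))) has_derivative integral (cbox a b) (D x)) (at x within UNIV)"
    by (rule leibniz_rule[OF der fi cD]) auto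
  have "blinfun_apply (integral (cbox a b) (D x)) w = lint v a b (dd w f) x" for w
  proof -
    have "blinfun_apply (integral (cbox a b) (D x)) w = integral (cbox a b) (\<lambda>t. D x t w)"
      by (rule integral_linear[symmetric, unfolded o_def, OF integrable_continuous[OF cD'] blinfun.bounded_linear_left])
    then show ?thesis
      using lint_eq_integral[OF smooth_continuous_on[OF smooth_dd[OF assms]]] by (simp add: D)
  qed
  moreover have "lint v a b f = (\<lambda>x. integral (cbox a b) (\<lambda>t. f (x + t *\<^sub>R v)))"
    using lint_eq_integral[OF smooth_continuous_on[OF assms]] by (simp add: fun_eq_iff)
  ultimately show ?thesis using *
    by (metis (no_types, lifting) ext)
qed

lemma dd_lint: "smooth f \<Longrightarrow> dd w (lint v a b f) x = lint v a b (dd w f) x"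
  by (rule dd_eqI[OF lint_has_derivative])

lemma smooth_lint: "smooth f \<Longrightarrow> smooth (lint v a b f)"
proof (rule smooth_coinduct[where P="\<lambda>h. \<exists>f. smooth f \<and> h = lint v a b f"])
  show "\<exists>f. smooth f \<and> h = lint v a b f \<Longrightarrow> h differentiable at x" for h x
    using lint_has_derivative differentiableI by blast
  show "\<exists>f. smooth f \<and> h = lint v a b f \<Longrightarrow> \<exists>f. smooth f \<and> dd w h = lint v a b f" for h w
    using smooth_dd dd_lint by blast
qed auto

lemma lint_dd:
  assumes "smooth f" "a \<le> b"
  shows "lint v a b (dd v f) x = f (x + b *\<^sub>R v) - f (x + a *\<^sub>R v)"
proof -
  have "((\<lambda>t. f (x + t *\<^sub>R v)) has_vector_derivative dd v f (x + t *\<^sub>R v)) (at t)" for t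
  proof -
    have "((\<lambda>t. f (x + t *\<^sub>R v)) has_derivative (\<lambda>s. dd (s *\<^sub>R v) f (x + t *\<^sub>R v))) (at t)"
      by (rule has_derivative_compose[OF _ smooth_has_derivative[OF assms(1)], where f="\<lambda>t. x + t *\<^sub>R v"])
         (auto intro!: derivative_eq_intros)
    then show ?thesis
      using dd_linear_combination[OF assms(1), of _ v 0 0] by (simp add: has_vector_derivative_def)
  qed
  then have "((\<lambda>t. dd v f (x + t *\<^sub>R v)) has_integral f (x + b *\<^sub>R v) - f (x + a *\<^sub>R v)) {a..b}"
    using assms(2) by (intro fundamental_theorem_of_calculus) (auto intro: has_vector_derivative_at_within)
  then show ?thesis
    using lint_eq_integral[OF smooth_continuous_on[OF smooth_dd[OF assms(1)]]] by (simp add: integral_unique)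
qed

text \<open>Integrated over a segment in direction \<open>w\<close>, both sides give the increment
  of \<open>dd v f\<close>, since \<open>dd v\<close> passes under the integral. The integrands at
  \<open>x\<close> are recovered by differentiating in the length of the segment at 0.\<close>

lemma dd_commute:
  fixes f :: "'a::euclidean_space \<Rightarrow> real"
  assumes "smooth f"
  shows "dd v (dd w f) x = dd w (dd v f) x"
proof -
  have eq: "lint w 0 t (dd v (dd w f)) x = lint w 0 t (dd w (dd v f)) x" if "t \<ge> 0" for t
  proof -
    have sm: "smooth (\<lambda>y. f (y + t *\<^sub>R w))" by (rule smooth_affine[OF bounded_linear_ident assms])
    have dt: "dd v (\<lambda>y. f (y + t *\<^sub>R w)) x = dd v f (x + t *\<^sub>R w)"
      by (rule dd_eqI, rule has_derivative_compose[OF _ smooth_has_derivative[OF assms], where f="\<lambda>y. y + t *\<^sub>R w"])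
         (auto intro!: derivative_eq_intros)
    have "lint w 0 t (dd v (dd w f)) x = dd v (lint w 0 t (dd w f)) x"
      by (simp add: dd_lint smooth_dd assms)
    also have "lint w 0 t (dd w f) = (\<lambda>y. f (y + t *\<^sub>R w) - f y)"
      using lint_dd[OF assms that, of w] by (simp add: fun_eq_iff)
    also have "dd v \<dots> x = dd v f (x + t *\<^sub>R w) - dd v f x"
      by (simp add: dd_diff[OF sm assms] dt)
    also have "\<dots> = lint w 0 t (dd w (dd v f)) x"
      using lint_dd[OF smooth_dd[OF assms] that, of w v x] by simp
    finally show ?thesis .
  qed
  have der: "((\<lambda>t. lint w 0 t g x) has_real_derivative g x) (at 0 within {0..1})" if "smooth g" for g
  proof -
    have "((\<lambda>t. integral {0..t} (\<lambda>s. g (x + s *\<^sub>R w))) has_real_derivative g (x + 0 *\<^sub>R w)) (at 0 within {0..1})"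
      by (rule integral_has_real_derivative)
         (auto intro!: smooth_continuous_on_compose[OF that] continuous_intros)
    then show ?thesis using lint_eq_integral[OF smooth_continuous_on[OF that]] by simp
  qed
  have "((\<lambda>t. lint w 0 t (dd v (dd w f)) x) has_real_derivative dd w (dd v f) x) (at 0 within {0..1})"
    by (rule has_field_derivative_transform_within[OF der[OF smooth_dd[OF smooth_dd[OF assms]]], of 1]) (auto simp: eq)
  with der[OF smooth_dd[OF smooth_dd[OF assms]], of v w]
  show ?thesis
    unfolding has_real_derivative_iff_has_vector_derivative
    by (intro vector_derivative_unique_within) (auto simp: trivial_limit_within)
qed

lemma lint_eq_0: "(\<And>t. t \<in> {a..b} \<Longrightarrow> f (x + t *\<^sub>R v) = 0) \<Longrightarrow> lint v a b f x = 0"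
  unfolding lint_def by (rule integral_eq_zero_AE) (auto simp: indicator_def)

lemma lint_eq_line_integral:
  "(\<And>t. t \<notin> {a..b} \<Longrightarrow> f (x + t *\<^sub>R v) = 0) \<Longrightarrow> lint v a b f x = (LINT t|lborel. f (x + t *\<^sub>R v))"
  unfolding lint_def by (rule Bochner_Integration.integral_cong) (auto simp: indicator_def)

section \<open>Line integrals of integrable and square integrable functions\<close>

lemma lborel_integral_shift:
  fixes c :: "'a::euclidean_space"
  shows "(LINT x|lborel. f (x + c)) = (LINT x|lborel. f x :: real)"
proof (cases "f \<in> borel_measurable borel")
  case True
  have "(LINT x|lborel. f x) = (LINT x|distr lborel borel ((+) c). f x)"
    by (simp add: lborel_distr_plus)
  also have "\<dots> = (LINT x|lborel. f (c + x))"
    using True by (subst integral_distr) auto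
  finally show ?thesis by (simp add: add.commute)
next
  \<comment> \<open>Without measurability neither function is integrable, and both integrals are 0
    by convention.\<close>
  case False
  have "(\<lambda>x. f (x + c)) \<notin> borel_measurable borel"
  proof
    assume "(\<lambda>x. f (x + c)) \<in> borel_measurable borel"
    then have "(\<lambda>x. f ((x + - c) + c)) \<in> borel_measurable borel"
      by (rule measurable_compose_rev) simp
    with False show False by simp
  qed
  with False have "\<not> integrable lborel (\<lambda>x. f (x + c))" "\<not> integrable lborel f"
    using borel_measurable_integrable by fastforce+
  then show ?thesis by (simp add: not_integrable_integral_eq)
qed

lemma lborel_integrable_shift:
  fixes c :: "'a::euclidean_space" and f :: "'a \<Rightarrow> real"
  assumes "integrable lborel f" shows "integrable lborel (\<lambda>x. f (x + c))"
proof -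
  have "integrable (distr lborel borel ((+) c)) f" using assms by (simp add: lborel_distr_plus)
  then have "integrable lborel (\<lambda>x. f (c + x))"
    using assms by (subst (asm) integrable_distr_eq) auto
  then show ?thesis by (simp add: add.commute)
qed

lemma measurable_line_pair [measurable]:
  fixes f :: "'a::euclidean_space \<Rightarrow> real"
  assumes [measurable]: "f \<in> borel_measurable borel"
  shows "(\<lambda>(x, t). f (x + t *\<^sub>R v)) \<in> borel_measurable (lborel \<Otimes>\<^sub>M lborel)"
    and "(\<lambda>(t, x). f (x + t *\<^sub>R v)) \<in> borel_measurable (lborel \<Otimes>\<^sub>M lborel)"
  by measurable

lemma borel_measurable_lint [measurable]:
  fixes f :: "'a::euclidean_space \<Rightarrow> real"
  assumes [measurable]: "f \<in> borel_measurable borel"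
  shows "lint v a b f \<in> borel_measurable borel"
  unfolding lint_def by measurable

lemma integrable_indicator_Icc: "integrable lborel (indicator {a..b::real} :: real \<Rightarrow> real)"
  by (simp add: integrable_indicator_iff emeasure_lborel_Icc_eq)

text \<open>Tonelli's criterion: the slices have uniformly bounded norms and the strip has finite
  width.\<close>

lemma integrable_strip:
  fixes F :: "real \<Rightarrow> 'a::euclidean_space \<Rightarrow> real"
  assumes [measurable]: "(\<lambda>(t, x). F t x) \<in> borel_measurable (lborel \<Otimes>\<^sub>M lborel)"
    and int: "\<And>t. integrable lborel (F t)" and bd: "\<And>t. (LINT x|lborel. \<bar>F t x\<bar>) \<le> D"
  shows "integrable (lborel \<Otimes>\<^sub>M lborel) (\<lambda>(t, x). indicator {a..b} t * F t x)"
proof (rule lborel_pair.Fubini_integrable)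
  have [measurable]: "(\<lambda>x. F (fst x) (snd x)) \<in> borel_measurable (lborel \<Otimes>\<^sub>M lborel)"
    using assms(1) by (simp add: case_prod_beta)
  show "(\<lambda>(t, x). indicator {a..b} t * F t x) \<in> borel_measurable (lborel \<Otimes>\<^sub>M lborel)"
    unfolding case_prod_beta by measurable
  show "AE t in lborel. integrable lborel (\<lambda>x. case (t, x) of (t, x) \<Rightarrow> indicator {a..b} t * F t x)"
    using int by simp
  have "integrable lborel (\<lambda>t. (LINT x|lborel. \<bar>F t x\<bar>) * indicator {a..b} t)"
  proof (rule Bochner_Integration.integrable_bound[where f="\<lambda>t. D * indicator {a..b} t"])
    show "integrable lborel (\<lambda>t. D * indicator {a..b} t :: real)"
      by (intro integrable_mult_right integrable_indicator_Icc)
    show "(\<lambda>t. (LINT x|lborel. \<bar>F t x\<bar>) * indicator {a..b} t) \<in> borel_measurable lborel"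
      by measurable
    show "AE t in lborel. norm ((LINT x|lborel. \<bar>F t x\<bar>) * indicator {a..b} t)
        \<le> norm (D * indicator {a..b} t)"
      using bd by (intro AE_I2) (auto simp: indicator_def intro: order_trans[OF _ abs_ge_self])
  qed
  then show "integrable lborel (\<lambda>t. LINT x|lborel. norm (case (t, x) of (t, x) \<Rightarrow> indicator {a..b} t * F t x))"
    by (rule Bochner_Integration.integrable_cong[THEN iffD1, rotated -1]) (auto simp: indicator_def)
qed

lemma integral_abs_mult_le:
  fixes f g :: "'a \<Rightarrow> real"
  assumes f: "integrable M f" and [measurable]: "g \<in> borel_measurable M" and C: "\<And>x. \<bar>g x\<bar> \<le> C"
  shows "integrable M (\<lambda>x. f x * g x)" and "(LINT x|M. \<bar>f x * g x\<bar>) \<le> C * (LINT x|M. \<bar>f x\<bar>)"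
proof -
  have C0: "C \<ge> 0" using C[of undefined] by linarith
  have le: "\<bar>f x * g x\<bar> \<le> C * \<bar>f x\<bar>" for x
    using mult_left_mono[OF C[of x], of "\<bar>f x\<bar>"] by (simp add: abs_mult mult.commute)
  have [measurable]: "f \<in> borel_measurable M" using f by auto
  have I: "integrable M (\<lambda>x. C * \<bar>f x\<bar>)" using f by simp
  show fg: "integrable M (\<lambda>x. f x * g x)"
    by (rule Bochner_Integration.integrable_bound[OF I]) (auto intro!: AE_I2 order_trans[OF le])
  have "(LINT x|M. \<bar>f x * g x\<bar>) \<le> (LINT x|M. C * \<bar>f x\<bar>)"
    by (rule integral_mono) (use fg I le in auto)
  then show "(LINT x|M. \<bar>f x * g x\<bar>) \<le> C * (LINT x|M. \<bar>f x\<bar>)" by simp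
qed

lemma lint_pair_integrable:
  fixes f g :: "'a::euclidean_space \<Rightarrow> real"
  assumes f: "integrable lborel f" and g [measurable]: "g \<in> borel_measurable borel"
    and C: "\<And>x. \<bar>g x\<bar> \<le> C"
  shows "integrable (lborel \<Otimes>\<^sub>M lborel) (\<lambda>(t, x). indicator {a..b} t * (f (x + t *\<^sub>R v) * g x))"
proof (rule integrable_strip)
  have [measurable]: "f \<in> borel_measurable borel" using f by auto
  show "(\<lambda>(t, x). f (x + t *\<^sub>R v) * g x) \<in> borel_measurable (lborel \<Otimes>\<^sub>M lborel)" by measurable
  show "integrable lborel (\<lambda>x. f (x + t *\<^sub>R v) * g x)" for t
    by (rule integral_abs_mult_le[OF lborel_integrable_shift[OF f] _ C]) simp
  show "(LINT x|lborel. \<bar>f (x + t *\<^sub>R v) * g x\<bar>) \<le> C * (LINT x|lborel. \<bar>f x\<bar>)" for t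
    using integral_abs_mult_le(2)[OF lborel_integrable_shift[OF f, of "t *\<^sub>R v"] _ C]
      lborel_integral_shift[of "\<lambda>x. \<bar>f x\<bar>" "t *\<^sub>R v"] by simp
qed

text \<open>The transpose of a line integral is the line integral over the reflected segment:
  exchange the integrals, translate by t v, and replace t by -t. It carries operators from test
  functions over to integrable fields.\<close>

lemma lint_dual:
  fixes f g :: "'a::euclidean_space \<Rightarrow> real"
  assumes f: "integrable lborel f" and g [measurable]: "g \<in> borel_measurable borel"
    and C: "\<And>x. \<bar>g x\<bar> \<le> C"
  shows "(LINT x|lborel. lint v a b f x * g x) = (LINT x|lborel. f x * lint v (- b) (- a) g x)"
    and "integrable lborel (\<lambda>x. lint v a b f x * g x)"
proof -
  have [measurable]: "f \<in> borel_measurable borel" using f by auto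
  let ?F = "\<lambda>t x. indicator {a..b} t * (f (x + t *\<^sub>R v) * g x)"
  have I: "integrable (lborel \<Otimes>\<^sub>M lborel) (\<lambda>(t, x). ?F t x)"
    by (rule lint_pair_integrable[OF f g C])
  have eq: "(LINT t|lborel. ?F t x) = lint v a b f x * g x" for x
    unfolding lint_def by (subst integral_mult_left_zero[symmetric]) (simp add: mult.assoc)
  show "integrable lborel (\<lambda>x. lint v a b f x * g x)"
    using lborel_pair.integrable_snd[OF I] by (simp add: eq)
  have I2: "integrable (lborel \<Otimes>\<^sub>M lborel) (\<lambda>(t, x). indicator {- b..- a} t * (g (x + t *\<^sub>R v) * f x))"
  proof (rule integrable_strip)
    show "(\<lambda>(t, x). g (x + t *\<^sub>R v) * f x) \<in> borel_measurable (lborel \<Otimes>\<^sub>M lborel)" by measurable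
    show "integrable lborel (\<lambda>x. g (x + t *\<^sub>R v) * f x)" for t
      using integral_abs_mult_le(1)[OF f, of "\<lambda>x. g (x + t *\<^sub>R v)" C] C by (simp add: mult.commute)
    show "(LINT x|lborel. \<bar>g (x + t *\<^sub>R v) * f x\<bar>) \<le> C * (LINT x|lborel. \<bar>f x\<bar>)" for t
      using integral_abs_mult_le(2)[OF f, of "\<lambda>x. g (x + t *\<^sub>R v)" C] C by (simp add: mult.commute)
  qed
  have eq2: "(LINT t|lborel. indicator {- b..- a} t * (g (x + t *\<^sub>R v) * f x)) = f x * lint v (- b) (- a) g x" for x
    unfolding lint_def by (subst mult.commute, subst integral_mult_left_zero[symmetric]) (simp add: mult.assoc)
  have sh: "(LINT x|lborel. ?F t x) = (LINT x|lborel. indicator {a..b} t * (f x * g (x - t *\<^sub>R v)))" for t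
    using lborel_integral_shift[of "\<lambda>x. indicator {a..b} t * (f x * g (x - t *\<^sub>R v))" "t *\<^sub>R v"] by simp
  have "(LINT x|lborel. lint v a b f x * g x) = (LINT x|lborel. LINT t|lborel. ?F t x)"
    by (simp add: eq)
  also have "\<dots> = (LINT t|lborel. LINT x|lborel. ?F t x)"
    by (rule lborel_pair.Fubini_integral[OF I])
  also have "\<dots> = (LINT t|lborel. LINT x|lborel. indicator {a..b} t * (f x * g (x - t *\<^sub>R v)))"
    by (simp only: sh)
  also have "\<dots> = (LINT t|lborel. LINT x|lborel. indicator {a..b} (- t) * (f x * g (x + t *\<^sub>R v)))"
    using lborel_integral_real_affine[of "-1" "\<lambda>t. LINT x|lborel. indicator {a..b} t * (f x * g (x - t *\<^sub>R v))" 0] by simp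
  also have "\<dots> = (LINT t|lborel. LINT x|lborel. indicator {- b..- a} t * (g (x + t *\<^sub>R v) * f x))"
    by (intro Bochner_Integration.integral_cong) (auto simp: indicator_def)
  also have "\<dots> = (LINT x|lborel. LINT t|lborel. indicator {- b..- a} t * (g (x + t *\<^sub>R v) * f x))"
    by (rule lborel_pair.Fubini_integral[OF I2, symmetric])
  also have "\<dots> = (LINT x|lborel. f x * lint v (- b) (- a) g x)"
    by (simp add: eq2)
  finally show "(LINT x|lborel. lint v a b f x * g x) = (LINT x|lborel. f x * lint v (- b) (- a) g x)" .
qed

lemma lint_const: "a \<le> b \<Longrightarrow> lint v a b (\<lambda>x. c) x = (b - a) * c"
  by (simp add: lint_def)

lemma integrable_lint: "integrable lborel f \<Longrightarrow> integrable lborel (lint v a b f)"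
  using lint_dual(2)[of f "\<lambda>x. 1" 1 v a b] by simp

lemma integral_lint:
  "integrable lborel f \<Longrightarrow> a \<le> b \<Longrightarrow> (LINT x|lborel. lint v a b f x) = (b - a) * (LINT x|lborel. f x)"
  using lint_dual(1)[of f "\<lambda>x. 1" 1 v a b] by (simp add: lint_const mult.commute)

lemma abs_lint_le:
  assumes "\<And>x. \<bar>f x\<bar> \<le> C" "a \<le> b"
  shows "\<bar>lint v a b f x\<bar> \<le> (b - a) * C"
proof -
  have "C \<ge> 0" using assms(1)[of undefined] by linarith
  show ?thesis
  proof (cases "integrable lborel (\<lambda>t. indicator {a..b} t * f (x + t *\<^sub>R v))")
    case True
    have "norm (lint v a b f x) \<le> (LINT t|lborel. indicator {a..b} t * C)"
      unfolding lint_def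
      by (rule Bochner_Integration.integral_norm_bound_integral[OF True integrable_mult_left[OF integrable_indicator_Icc]])
         (use assms \<open>C \<ge> 0\<close> in \<open>auto simp: indicator_def\<close>)
    then show ?thesis using assms(2) by simp
  next
    case False
    then show ?thesis using \<open>C \<ge> 0\<close> assms(2) by (simp add: lint_def not_integrable_integral_eq)
  qed
qed

text \<open>Cauchy--Schwarz, obtained from the nonnegativity of the variance of \<open>f\<close> on
  the segment. If \<open>f\<close> is not integrable there, the left side is 0 by
  convention.\<close>

lemma lint_square_le:
  assumes "integrable lborel (\<lambda>t. indicator {a..b} t * (f (x + t *\<^sub>R v))\<^sup>2)" "a < b"
  shows "(lint v a b f x)\<^sup>2 \<le> (b - a) * lint v a b (\<lambda>x. (f x)\<^sup>2) x"
proof (cases "integrable lborel (\<lambda>t. indicator {a..b} t * f (x + t *\<^sub>R v))")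
  case True
  \<comment> \<open>The mean value of \<open>f\<close> on the segment.\<close>
  define c where "c = lint v a b f x / (b - a)"
  have L: "lint v a b f x = c * (b - a)" using assms(2) by (simp add: c_def)
  have "0 \<le> (LINT t|lborel. indicator {a..b} t * (f (x + t *\<^sub>R v) - c)\<^sup>2)"
    by (rule Bochner_Integration.integral_nonneg) (auto simp: indicator_def)
  also have "\<dots> = (LINT t|lborel. indicator {a..b} t * (f (x + t *\<^sub>R v))\<^sup>2
      - (2 * c) * (indicator {a..b} t * f (x + t *\<^sub>R v)) + indicator {a..b} t * c\<^sup>2)"
    by (intro Bochner_Integration.integral_cong) (auto simp: power2_eq_square algebra_simps)
  also have "\<dots> = lint v a b (\<lambda>x. (f x)\<^sup>2) x - 2 * c * lint v a b f x + (b - a) * c\<^sup>2"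
    using True assms unfolding lint_def by simp
  finally have "0 \<le> (b - a) * (lint v a b (\<lambda>x. (f x)\<^sup>2) x - 2 * c * lint v a b f x + (b - a) * c\<^sup>2)"
    using assms(2) by simp
  also have "\<dots> = (b - a) * lint v a b (\<lambda>x. (f x)\<^sup>2) x - (lint v a b f x)\<^sup>2"
    by (simp add: L power2_eq_square algebra_simps)
  finally show ?thesis by simp
next
  case False
  then have "lint v a b f x = 0" by (simp add: lint_def not_integrable_integral_eq)
  moreover have "0 \<le> lint v a b (\<lambda>x. (f x)\<^sup>2) x"
    unfolding lint_def by (rule Bochner_Integration.integral_nonneg) (auto simp: indicator_def)
  ultimately show ?thesis using assms(2) by simp
qed

text \<open>By Fubini the square is integrable on almost every segment, so
  \<open>lint_square_le\<close> applies there, and its right side is integrable by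
  \<open>integrable_lint\<close>.\<close>

lemma square_integrable_lint:
  fixes f :: "'a::euclidean_space \<Rightarrow> real"
  assumes [measurable]: "f \<in> borel_measurable borel" and f: "integrable lborel (\<lambda>x. (f x)\<^sup>2)" and "a < b"
  shows "integrable lborel (\<lambda>x. (lint v a b f x)\<^sup>2)"
proof (rule Bochner_Integration.integrable_bound)
  show "integrable lborel (\<lambda>x. (b - a) * lint v a b (\<lambda>x. (f x)\<^sup>2) x)"
    using integrable_lint[OF f] by simp
  have "integrable (lborel \<Otimes>\<^sub>M lborel) (\<lambda>(t, x). indicator {a..b} t * ((f (x + t *\<^sub>R v))\<^sup>2 * 1))"
    by (rule lint_pair_integrable[OF f, of "\<lambda>x. 1" 1]) auto
  then have "integrable (lborel \<Otimes>\<^sub>M lborel) (\<lambda>(x, t). indicator {a..b} t * ((f (x + t *\<^sub>R v))\<^sup>2))"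
    using lborel_pair.integrable_product_swap_iff by (fastforce simp: case_prod_beta)
  from lborel_pair.AE_integrable_fst'[OF this]
  have "AE x in lborel. integrable lborel (\<lambda>t. indicator {a..b} t * (f (x + t *\<^sub>R v))\<^sup>2)"
    by simp
  then show "AE x in lborel. norm ((lint v a b f x)\<^sup>2) \<le> norm ((b - a) * lint v a b (\<lambda>x. (f x)\<^sup>2) x)"
  proof eventually_elim
    case (elim x)
    show ?case
      using order_trans[OF lint_square_le[OF elim \<open>a < b\<close>] abs_ge_self] by simp
  qed
  show "(\<lambda>x. (lint v a b f x)\<^sup>2) \<in> borel_measurable lborel" by measurable
qed

subsection \<open>Test functions\<close>

lemma integral_pos_continuous:
  fixes f :: "'a::euclidean_space \<Rightarrow> real"
  assumes c: "continuous_on UNIV f" and i: "integrable lborel f" and nn: "\<And>x. f x \<ge> 0" and y: "f y > 0"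
  shows "(LINT x|lborel. f x) > 0"
proof (rule ccontr)
  assume "\<not> ?thesis"
  moreover have "0 \<le> (LINT x|lborel. f x)" using nn by simp
  ultimately have "(LINT x|lborel. f x) = 0" by linarith
  then have "AE x in lborel. f x = 0"
    using integral_nonneg_eq_0_iff_AE[OF i] nn by simp
  then have "AE x in lebesgue. f x = 0" by (rule AE_completion)
  then have "negligible {x. f x \<noteq> 0}"
    unfolding eventually_ae_filter by (auto simp: negligible_iff_null_sets[symmetric] intro: negligible_subset)
  moreover have "open {x. f x \<noteq> 0}"
    using c by (intro open_Collect_neq continuous_on_const) auto
  ultimately show False using open_not_negligible y by fastforce
qed

lemma integrable_compact_support:
  fixes f :: "'a::euclidean_space \<Rightarrow> real"
  assumes "continuous_on UNIV f" "compact C" "\<And>x. x \<notin> C \<Longrightarrow> f x = 0"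
  shows "integrable lborel f"
proof -
  have "integrable lborel (\<lambda>x. indicator C x *\<^sub>R f x)"
    using borel_integrable_compact[OF assms(2)] assms(1) continuous_on_subset by blast
  moreover have "(\<lambda>x. indicator C x *\<^sub>R f x) = f"
    using assms(3) by (auto simp: fun_eq_iff indicator_def)
  ultimately show ?thesis by simp
qed

lemma bounded_compact_support:
  fixes f :: "'a::euclidean_space \<Rightarrow> real"
  assumes "continuous_on UNIV f" "compact C" "\<And>x. x \<notin> C \<Longrightarrow> f x = 0"
  obtains B where "\<And>x. \<bar>f x\<bar> \<le> B"
proof -
  have "bounded (f ` C)"
    using compact_continuous_image[OF continuous_on_subset[OF assms(1)] assms(2)] compact_imp_bounded by blast
  then obtain B where "\<And>x. x \<in> C \<Longrightarrow> \<bar>f x\<bar> \<le> B" by (auto simp: bounded_iff)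
  then have "\<bar>f x\<bar> \<le> max B 0" for x using assms(3)[of x] by (cases "x \<in> C") fastforce+
  then show ?thesis using that by blast
qed

definition nbump :: "real \<Rightarrow> real \<Rightarrow> real \<Rightarrow> real" where
  "nbump a b t = bump a b t / (LINT s|lborel. bump a b s)"

lemma bump_eq_0: "t \<notin> {a..b} \<Longrightarrow> bump a b t = 0"
  using bump_pos_iff[of a b t] bump_nonneg[of a b t] by fastforce

lemma nbump_eq_0: "t \<notin> {a..b} \<Longrightarrow> nbump a b t = 0"
  by (simp add: nbump_def bump_eq_0)

lemma integral_bump_pos:
  assumes "a < b" shows "(LINT s|lborel. bump a b s) > 0"
  by (rule integral_pos_continuous[OF _ integrable_compact_support[OF _ compact_Icc bump_eq_0], where y="(a+b)/2"])
     (use assms in \<open>auto simp: bump_pos_iff bump_nonneg smooth_continuous_on[OF smooth_bump]\<close>)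

lemma smooth_nbump: "smooth (nbump a b)"
  using smooth_mult[OF smooth_bump smooth_const] unfolding nbump_def[abs_def] divide_inverse .

lemma integral_nbump: "a < b \<Longrightarrow> (LINT s|lborel. nbump a b s) = 1"
  using integral_bump_pos[of a b] by (simp add: nbump_def)

lemma nbump_nonneg: "a < b \<Longrightarrow> nbump a b t \<ge> 0"
  using integral_bump_pos[of a b] bump_nonneg[of a b t] by (simp add: nbump_def)

lemma nbump_pos: "a < t \<Longrightarrow> t < b \<Longrightarrow> nbump a b t > 0"
  using integral_bump_pos[of a b] bump_pos_iff[of a b t] by (simp add: nbump_def)

lemma test_smooth: "\<phi> \<in> test_functions \<Omega> \<Longrightarrow> smooth \<phi>"
  by (simp add: test_functions_def)

lemma test_functionsI:
  assumes "smooth \<phi>" "compact C" "C \<subseteq> \<Omega>" "\<And>x. x \<notin> C \<Longrightarrow> \<phi> x = 0"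
  shows "\<phi> \<in> test_functions \<Omega>"
proof -
  have "closure {x. \<phi> x \<noteq> 0} \<subseteq> C"
    using assms by (intro closure_minimal compact_imp_closed) auto
  moreover from this have "compact (closure {x. \<phi> x \<noteq> 0})"
    using assms(2) by (metis bounded_subset closed_closure compact_eq_bounded_closed)
  ultimately show ?thesis using assms unfolding test_functions_def by auto
qed

lemma test_functionsE:
  assumes "\<phi> \<in> test_functions \<Omega>"
  obtains C where "compact C" "C \<subseteq> \<Omega>" "\<And>x. x \<notin> C \<Longrightarrow> \<phi> x = 0"
proof (rule that)
  show "compact (closure {x. \<phi> x \<noteq> 0})" "closure {x. \<phi> x \<noteq> 0} \<subseteq> \<Omega>"
    using assms by (simp_all add: test_functions_def)
  show "\<phi> x = 0" if "x \<notin> closure {x. \<phi> x \<noteq> 0}" for x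
    using that closure_subset[of "{x. \<phi> x \<noteq> 0}"] by blast
qed

lemma test_mono: "\<phi> \<in> test_functions Q \<Longrightarrow> Q \<subseteq> \<Omega> \<Longrightarrow> \<phi> \<in> test_functions \<Omega>"
  by (auto simp: test_functions_def)

lemma test_eq_0:
  assumes "\<phi> \<in> test_functions \<Omega>" "x \<notin> \<Omega>" shows "\<phi> x = 0"
proof (rule test_functionsE[OF assms(1)])
  fix C assume "C \<subseteq> \<Omega>" "\<And>x. x \<notin> C \<Longrightarrow> \<phi> x = 0"
  then show "\<phi> x = 0" using assms(2) by blast
qed

lemma test_mult:
  assumes "\<phi> \<in> test_functions \<Omega>" "smooth \<eta>"
  shows "(\<lambda>x. \<eta> x * \<phi> x) \<in> test_functions \<Omega>"
proof -
  obtain C where C: "compact C" "C \<subseteq> \<Omega>" "\<And>x. x \<notin> C \<Longrightarrow> \<phi> x = 0"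
    using test_functionsE[OF assms(1)] by blast
  show ?thesis
    by (rule test_functionsI[OF smooth_mult[OF assms(2) test_smooth[OF assms(1)]] C(1,2)]) (simp add: C(3))
qed

text \<open>The set \<open>D\<close> may stick out of \<Omega>; only its part inside \<Omega> has to
  lie in \<open>Q\<close>. This is what makes cutting off possible for charts that touch the
  boundary.\<close>

lemma test_mult_local:
  assumes "\<phi> \<in> test_functions \<Omega>" "smooth \<eta>" "closed D" "\<And>x. x \<notin> D \<Longrightarrow> \<eta> x = 0" "\<Omega> \<inter> D \<subseteq> Q"
  shows "(\<lambda>x. \<eta> x * \<phi> x) \<in> test_functions Q"
proof -
  obtain C where C: "compact C" "C \<subseteq> \<Omega>" "\<And>x. x \<notin> C \<Longrightarrow> \<phi> x = 0"
    using test_functionsE[OF assms(1)] by blast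
  show ?thesis
    by (rule test_functionsI[OF smooth_mult[OF assms(2) test_smooth[OF assms(1)]] compact_Int_closed[OF C(1) assms(3)]])
       (use C assms in auto)
qed

lemma dd_eq_0_open:
  assumes "open U" "x \<in> U" "\<And>y. y \<in> U \<Longrightarrow> f y = 0" shows "dd v f x = 0"
  using dd_cong_open[OF assms(1,2), of f "\<lambda>x. 0"] assms(3) by simp

lemma test_dd:
  assumes "\<phi> \<in> test_functions \<Omega>" shows "dd v \<phi> \<in> test_functions \<Omega>"
proof -
  obtain C where C: "compact C" "C \<subseteq> \<Omega>" "\<And>x. x \<notin> C \<Longrightarrow> \<phi> x = 0"
    using test_functionsE[OF assms] by blast
  have "dd v \<phi> x = 0" if "x \<notin> C" for x
    by (rule dd_eq_0_open[of "- C"]) (use that C compact_imp_closed in auto)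
  then show ?thesis using test_functionsI[OF smooth_dd[OF test_smooth[OF assms]] C(1,2)] by blast
qed

lemma test_add:
  assumes "\<phi> \<in> test_functions \<Omega>" "\<psi> \<in> test_functions \<Omega>"
  shows "(\<lambda>x. \<phi> x + \<psi> x) \<in> test_functions \<Omega>"
proof -
  obtain C where C: "compact C" "C \<subseteq> \<Omega>" "\<And>x. x \<notin> C \<Longrightarrow> \<phi> x = 0"
    using test_functionsE[OF assms(1)] by blast
  obtain D where D: "compact D" "D \<subseteq> \<Omega>" "\<And>x. x \<notin> D \<Longrightarrow> \<psi> x = 0"
    using test_functionsE[OF assms(2)] by blast
  show ?thesis
    by (rule test_functionsI[OF smooth_add[OF assms[THEN test_smooth]] compact_Un[OF C(1) D(1)]]) (use C D in auto)
qed

lemma test_scale: "\<phi> \<in> test_functions \<Omega> \<Longrightarrow> (\<lambda>x. c * \<phi> x) \<in> test_functions \<Omega>"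
  using test_mult[OF _ smooth_const] .

lemma test_zero: "(\<lambda>x. 0) \<in> test_functions \<Omega>"
  by (rule test_functionsI[of _ "{}"]) auto

lemma test_sum:
  "(\<And>i. i \<in> I \<Longrightarrow> \<phi> i \<in> test_functions \<Omega>) \<Longrightarrow> (\<lambda>x. \<Sum>i\<in>I. \<phi> i x) \<in> test_functions \<Omega>"
  by (induction I rule: infinite_finite_induct) (auto simp: test_zero test_add)

lemma test_measurable: "\<phi> \<in> test_functions \<Omega> \<Longrightarrow> \<phi> \<in> borel_measurable borel"
  by (intro borel_measurable_continuous_onI smooth_continuous_on test_smooth)

lemma test_integrable:
  assumes "\<phi> \<in> test_functions \<Omega>" shows "integrable lborel \<phi>"
proof (rule test_functionsE[OF assms])
  fix C assume "compact C" "\<And>x. x \<notin> C \<Longrightarrow> \<phi> x = 0"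
  then show ?thesis
    by (rule integrable_compact_support[OF smooth_continuous_on[OF test_smooth[OF assms]]])
qed

lemma test_bounded:
  assumes "\<phi> \<in> test_functions \<Omega>"
  obtains B where "\<And>x. \<bar>\<phi> x\<bar> \<le> B"
proof -
  obtain C where C: "compact C" "C \<subseteq> \<Omega>" "\<And>x. x \<notin> C \<Longrightarrow> \<phi> x = 0"
    using test_functionsE[OF assms] by blast
  show ?thesis
    by (rule bounded_compact_support[OF smooth_continuous_on[OF test_smooth[OF assms]] C(1,3)]) (use that in blast)+
qed

lemma integrable_mult_test:
  assumes "integrable lborel f" "\<phi> \<in> test_functions \<Omega>"
  shows "integrable lborel (\<lambda>x. f x * \<phi> x :: real)"
proof -
  obtain B where "\<And>x. \<bar>\<phi> x\<bar> \<le> B" using test_bounded[OF assms(2)] by blast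
  then show ?thesis
    using test_measurable[OF assms(2)] by (intro integral_abs_mult_le(1)[OF assms(1)]) auto
qed

text \<open>Averaging over a unit segment leaves the integral unchanged and turns the derivative
  into a difference of two translates of \<phi>, whose integrals agree.\<close>

lemma integral_dd_test:
  assumes "\<phi> \<in> test_functions \<Omega>" shows "(LINT x|lborel. dd v \<phi> x) = 0"
proof -
  have "(LINT x|lborel. dd v \<phi> x) = (LINT x|lborel. lint v 0 1 (dd v \<phi>) x)"
    using integral_lint[OF test_integrable[OF test_dd[OF assms]], of 0 1 v v] by simp
  also have "\<dots> = (LINT x|lborel. \<phi> (x + v) - \<phi> x)"
    using lint_dd[OF test_smooth[OF assms], of 0 1 v] by simp
  also have "\<dots> = 0"
    using test_integrable[OF assms] lborel_integrable_shift[OF test_integrable[OF assms]]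
    by (simp add: lborel_integral_shift)
  finally show ?thesis .
qed

lemma integral_by_parts_test:
  assumes "\<phi> \<in> test_functions \<Omega>" "smooth P"
  shows "(LINT x|lborel. P x * dd v \<phi> x) = - (LINT x|lborel. dd v P x * \<phi> x)"
proof -
  have "0 = (LINT x|lborel. dd v (\<lambda>x. P x * \<phi> x) x)"
    by (rule integral_dd_test[OF test_mult[OF assms], symmetric])
  also have "\<dots> = (LINT x|lborel. P x * dd v \<phi> x + dd v P x * \<phi> x)"
    by (simp add: dd_mult assms test_smooth[OF assms(1)])
  also have "\<dots> = (LINT x|lborel. P x * dd v \<phi> x) + (LINT x|lborel. dd v P x * \<phi> x)"
    by (intro Bochner_Integration.integral_add test_integrable[of _ \<Omega>] test_mult smooth_dd test_dd assms)
  finally show ?thesis by simp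
qed

subsection \<open>Integration along lines in a region above a graph\<close>

text \<open>The vectors \<open>f\<close> and \<open>e\<close> are the horizontal and vertical
  directions of an orthonormal frame. Over the base (\<alpha>, \<beta>) the graph stays below the
  level \<open>c0\<close>, so the slab between \<open>c0\<close> and \<open>c\<close> lies in the
  region and offers room for cutoff functions that do not depend on the graph.\<close>

locale graph_chart =
  fixes f e :: "real^2" and \<phi> :: "real \<Rightarrow> real" and \<alpha> \<beta> c0 c :: real
  assumes ff: "f \<bullet> f = 1" and ee: "e \<bullet> e = 1" and fe: "f \<bullet> e = 0"
    and cont: "continuous_on UNIV \<phi>" and ab: "\<alpha> < \<beta>" and cc: "c0 < c"
    and below: "\<And>s. \<alpha> < s \<Longrightarrow> s < \<beta> \<Longrightarrow> \<phi> s \<le> c0"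
begin

definition "region = {x. \<alpha> < x \<bullet> f \<and> x \<bullet> f < \<beta> \<and> \<phi> (x \<bullet> f) < x \<bullet> e \<and> x \<bullet> e < c}"

lemma expand: "x = (x \<bullet> f) *\<^sub>R f + (x \<bullet> e) *\<^sub>R e"
proof -
  obtain a b p q where [simp]: "f $ 1 = a" "f $ 2 = b" "e $ 1 = p" "e $ 2 = q" by blast
  have n: "a * a = 1 - b * b" "p * p + q * q = 1" "b * q = - (a * p)"
    using ff ee fe by (simp_all add: inner_vec_def sum_2 algebra_simps)
  \<comment> \<open>The determinant of the frame: \<open>e\<close> is \<open>d\<close> times
    \<open>f\<close> turned by a right angle, and \<open>d\<close> is 1 or -1.\<close>
  define d where "d = a * q - b * p"
  have "p = (a * a + b * b) * p" unfolding n by simp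
  also have "\<dots> = - a * (b * q) + b * b * p" unfolding n(3) by (simp add: algebra_simps)
  also have "\<dots> = - d * b" by (simp add: d_def algebra_simps)
  finally have p: "p = - d * b" .
  have "q = (a * a + b * b) * q" unfolding n by simp
  also have "\<dots> = a * a * q + b * (b * q)" by (simp add: algebra_simps)
  also have "\<dots> = d * a" unfolding n(3) by (simp add: d_def algebra_simps)
  finally have q: "q = d * a" .
  have d: "d * d = 1"
  proof -
    have "d * d = d * d * (a * a + b * b)" unfolding n by simp
    also have "\<dots> = p * p + q * q" unfolding p q by (simp add: algebra_simps)
    finally show ?thesis using n(2) by simp
  qed
  have "(x $ 1 * a + x $ 2 * b) * a + (x $ 1 * p + x $ 2 * q) * p
      = x $ 1 * (a * a + (d * d) * (b * b)) + x $ 2 * (a * b) * (1 - d * d)"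
    unfolding p q by (simp add: algebra_simps)
  then have 1: "(x $ 1 * a + x $ 2 * b) * a + (x $ 1 * p + x $ 2 * q) * p = x $ 1"
    unfolding d n(1) by simp
  have "(x $ 1 * a + x $ 2 * b) * b + (x $ 1 * p + x $ 2 * q) * q
      = x $ 2 * ((d * d) * (a * a) + b * b) + x $ 1 * (a * b) * (1 - d * d)"
    unfolding p q by (simp add: algebra_simps)
  then have "(x $ 1 * a + x $ 2 * b) * b + (x $ 1 * p + x $ 2 * q) * q = x $ 2"
    unfolding d n(1) by simp
  with 1 show ?thesis by (simp add: vec_eq_iff forall_2 inner_vec_def sum_2)
qed

lemma norm_f [simp]: "norm f = 1" and norm_e [simp]: "norm e = 1"
  using ff ee by (simp_all add: norm_eq_sqrt_inner)

lemma ef: "e \<bullet> f = 0" using fe by (simp add: inner_commute)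

lemma coord_add [simp]:
  "(x + t *\<^sub>R e) \<bullet> f = x \<bullet> f" "(x + t *\<^sub>R e) \<bullet> e = x \<bullet> e + t"
  "(x + t *\<^sub>R f) \<bullet> f = x \<bullet> f + t" "(x + t *\<^sub>R f) \<bullet> e = x \<bullet> e"
  using ff ee fe ef by (simp_all add: inner_add_left)

lemma region_bounded: "\<exists>R>0. region \<subseteq> ball 0 R"
proof -
  have "bounded (\<phi> ` {\<alpha>..\<beta>})"
    using cont by (intro compact_imp_bounded compact_continuous_image) (auto intro: continuous_on_subset)
  then obtain m where m: "\<And>s. s \<in> {\<alpha>..\<beta>} \<Longrightarrow> \<bar>\<phi> s\<bar> \<le> m"
    unfolding bounded_iff by (metis image_eqI real_norm_def)
  define R where "R = \<bar>\<alpha>\<bar> + \<bar>\<beta>\<bar> + \<bar>m\<bar> + \<bar>c\<bar> + 1"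
  have "norm x < R" if "x \<in> region" for x
  proof -
    have "norm x \<le> norm ((x \<bullet> f) *\<^sub>R f) + norm ((x \<bullet> e) *\<^sub>R e)"
      by (subst expand) (rule norm_triangle_ineq)
    also have "\<dots> = \<bar>x \<bullet> f\<bar> + \<bar>x \<bullet> e\<bar>" by simp
    also have "\<dots> < R" using that m[of "x \<bullet> f"] unfolding region_def R_def by auto
    finally show ?thesis .
  qed
  moreover have "R > 0" by (auto simp: R_def)
  ultimately show ?thesis by (auto simp: mem_ball_0)
qed

definition "R = (SOME R. R > 0 \<and> region \<subseteq> ball 0 R)"

lemma R: "R > 0" "region \<subseteq> ball 0 R"
  using someI_ex[OF region_bounded] unfolding R_def by auto

text \<open>Compact sets exhausting the region that meet every line in direction \<open>e\<close> in
  a segment. The support of a test function need not do so, and a primitive along the line could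
  then be nonzero in a gap outside the region considered.\<close>

definition "core \<epsilon> = {x. \<alpha> + \<epsilon> \<le> x \<bullet> f \<and> x \<bullet> f \<le> \<beta> - \<epsilon> \<and> \<phi> (x \<bullet> f) + \<epsilon> \<le> x \<bullet> e \<and> x \<bullet> e \<le> c - \<epsilon>}"

lemma core_subset: "\<epsilon> > 0 \<Longrightarrow> core \<epsilon> \<subseteq> region"
  by (auto simp: core_def region_def)

lemma compact_core: assumes "\<epsilon> > 0" shows "compact (core \<epsilon>)"
proof -
  have [continuous_intros]: "continuous_on UNIV (\<lambda>x::real^2. \<phi> (x \<bullet> f))"
    by (rule continuous_on_compose2[OF cont]) (auto intro!: continuous_intros)
  have "closed (core \<epsilon>)"
    unfolding core_def by (intro closed_Collect_conj closed_Collect_le continuous_intros)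
  moreover have "bounded (core \<epsilon>)"
    using core_subset[OF assms] R(2) bounded_ball bounded_subset by (metis order_trans)
  ultimately show ?thesis by (simp add: compact_eq_bounded_closed)
qed

lemma compact_subset_core:
  assumes "compact C" "C \<subseteq> region" "\<delta> > 0"
  obtains \<epsilon> where "\<epsilon> > 0" "\<epsilon> \<le> \<delta>" "C \<subseteq> core \<epsilon>"
proof (cases "C = {}")
  case True then show ?thesis using that[of \<delta>] assms(3) by auto
next
  case False
  define m where "m x = min (min (x \<bullet> f - \<alpha>) (\<beta> - x \<bullet> f)) (min (x \<bullet> e - \<phi> (x \<bullet> f)) (c - x \<bullet> e))" for x
  have "continuous_on C m"
    unfolding m_def by (intro continuous_intros continuous_on_compose2[OF cont]) auto
  then obtain x0 where x0: "x0 \<in> C" "\<And>x. x \<in> C \<Longrightarrow> m x0 \<le> m x"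
    using continuous_attains_inf[OF assms(1) False] by blast
  have "m x0 > 0" using x0(1) assms(2) by (auto simp: m_def region_def)
  moreover have "C \<subseteq> core (min \<delta> (m x0))"
  proof
    fix x assume "x \<in> C"
    then have "min \<delta> (m x0) \<le> m x" using x0(2) min.coboundedI2 by blast
    moreover define r where "r = min \<delta> (m x0)"
    ultimately show "x \<in> core (min \<delta> (m x0))"
      unfolding r_def[symmetric] m_def min.bounded_iff core_def by simp
  qed
  ultimately show ?thesis using that[of "min \<delta> (m x0)"] assms(3) by simp
qed

text \<open>The primitive of \<open>g\<close> along \<open>v\<close> stays inside \<open>C\<close> because \<open>g\<close> has mean zero on each line.\<close>

lemma primitive_test:
  assumes v: "norm v = 1" and g: "smooth g" and C: "compact C" "C \<subseteq> region" "\<And>x. x \<notin> C \<Longrightarrow> g x = 0"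
    and side: "\<And>x. x \<notin> C \<Longrightarrow> (\<forall>t\<ge>0. g (x + t *\<^sub>R v) = 0) \<or> (\<forall>t\<le>0. g (x + t *\<^sub>R v) = 0)"
    and mean: "\<And>x. (LINT t|lborel. g (x + t *\<^sub>R v)) = 0"
  shows "\<exists>K\<in>test_functions region. (\<forall>x. dd v K x = - g x) \<and>
    (\<forall>x\<in>ball 0 R. K x = lint v 0 (3 * R) g x)"
proof -
  \<comment> \<open>From a point within 3R/2 of the origin, a segment of length 3R ends outside the
    ball of radius R that contains the support of \<open>g\<close>. The plateau is 1 on that ball
    and removes the points beyond 3R/2.\<close>
  define K where "K x = plateau 0 R x * lint v 0 (3 * R) g x" for x
  have sK: "smooth K" unfolding K_def[abs_def] by (intro smooth_mult smooth_plateau smooth_lint g)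
  have far: "g y = 0" if "norm y \<ge> R" for y
    using C(2,3) R(2) that by force
  have line: "norm (x + t *\<^sub>R v) \<ge> \<bar>t\<bar> - norm x" for x t
    using norm_triangle_ineq2[of "t *\<^sub>R v" "- x"] v by (simp add: add.commute)
  have K0: "K x = 0" if "x \<notin> C" for x
  proof (cases "norm x \<ge> 3 / 2 * R")
    case True
    then show ?thesis using plateau_eq_0[OF R(1), of 0 x] by (simp add: K_def)
  next
    case False
    have "lint v 0 (3 * R) g x = 0"
      using side[OF that]
    proof
      assume "\<forall>t\<ge>0. g (x + t *\<^sub>R v) = 0"
      then show ?thesis by (intro lint_eq_0) auto
    next
      assume *: "\<forall>t\<le>0. g (x + t *\<^sub>R v) = 0"
      have "lint v 0 (3 * R) g x = (LINT t|lborel. g (x + t *\<^sub>R v))"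
      proof (rule lint_eq_line_integral)
        fix t assume "t \<notin> {0..3 * R}"
        then consider "t \<le> 0" | "t > 3 * R" by fastforce
        then show "g (x + t *\<^sub>R v) = 0"
        proof cases
          case 1 then show ?thesis using * by blast
        next
          case 2
          then have "norm (x + t *\<^sub>R v) \<ge> R" using False line[of t x] R(1) by linarith
          then show ?thesis by (rule far)
        qed
      qed
      then show ?thesis using mean by simp
    qed
    then show ?thesis by (simp add: K_def)
  qed
  have Kball: "K x = lint v 0 (3 * R) g x" if "x \<in> ball 0 R" for x
    using that plateau_eq_1[OF R(1), of 0 x] by (simp add: K_def)
  have "dd v K x = - g x" for x
  proof (cases "x \<in> ball 0 R")
    case True
    have "dd v K x = dd v (lint v 0 (3 * R) g) x"
      by (rule dd_cong_open[OF open_ball True Kball smooth_lint[OF g]])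
    also have "\<dots> = g (x + (3 * R) *\<^sub>R v) - g x"
      using R(1) g by (simp add: dd_lint lint_dd)
    also have "g (x + (3 * R) *\<^sub>R v) = 0"
    proof (rule far)
      have "norm x < R" using True by simp
      then show "R \<le> norm (x + (3 * R) *\<^sub>R v)" using line[of "3 * R" x] R(1) by linarith
    qed
    finally show ?thesis by simp
  next
    case False
    then have "x \<in> - C" using C(2) R(2) by auto
    then have "dd v K x = 0"
      by (intro dd_eq_0_open[of "- C"]) (use K0 C(1) compact_imp_closed in auto)
    with \<open>x \<in> - C\<close> C(3) show ?thesis by simp
  qed
  with test_functionsI[OF sK C(1,2) K0] Kball show ?thesis by blast
qed

text \<open>Weights of integral one on the middle thirds of the slab (c0, c) and of the base
  (\<alpha>, \<beta>). Because of the slab, \<open>th\<close> can be placed above every base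
  point.\<close>

definition "th = nbump (c0 + (c - c0) / 3) (c0 + 2 * (c - c0) / 3)"
definition "mu = nbump (\<alpha> + (\<beta> - \<alpha>) / 3) (\<alpha> + 2 * (\<beta> - \<alpha>) / 3)"

text \<open>Starting at the projection of \<open>x\<close> makes this exactly constant along
  \<open>e\<close>, and the finite limits make it smooth for every smooth \<psi>. For test functions
  of the region it is the integral over the whole line, see \<open>lineA_eq\<close>.\<close>

definition lineA :: "(real^2 \<Rightarrow> real) \<Rightarrow> real^2 \<Rightarrow> real" where
  "lineA \<psi> x = lint e (- 4 * R) (4 * R) \<psi> ((x \<bullet> f) *\<^sub>R f)"

definition "meanfree \<psi> x = \<psi> x - th (x \<bullet> e) * lineA \<psi> x"

lemma smooth_inner_left: "smooth (\<lambda>x::real^2. x \<bullet> v)"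
  by (rule smooth_linear[OF bounded_linear_inner_left])

lemma smooth_th: "smooth (\<lambda>x::real^2. th (x \<bullet> e))" and smooth_mu: "smooth (\<lambda>x::real^2. mu (x \<bullet> f))"
  unfolding th_def mu_def by (rule smooth_compose_real[OF smooth_nbump smooth_inner_left])+

lemma bounded_linear_proj: "bounded_linear (\<lambda>x::real^2. (x \<bullet> f) *\<^sub>R f)"
  by (intro bounded_linear_scaleR_const bounded_linear_inner_left)

lemma smooth_lineA:
  assumes "smooth \<psi>" shows "smooth (lineA \<psi>)"
proof -
  have "smooth (\<lambda>x::real^2. lint e (- 4 * R) (4 * R) \<psi> ((x \<bullet> f) *\<^sub>R f + 0))"
    by (rule smooth_affine[OF bounded_linear_proj smooth_lint[OF assms]])
  then show ?thesis by (simp add: lineA_def[abs_def])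
qed

lemma smooth_meanfree: "smooth \<psi> \<Longrightarrow> smooth (meanfree \<psi>)"
  unfolding meanfree_def[abs_def] by (intro smooth_diff smooth_mult smooth_th smooth_lineA)

lemma dd_f_lineA:
  assumes "smooth \<psi>" shows "dd f (lineA \<psi>) = lineA (dd f \<psi>)"
proof
  fix x
  have "((\<lambda>x. lint e (- 4 * R) (4 * R) \<psi> ((x \<bullet> f) *\<^sub>R f)) has_derivative
      (\<lambda>v. dd ((v \<bullet> f) *\<^sub>R f) (lint e (- 4 * R) (4 * R) \<psi>) ((x \<bullet> f) *\<^sub>R f))) (at x)"
    by (rule has_derivative_compose[OF bounded_linear_imp_has_derivative[OF bounded_linear_proj]
          smooth_has_derivative[OF smooth_lint[OF assms]]])
  from dd_eqI[OF this, of f] show "dd f (lineA \<psi>) x = lineA (dd f \<psi>) x"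
    by (simp add: lineA_def[abs_def] dd_lint[OF assms] ff)
qed

lemma dd_f_th: "dd f (\<lambda>x::real^2. th (x \<bullet> e)) x = 0"
proof -
  have "((\<lambda>x::real^2. th (x \<bullet> e)) has_derivative (\<lambda>v. dd (v \<bullet> e) th (x \<bullet> e))) (at x)"
    by (rule has_derivative_compose[OF bounded_linear_imp_has_derivative[OF bounded_linear_inner_left]
      smooth_has_derivative]) (simp add: th_def smooth_nbump)
  from dd_eqI[OF this, of f] have "dd f (\<lambda>x::real^2. th (x \<bullet> e)) x = dd 0 th (x \<bullet> e)" by (simp add: fe)
  also have "\<dots> = 0" using dd_linear_combination[of th 0 0 0 0 "x \<bullet> e"] by (simp add: th_def smooth_nbump)
  finally show ?thesis .
qed

text \<open>\<open>th\<close> depends on the height alone, and \<open>lineA\<close> commutes with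
  horizontal derivatives. This later identifies the horizontal derivative of a vertical
  primitive.\<close>

lemma dd_f_meanfree: "smooth \<psi> \<Longrightarrow> dd f (meanfree \<psi>) = meanfree (dd f \<psi>)"
  unfolding meanfree_def[abs_def]
  by (simp add: fun_eq_iff dd_diff dd_mult smooth_mult smooth_th smooth_lineA dd_f_th dd_f_lineA)

lemma norm_ge_coord: "\<bar>x \<bullet> f\<bar> \<le> norm x" "\<bar>x \<bullet> e\<bar> \<le> norm x"
  using Cauchy_Schwarz_ineq2[of x f] Cauchy_Schwarz_ineq2[of x e] by simp_all

lemma test_far: "\<psi> \<in> test_functions region \<Longrightarrow> norm x \<ge> R \<Longrightarrow> \<psi> x = 0"
  using R(2) test_eq_0[of \<psi> region x] by fastforce

lemma lineA_eq:
  assumes "\<psi> \<in> test_functions region"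
  shows "lineA \<psi> x = (LINT t|lborel. \<psi> (x + t *\<^sub>R e))"
proof -
  have "lineA \<psi> x = (LINT t|lborel. \<psi> ((x \<bullet> f) *\<^sub>R f + t *\<^sub>R e))"
    unfolding lineA_def
  proof (rule lint_eq_line_integral)
    fix t assume "t \<notin> {- 4 * R..4 * R}"
    then have "\<bar>t\<bar> \<ge> R" using R(1) by auto
    then show "\<psi> ((x \<bullet> f) *\<^sub>R f + t *\<^sub>R e) = 0"
      using norm_ge_coord(2)[of "(x \<bullet> f) *\<^sub>R f + t *\<^sub>R e"] by (intro test_far[OF assms]) (simp add: fe)
  qed
  also have "\<dots> = (LINT t|lborel. \<psi> ((x \<bullet> f) *\<^sub>R f + (t + x \<bullet> e) *\<^sub>R e))"
    by (rule lborel_integral_shift[symmetric])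
  also have "\<dots> = (LINT t|lborel. \<psi> (x + t *\<^sub>R e))"
    by (rule Bochner_Integration.integral_cong[OF refl], subst (2) expand) (simp add: scaleR_left_distrib add_ac)
  finally show ?thesis .
qed

text \<open>Beyond parameter 4R a line through a point of norm below 3R has left the ball of radius
  R. The bound 3R allows for points of the region shifted horizontally by up to 2R.\<close>

lemma lineA_lint:
  assumes "\<psi> \<in> test_functions region" "norm x < 3 * R"
  shows "lint e (- 4 * R) (4 * R) \<psi> x = lineA \<psi> x"
  unfolding lineA_eq[OF assms(1)]
proof (rule lint_eq_line_integral)
  fix t assume "t \<notin> {- 4 * R..4 * R}"
  then have "\<bar>t\<bar> > 4 * R" by auto
  then show "\<psi> (x + t *\<^sub>R e) = 0"
    using norm_triangle_ineq2[of "t *\<^sub>R e" "- x"] assms(2)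
    by (intro test_far[OF assms(1)]) (simp add: add.commute)
qed

lemma lineA_line: "lineA \<psi> (x + t *\<^sub>R e) = lineA \<psi> x"
  by (simp add: lineA_def)

lemma integral_th_line: "(LINT t|lborel. th (a + t)) = 1"
proof -
  have "(LINT t|lborel. th (t + a)) = (LINT t|lborel. th t)" by (rule lborel_integral_shift)
  also have "\<dots> = 1" unfolding th_def by (rule integral_nbump) (use cc in simp)
  finally show ?thesis by (simp add: add.commute)
qed

lemma integral_mu_line: "(LINT t|lborel. mu (a + t)) = 1"
proof -
  have "(LINT t|lborel. mu (t + a)) = (LINT t|lborel. mu t)" by (rule lborel_integral_shift)
  also have "\<dots> = 1" unfolding mu_def by (rule integral_nbump) (use ab in \<open>simp add: field_simps\<close>)
  finally show ?thesis by (simp add: add.commute)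
qed

lemma integrable_nbump_line: "integrable lborel (\<lambda>t. nbump p q (a + t))"
proof -
  have "integrable lborel (nbump p q)"
    by (rule integrable_compact_support[OF smooth_continuous_on[OF smooth_nbump] compact_Icc nbump_eq_0])
  from lborel_integrable_shift[OF this, of a] show ?thesis by (simp add: add.commute)
qed

lemma integrable_test_line:
  assumes "\<psi> \<in> test_functions \<Omega>" "norm v = 1" shows "integrable lborel (\<lambda>t. \<psi> (x + t *\<^sub>R v))"
proof -
  obtain C where C: "compact C" "C \<subseteq> \<Omega>" "\<And>x. x \<notin> C \<Longrightarrow> \<psi> x = 0"
    using test_functionsE[OF assms(1)] by blast
  obtain B where B: "\<And>y. y \<in> C \<Longrightarrow> norm y \<le> B" using compact_imp_bounded[OF C(1)] by (auto simp: bounded_iff)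
  show ?thesis
  proof (rule integrable_compact_support[OF _ compact_Icc[of "- (B + norm x)" "B + norm x"]])
    show "continuous_on UNIV (\<lambda>t. \<psi> (x + t *\<^sub>R v))"
      by (rule smooth_continuous_on_compose[OF test_smooth[OF assms(1)]]) (intro continuous_intros)
    show "\<psi> (x + t *\<^sub>R v) = 0" if "t \<notin> {- (B + norm x)..B + norm x}" for t
    proof (rule C(3), rule notI)
      assume "x + t *\<^sub>R v \<in> C"
      then show False using B norm_triangle_ineq2[of "t *\<^sub>R v" "- x"] that assms(2)
        by (fastforce simp: add.commute)
    qed
  qed
qed

text \<open>Subtracting \<open>th\<close> times the line integral makes every line integral in direction \<open>e\<close> vanish.\<close>

lemma meanfree_primitive:
  assumes \<psi>: "\<psi> \<in> test_functions region"
  shows "\<exists>K\<in>test_functions region. (\<forall>x. dd e K x = - meanfree \<psi> x) \<and>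
      (\<forall>x\<in>ball 0 R. K x = lint e 0 (3 * R) (meanfree \<psi>) x)"
    and "(\<lambda>x. th (x \<bullet> e) * lineA \<psi> x) \<in> test_functions region"
    and "\<exists>\<epsilon>>0. \<epsilon> \<le> (\<beta> - \<alpha>) / 3 \<and> (\<forall>x. lineA \<psi> x \<noteq> 0 \<longrightarrow> \<alpha> + \<epsilon> \<le> x \<bullet> f \<and> x \<bullet> f \<le> \<beta> - \<epsilon>)"
proof -
  obtain C where C: "compact C" "C \<subseteq> region" "\<And>x. x \<notin> C \<Longrightarrow> \<psi> x = 0"
    using test_functionsE[OF \<psi>] by blast
  \<comment> \<open>A third of each width is the largest margin for which the core still contains
    the middle third of the slab, where \<open>th\<close> lives, and the same margin serves the
    middle third of the base.\<close>
  obtain \<epsilon> where \<epsilon>: "\<epsilon> > 0" "\<epsilon> \<le> min ((c - c0) / 3) ((\<beta> - \<alpha>) / 3)" "C \<subseteq> core \<epsilon>"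
    using compact_subset_core[OF C(1,2), of "min ((c - c0) / 3) ((\<beta> - \<alpha>) / 3)"] ab cc by auto
  have \<psi>0: "\<psi> x = 0" if "x \<notin> core \<epsilon>" for x using that C(3) \<epsilon>(3) by blast
  have A0: "lineA \<psi> x = 0" if "\<not> (\<alpha> + \<epsilon> \<le> x \<bullet> f \<and> x \<bullet> f \<le> \<beta> - \<epsilon>)" for x
    unfolding lineA_eq[OF \<psi>] by (subst \<psi>0) (use that in \<open>auto simp: core_def\<close>)
  have thA0: "th (x \<bullet> e) * lineA \<psi> x = 0" if "x \<notin> core \<epsilon>" for x
  proof (cases "\<alpha> + \<epsilon> \<le> x \<bullet> f \<and> x \<bullet> f \<le> \<beta> - \<epsilon>")
    case True
    then have "\<phi> (x \<bullet> f) \<le> c0" using \<epsilon>(1) by (intro below) auto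
    then have "x \<bullet> e \<notin> {c0 + (c - c0) / 3..c0 + 2 * (c - c0) / 3}"
      using that True \<epsilon>(2) by (auto simp: core_def field_simps)
    then show ?thesis by (simp add: th_def nbump_eq_0)
  qed (use A0 in auto)
  have g0: "meanfree \<psi> x = 0" if "x \<notin> core \<epsilon>" for x
    using that \<psi>0 thA0 by (simp add: meanfree_def)
  have mean: "(LINT t|lborel. meanfree \<psi> (x + t *\<^sub>R e)) = 0" for x
  proof -
    have "integrable lborel (\<lambda>t. th (x \<bullet> e + t) * lineA \<psi> x)"
      unfolding th_def by (intro integrable_mult_left integrable_nbump_line)
    then show ?thesis
      using integrable_test_line[OF \<psi> norm_e] integral_th_line[of "x \<bullet> e"] lineA_eq[OF \<psi>, of x]
      by (simp add: meanfree_def lineA_line)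
  qed
  \<comment> \<open>Moving along \<open>e\<close> keeps the base coordinate. A point outside the
    core therefore is above it, so that nothing lies ahead, or else the ray downwards avoids the
    core.\<close>
  have side: "(\<forall>t\<ge>0. meanfree \<psi> (x + t *\<^sub>R e) = 0) \<or> (\<forall>t\<le>0. meanfree \<psi> (x + t *\<^sub>R e) = 0)" if "x \<notin> core \<epsilon>" for x
  proof (cases "x \<bullet> e > c - \<epsilon>")
    case True
    then have "meanfree \<psi> (x + t *\<^sub>R e) = 0" if "t \<ge> 0" for t
      using that by (intro g0) (auto simp: core_def)
    then show ?thesis by blast
  next
    case False
    then have "meanfree \<psi> (x + t *\<^sub>R e) = 0" if "t \<le> 0" for t
      using that \<open>x \<notin> core \<epsilon>\<close> by (intro g0) (auto simp: core_def)
    then show ?thesis by blast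
  qed
  show "\<exists>K\<in>test_functions region. (\<forall>x. dd e K x = - meanfree \<psi> x) \<and>
      (\<forall>x\<in>ball 0 R. K x = lint e 0 (3 * R) (meanfree \<psi>) x)"
    by (rule primitive_test[OF norm_e smooth_meanfree[OF test_smooth[OF \<psi>]] compact_core[OF \<epsilon>(1)] core_subset[OF \<epsilon>(1)] g0 side mean])
  show "(\<lambda>x. th (x \<bullet> e) * lineA \<psi> x) \<in> test_functions region"
    by (rule test_functionsI[OF smooth_mult[OF smooth_th smooth_lineA[OF test_smooth[OF \<psi>]]]
      compact_core[OF \<epsilon>(1)] core_subset[OF \<epsilon>(1)] thA0])
  show "\<exists>\<epsilon>>0. \<epsilon> \<le> (\<beta> - \<alpha>) / 3 \<and> (\<forall>x. lineA \<psi> x \<noteq> 0 \<longrightarrow> \<alpha> + \<epsilon> \<le> x \<bullet> f \<and> x \<bullet> f \<le> \<beta> - \<epsilon>)"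
    using \<epsilon> A0 by (intro exI[of _ \<epsilon>]) auto
qed

end

subsection \<open>Distributions and potentials in the region above a graph\<close>

definition distr_linear :: "(real^2) set \<Rightarrow> distribution \<Rightarrow> bool" where
  "distr_linear Q T \<longleftrightarrow>
     (\<forall>\<phi>\<in>test_functions Q. \<forall>\<psi>\<in>test_functions Q. T (\<lambda>x. \<phi> x + \<psi> x) = T \<phi> + T \<psi>) \<and>
     (\<forall>\<phi>\<in>test_functions Q. \<forall>a. T (\<lambda>x. a * \<phi> x) = a * T \<phi>)"

lemma distr_linear_diff:
  assumes "distr_linear Q T" "\<phi> \<in> test_functions Q" "\<psi> \<in> test_functions Q"
  shows "T (\<lambda>x. \<phi> x - a * \<psi> x) = T \<phi> - a * T \<psi>"
proof -
  have "T (\<lambda>x. \<phi> x + (- a) * \<psi> x) = T \<phi> + (- a) * T \<psi>"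
    using assms test_scale[OF assms(3), of "- a"] unfolding distr_linear_def by metis
  then show ?thesis by simp
qed

lemma distr_linear_integral:
  assumes "integrable lborel f" shows "distr_linear Q (\<lambda>\<psi>. LINT x|lborel. f x * \<psi> x)"
  unfolding distr_linear_def
  using integrable_mult_test[OF assms] by (auto simp: distrib_left mult.left_commute)

lemma distr_linear_integral_1: "distr_linear Q (\<lambda>\<psi>. LINT x|lborel. \<psi> x)"
  unfolding distr_linear_def using test_integrable by auto

lemma square_integrable_add:
  fixes f g :: "'a \<Rightarrow> real"
  assumes [measurable]: "f \<in> borel_measurable M" "g \<in> borel_measurable M"
    and "integrable M (\<lambda>x. (f x)\<^sup>2)" "integrable M (\<lambda>x. (g x)\<^sup>2)"
  shows "integrable M (\<lambda>x. (f x + g x)\<^sup>2)"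
proof (rule Bochner_Integration.integrable_bound[where f="\<lambda>x. 2 * (f x)\<^sup>2 + 2 * (g x)\<^sup>2"])
  have "(f x + g x)\<^sup>2 \<le> 2 * (f x)\<^sup>2 + 2 * (g x)\<^sup>2" for x
    using zero_le_power2[of "f x - g x"] by (simp add: power2_sum power2_diff)
  then show "AE x in M. norm ((f x + g x)\<^sup>2) \<le> norm (2 * (f x)\<^sup>2 + 2 * (g x)\<^sup>2)" by simp
qed (use assms in \<open>auto intro!: borel_measurable_power borel_measurable_add\<close>)

lemma square_integrable_mult_bounded:
  fixes f g :: "'a \<Rightarrow> real"
  assumes [measurable]: "f \<in> borel_measurable M" "g \<in> borel_measurable M"
    and f: "integrable M (\<lambda>x. (f x)\<^sup>2)" and C: "\<And>x. \<bar>g x\<bar> \<le> C"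
  shows "integrable M (\<lambda>x. (f x * g x)\<^sup>2)"
proof -
  have "\<bar>(g x)\<^sup>2\<bar> \<le> C\<^sup>2" for x using power_mono[OF C abs_ge_zero, of x 2] by simp
  then show ?thesis
    unfolding power_mult_distrib by (intro integral_abs_mult_le(1)[OF f]) simp_all
qed

lemma lint_diff:
  assumes "continuous_on UNIV f" "continuous_on UNIV g"
  shows "lint v a b (\<lambda>x. f x - g x) x = lint v a b f x - lint v a b g x"
proof -
  have "(\<lambda>t. h (x + t *\<^sub>R v)) integrable_on {a..b}" if "continuous_on UNIV h" for h :: "'a \<Rightarrow> real"
    by (rule integrable_continuous_interval, rule continuous_on_compose2[OF that]) (auto intro!: continuous_intros)
  then show ?thesis
    using assms by (simp add: lint_eq_integral continuous_on_diff integral_diff)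
qed

context graph_chart
begin

section \<open>Constancy of distributions with vanishing gradient\<close>

definition "weight x = th (x \<bullet> e) * mu (x \<bullet> f)"

text \<open>The integral of \<psi> iterated in the coordinates of the frame. It is never compared
  with the plane integral: \<open>zero_gradient_imp_constant\<close> eliminates it by applying
  \<open>functional_eq_mass\<close> to integration itself.\<close>

definition "mass \<psi> = (LINT s|lborel. lineA \<psi> (s *\<^sub>R f))"

text \<open>The rectangle is the middle third of the slab over a slightly shrunk base. It is compact
  in the region because the graph is below the slab, and it meets horizontal lines in segments, as
  \<open>primitive_test\<close> in direction \<open>f\<close> requires.\<close>

lemma weight_rectangle:
  assumes "\<epsilon> > 0" "\<epsilon> \<le> (\<beta> - \<alpha>) / 3"
  defines "C \<equiv> {x. \<alpha> + \<epsilon> \<le> x \<bullet> f \<and> x \<bullet> f \<le> \<beta> - \<epsilon> \<and> c0 + (c - c0) / 3 \<le> x \<bullet> e \<and> x \<bullet> e \<le> c0 + 2 * (c - c0) / 3}"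
  shows "compact C" "C \<subseteq> region" "\<And>x. x \<notin> C \<Longrightarrow> weight x = 0"
proof -
  define \<delta> where "\<delta> = min \<epsilon> ((c - c0) / 3)"
  have \<delta>: "\<delta> > 0" "\<delta> \<le> \<epsilon>" "\<delta> \<le> (c - c0) / 3" using assms cc unfolding \<delta>_def by (simp, simp, intro min.cobounded2)
  have sub: "C \<subseteq> core \<delta>"
  proof
    fix x assume x: "x \<in> C"
    then have "\<phi> (x \<bullet> f) \<le> c0" using assms(1) by (intro below) (auto simp: C_def)
    then show "x \<in> core \<delta>" using x \<delta> unfolding C_def core_def by (auto simp: field_simps)
  qed
  then show "C \<subseteq> region" using core_subset[OF \<delta>(1)] by blast
  have "closed C" unfolding C_def by (intro closed_Collect_conj closed_Collect_le continuous_intros)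
  then show "compact C" using sub compact_core[OF \<delta>(1)] by (metis compact_Int_closed inf.absorb_iff2)
  show "weight x = 0" if "x \<notin> C" for x
  proof (cases "c0 + (c - c0) / 3 \<le> x \<bullet> e \<and> x \<bullet> e \<le> c0 + 2 * (c - c0) / 3")
    case True
    then have "x \<bullet> f \<notin> {\<alpha> + (\<beta> - \<alpha>) / 3..\<alpha> + 2 * (\<beta> - \<alpha>) / 3}"
      using that assms(2) by (auto simp: C_def field_simps)
    then show ?thesis by (simp add: weight_def mu_def nbump_eq_0)
  next
    case False
    then show ?thesis by (auto simp: weight_def th_def nbump_eq_0)
  qed
qed

lemma weight_test: "weight \<in> test_functions region"
proof -
  have "\<epsilon> = (\<beta> - \<alpha>) / 3 \<Longrightarrow> \<epsilon> > 0" for \<epsilon> using ab by simp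
  from weight_rectangle[OF this[OF refl] order_refl] show ?thesis
    by (intro test_functionsI[of weight]) (auto simp: weight_def[abs_def] intro!: smooth_mult smooth_th smooth_mu)
qed

lemma integral_weight_pos: "(LINT x|lborel. weight x) > 0"
proof (rule integral_pos_continuous[OF smooth_continuous_on[OF test_smooth[OF weight_test]] test_integrable[OF weight_test]])
  show "weight x \<ge> 0" for x
    unfolding weight_def th_def mu_def by (intro mult_nonneg_nonneg nbump_nonneg) (use ab cc in auto)
  show "weight (((\<alpha> + \<beta>) / 2) *\<^sub>R f + ((c0 + c) / 2) *\<^sub>R e) > 0"
    unfolding weight_def th_def mu_def using ab cc
    by (intro mult_pos_pos nbump_pos) (auto simp: inner_add_left fe ef ff ee field_simps)
qed

lemma lineA_proj: "lineA \<psi> (x + t *\<^sub>R f) = lineA \<psi> ((t + x \<bullet> f) *\<^sub>R f)"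
  by (simp add: lineA_def ff add.commute)

text \<open>Modulo vertical derivatives of test functions, \<psi> equals \<open>th\<close> times its
  vertical line integral; modulo horizontal derivatives, this equals \<open>mass\<close> times the
  fixed function \<open>weight\<close>. \<open>T\<close> kills both kinds of derivatives.\<close>

lemma functional_eq_mass:
  assumes T: "distr_linear region T" and e: "\<And>\<psi>. \<psi> \<in> test_functions region \<Longrightarrow> T (dd e \<psi>) = 0"
    and f: "\<And>\<psi>. \<psi> \<in> test_functions region \<Longrightarrow> T (dd f \<psi>) = 0"
    and \<psi>: "\<psi> \<in> test_functions region"
  shows "T \<psi> = mass \<psi> * T weight"
proof -
  have Tneg: "T g = 0" if "K \<in> test_functions region" "\<And>x. dd v K x = - g x" "T (dd v K) = 0" for K v g
  proof -
    have "g = (\<lambda>x. (-1) * dd v K x)" using that(2) by (simp add: fun_eq_iff)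
    moreover have "T (\<lambda>x. (-1) * dd v K x) = (-1) * T (dd v K)"
      using T test_dd[OF that(1), of v] unfolding distr_linear_def by blast
    ultimately show ?thesis using that(3) by simp
  qed
  obtain K where K: "K \<in> test_functions region" "\<And>x. dd e K x = - meanfree \<psi> x"
    using meanfree_primitive(1)[OF \<psi>] by blast
  define h where "h x = th (x \<bullet> e) * lineA \<psi> x" for x
  have h: "h \<in> test_functions region" using meanfree_primitive(2)[OF \<psi>] by (simp add: h_def[abs_def])
  have "T (meanfree \<psi>) = 0" by (rule Tneg[OF K e[OF K(1)]])
  moreover have "meanfree \<psi> = (\<lambda>x. \<psi> x - 1 * h x)" by (simp add: fun_eq_iff meanfree_def h_def)
  ultimately have Th: "T \<psi> = T h" using distr_linear_diff[OF T \<psi> h, of 1] by simp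
  obtain \<epsilon> where \<epsilon>: "\<epsilon> > 0" "\<epsilon> \<le> (\<beta> - \<alpha>) / 3"
    "\<And>x. \<not> (\<alpha> + \<epsilon> \<le> x \<bullet> f \<and> x \<bullet> f \<le> \<beta> - \<epsilon>) \<Longrightarrow> lineA \<psi> x = 0"
    using meanfree_primitive(3)[OF \<psi>] by blast
  define C where "C = {x. \<alpha> + \<epsilon> \<le> x \<bullet> f \<and> x \<bullet> f \<le> \<beta> - \<epsilon> \<and> c0 + (c - c0) / 3 \<le> x \<bullet> e \<and> x \<bullet> e \<le> c0 + 2 * (c - c0) / 3}"
  note C = weight_rectangle[OF \<epsilon>(1,2), folded C_def]
  define G where "G x = h x - mass \<psi> * weight x" for x
  have thC: "th (x \<bullet> e) = 0" if "\<not> (c0 + (c - c0) / 3 \<le> x \<bullet> e \<and> x \<bullet> e \<le> c0 + 2 * (c - c0) / 3)" for x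
    using that by (simp add: th_def nbump_eq_0)
  have G0: "G x = 0" if "x \<notin> C" for x
  proof -
    have "h x = 0" using that \<epsilon>(3)[of x] thC[of x] by (auto simp: h_def C_def)
    then show ?thesis using C(3)[OF that] by (simp add: G_def)
  qed
  have side: "(\<forall>t\<ge>0. G (x + t *\<^sub>R f) = 0) \<or> (\<forall>t\<le>0. G (x + t *\<^sub>R f) = 0)" if "x \<notin> C" for x
  proof (cases "x \<bullet> f > \<beta> - \<epsilon>")
    case True
    then have "G (x + t *\<^sub>R f) = 0" if "t \<ge> 0" for t
      using that by (intro G0) (auto simp: C_def)
    then show ?thesis by blast
  next
    case False
    then have "G (x + t *\<^sub>R f) = 0" if "t \<le> 0" for t
      using that \<open>x \<notin> C\<close> by (intro G0) (auto simp: C_def)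
    then show ?thesis by blast
  qed
  have mean: "(LINT t|lborel. G (x + t *\<^sub>R f)) = 0" for x
  proof -
    have "integrable lborel (\<lambda>s. lineA \<psi> (s *\<^sub>R f))"
      by (rule integrable_compact_support[OF _ compact_Icc[of "\<alpha>" "\<beta>"]],
          rule smooth_continuous_on_compose[OF smooth_lineA[OF test_smooth[OF \<psi>]]])
         (use \<epsilon>(1) in \<open>auto intro!: continuous_intros \<epsilon>(3) simp: ff\<close>)
    from lborel_integrable_shift[OF this]
    have i1: "integrable lborel (\<lambda>t. lineA \<psi> ((t + x \<bullet> f) *\<^sub>R f))" .
    have i2: "integrable lborel (\<lambda>t. mu (x \<bullet> f + t))"
      unfolding mu_def by (rule integrable_nbump_line)
    have "(LINT t|lborel. lineA \<psi> ((t + x \<bullet> f) *\<^sub>R f)) = mass \<psi>"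
      unfolding mass_def by (rule lborel_integral_shift)
    then show ?thesis
      using i1 i2 integral_mu_line[of "x \<bullet> f"]
      by (simp add: G_def h_def weight_def lineA_proj)
  qed
  have sG: "smooth G"
    unfolding G_def[abs_def] by (intro smooth_diff smooth_mult smooth_const test_smooth[OF h] test_smooth[OF weight_test])
  obtain K' where K': "K' \<in> test_functions region" "\<And>x. dd f K' x = - G x"
    using primitive_test[OF norm_f sG C(1,2) G0 side mean] by blast
  have "T G = 0" by (rule Tneg[OF K' f[OF K'(1)]])
  then show ?thesis
    using Th distr_linear_diff[OF T h weight_test, of "mass \<psi>"] unfolding G_def[abs_def] by simp
qed

text \<open>Integration is another functional that kills derivatives, so both are multiples of
  \<open>mass\<close>; evaluating at \<open>weight\<close>, whose integral is positive, gives the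
  factor.\<close>

lemma zero_gradient_imp_constant:
  assumes T: "distr_linear region T" and e: "\<And>\<psi>. \<psi> \<in> test_functions region \<Longrightarrow> T (dd e \<psi>) = 0"
    and f: "\<And>\<psi>. \<psi> \<in> test_functions region \<Longrightarrow> T (dd f \<psi>) = 0"
  shows "\<exists>s. \<forall>\<psi>\<in>test_functions region. T \<psi> = s * (LINT x|lborel. \<psi> x)"
proof -
  have "T \<psi> = T weight / (LINT x|lborel. weight x) * (LINT x|lborel. \<psi> x)" if "\<psi> \<in> test_functions region" for \<psi>
    using functional_eq_mass[OF T e f that] integral_weight_pos
      functional_eq_mass[OF distr_linear_integral_1 _ _ that] integral_dd_test by simp
  then show ?thesis by blast
qed

section \<open>Square integrable potentials of rotation-free fields\<close>

lemma open_region: "open region"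
proof -
  have [continuous_intros]: "continuous_on UNIV (\<lambda>x::real^2. \<phi> (x \<bullet> f))"
    by (rule continuous_on_compose2[OF cont]) (auto intro!: continuous_intros)
  show ?thesis unfolding region_def by (intro open_Collect_conj open_Collect_less continuous_intros)
qed

lemma norm_shift_f: assumes "norm x < R" "\<bar>t\<bar> \<le> 2 * R" shows "norm (x + t *\<^sub>R f) < 3 * R"
  using norm_triangle_ineq[of x "t *\<^sub>R f"] assms by simp

lemma norm_shift_e: assumes "norm x < 3 * R" "\<bar>t\<bar> \<ge> 4 * R" shows "norm (x + t *\<^sub>R e) \<ge> R"
  using norm_triangle_ineq2[of "t *\<^sub>R e" "- x"] assms by (simp add: add.commute)

text \<open>The potential is minus the transpose of an explicit right inverse of the divergence on test
  functions of mean zero; only line integrals enter, so it is bounded on square integrable fields.\<close>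

lemma local_potential:
  assumes [measurable]: "u \<in> borel_measurable borel" "w \<in> borel_measurable borel"
    and u: "integrable lborel u" "integrable lborel (\<lambda>x. (u x)\<^sup>2)"
    and w: "integrable lborel w" "integrable lborel (\<lambda>x. (w x)\<^sup>2)"
    and rot: "\<And>K. K \<in> test_functions region \<Longrightarrow> (LINT x|lborel. w x * dd e K x) = (LINT x|lborel. u x * dd f K x)"
  shows "\<exists>p. p \<in> borel_measurable borel \<and> integrable lborel p \<and> integrable lborel (\<lambda>x. (p x)\<^sup>2) \<and>
    (\<forall>\<psi>\<in>test_functions region. (LINT x|lborel. p x * dd e \<psi> x) = - (LINT x|lborel. u x * \<psi> x) \<and>
       (LINT x|lborel. p x * dd f \<psi> x) = - (LINT x|lborel. w x * \<psi> x))"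
proof -
  have [measurable]: "region \<in> sets borel" using open_region by simp
  have R0: "0 < R" by (rule R(1))
  define ve where "ve x = u x * indicator region x" for x
  define vf where "vf x = w x * indicator region x" for x
  have [measurable]: "ve \<in> borel_measurable borel" "vf \<in> borel_measurable borel"
    unfolding ve_def[abs_def] vf_def[abs_def] by measurable
  have ind: "\<bar>indicator region x :: real\<bar> \<le> 1" for x by (simp add: indicator_def)
  have ve: "integrable lborel ve" "integrable lborel (\<lambda>x. (ve x)\<^sup>2)"
    unfolding ve_def[abs_def]
    by (rule integral_abs_mult_le(1)[OF u(1) _ ind] square_integrable_mult_bounded[OF _ _ u(2) ind]; simp)+
  have vf: "integrable lborel vf" "integrable lborel (\<lambda>x. (vf x)\<^sup>2)"
    unfolding vf_def[abs_def]
    by (rule integral_abs_mult_le(1)[OF w(1) _ ind] square_integrable_mult_bounded[OF _ _ w(2) ind]; simp)+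
  define th' where "th' x = th (x \<bullet> e)" for x
  obtain Ct where Ct: "\<And>t. \<bar>th t\<bar> \<le> Ct"
    using bounded_compact_support[OF smooth_continuous_on[OF smooth_nbump] compact_Icc nbump_eq_0] unfolding th_def by blast
  have th'b: "\<bar>th' x\<bar> \<le> Ct" for x using Ct by (simp add: th'_def)
  have sth': "smooth th'" unfolding th'_def[abs_def] by (rule smooth_th)
  have [measurable]: "th' \<in> borel_measurable borel"
    by (rule borel_measurable_continuous_onI[OF smooth_continuous_on[OF sth']])
  define Th where "Th = lint e 0 (3 * R) th'"
  have Thb: "\<bar>Th x\<bar> \<le> 3 * R * Ct" for x
    using abs_lint_le[OF th'b, where a=0 and b="3 * R" and v=e and x=x] R0 by (simp add: Th_def)
  have [measurable]: "Th \<in> borel_measurable borel" unfolding Th_def by measurable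
  define vt where "vt x = vf x * th' x" for x
  have [measurable]: "vt \<in> borel_measurable borel" unfolding vt_def[abs_def] by measurable
  have vt: "integrable lborel vt" "integrable lborel (\<lambda>x. (vt x)\<^sup>2)"
    unfolding vt_def[abs_def]
    by (rule integral_abs_mult_le(1)[OF vf(1) _ th'b] square_integrable_mult_bounded[OF _ _ vf(2) th'b]; simp)+
  have vT: "integrable lborel (\<lambda>x. ve x * Th x)" "integrable lborel (\<lambda>x. (ve x * Th x)\<^sup>2)"
    by (rule integral_abs_mult_le(1)[OF ve(1) _ Thb] square_integrable_mult_bounded[OF _ _ ve(2) Thb]; simp)+
  define q where "q x = ve x * Th x + lint f 0 (2 * R) vt x" for x
  have [measurable]: "q \<in> borel_measurable borel" unfolding q_def[abs_def] by measurable
  have q: "integrable lborel q" "integrable lborel (\<lambda>x. (q x)\<^sup>2)"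
    unfolding q_def[abs_def]
    using integrable_lint[OF vt(1), of f 0 "2 * R"] square_integrable_lint[OF _ vt(2), of 0 "2 * R" f] vT R0
    by (auto intro!: square_integrable_add Bochner_Integration.integrable_add)
  \<comment> \<open>Read off from \<open>int_p\<close>: \<open>lint_dual\<close> moves every line
    integral onto the test function and reverses its segment. What remains pairs \<open>ve\<close>
    with the vertical primitive of the mean-free part of \<psi>, and \<open>vf\<close> with
    \<open>th\<close> times a horizontal primitive of \<open>lineA\<close>.\<close>
  define p where "p x = lint e (- 3 * R) 0 ve x + (-1) * lint e (- 4 * R) (4 * R) q x" for x
  have pm: "p \<in> borel_measurable borel" unfolding p_def[abs_def] by measurable
  have p1: "integrable lborel p"
    unfolding p_def[abs_def] using integrable_lint[OF ve(1)] integrable_lint[OF q(1)] by (intro Bochner_Integration.integrable_add) auto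
  have p2: "integrable lborel (\<lambda>x. (p x)\<^sup>2)"
    unfolding p_def[abs_def]
    using square_integrable_lint[OF _ ve(2), of "-3 * R" 0 e] square_integrable_lint[OF _ q(2), of "-4 * R" "4 * R" e] R0
    by (intro square_integrable_add) (auto simp: power_mult_distrib)
  have int_p: "(LINT x|lborel. p x * \<psi> x) =
      (LINT x|lborel. ve x * (lint e 0 (3 * R) \<psi> x - Th x * lint e (- 4 * R) (4 * R) \<psi> x))
      - (LINT x|lborel. vt x * lint f (- 2 * R) 0 (lint e (- 4 * R) (4 * R) \<psi>) x)"
    if \<psi>: "\<psi> \<in> test_functions region" for \<psi>
  proof -
    obtain B where B: "\<And>x. \<bar>\<psi> x\<bar> \<le> B" using test_bounded[OF \<psi>] by blast
    have [measurable]: "\<psi> \<in> borel_measurable borel" by (rule test_measurable[OF \<psi>])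
    have Bl: "\<bar>lint v a b \<psi> x\<bar> \<le> (b - a) * B" if "a \<le> b" for v a b x by (rule abs_lint_le[OF B that])
    define A where "A = lint e (- 4 * R) (4 * R) \<psi>"
    have Am [measurable]: "A \<in> borel_measurable borel" unfolding A_def by measurable
    have Ab: "\<bar>A x\<bar> \<le> 8 * R * B" for x using Bl[where a="- 4 * R" and b="4 * R" and v=e and x=x] R0 by (simp add: A_def)
    have i1: "integrable lborel (\<lambda>x. lint e (- 3 * R) 0 ve x * \<psi> x)" "integrable lborel (\<lambda>x. lint e (- 4 * R) (4 * R) q x * \<psi> x)"
      by (rule lint_dual(2)[OF _ _ B]; use ve q in simp)+
    have "(LINT x|lborel. p x * \<psi> x) = (LINT x|lborel. lint e (- 3 * R) 0 ve x * \<psi> x) - (LINT x|lborel. lint e (- 4 * R) (4 * R) q x * \<psi> x)"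
      using i1 by (simp add: p_def left_diff_distrib)
    also have "(LINT x|lborel. lint e (- 3 * R) 0 ve x * \<psi> x) = (LINT x|lborel. ve x * lint e 0 (3 * R) \<psi> x)"
      using lint_dual(1)[OF ve(1) _ B, where v=e and a="- 3 * R" and b=0] by simp
    also have "(LINT x|lborel. lint e (- 4 * R) (4 * R) q x * \<psi> x) = (LINT x|lborel. q x * A x)"
      using lint_dual(1)[OF q(1) _ B, where v=e and a="- 4 * R" and b="4 * R"] by (simp add: A_def)
    also have "\<dots> = (LINT x|lborel. ve x * Th x * A x + lint f 0 (2 * R) vt x * A x)"
      by (simp add: q_def distrib_right)
    also have "\<dots> = (LINT x|lborel. ve x * Th x * A x) + (LINT x|lborel. lint f 0 (2 * R) vt x * A x)"
      by (rule Bochner_Integration.integral_add[OF integral_abs_mult_le(1)[OF vT(1) _ Ab] lint_dual(2)[OF vt(1) _ Ab]]) simp_all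
    also have "(LINT x|lborel. lint f 0 (2 * R) vt x * A x) = (LINT x|lborel. vt x * lint f (- 2 * R) 0 A x)"
      using lint_dual(1)[OF vt(1) _ Ab, where v=f and a=0 and b="2 * R"] by simp
    finally have "(LINT x|lborel. p x * \<psi> x) = (LINT x|lborel. ve x * lint e 0 (3 * R) \<psi> x) - (LINT x|lborel. ve x * Th x * A x)
       - (LINT x|lborel. vt x * lint f (- 2 * R) 0 A x)" by simp
    also have "(LINT x|lborel. ve x * lint e 0 (3 * R) \<psi> x) - (LINT x|lborel. ve x * Th x * A x)
       = (LINT x|lborel. ve x * lint e 0 (3 * R) \<psi> x - ve x * Th x * A x)"
      using R0 by (intro Bochner_Integration.integral_diff[symmetric] integral_abs_mult_le(1)[OF ve(1) _ Bl]
        integral_abs_mult_le(1)[OF vT(1) _ Ab]) simp_all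
    finally show ?thesis by (simp add: A_def right_diff_distrib mult.assoc)
  qed
  have restrict: "(LINT x|lborel. ve x * g x) = (LINT x|lborel. u x * g' x)"
      "(LINT x|lborel. vf x * g x) = (LINT x|lborel. w x * g' x)"
    if "\<And>x. x \<in> region \<Longrightarrow> g x = g' x" "\<And>x. x \<notin> region \<Longrightarrow> g' x = 0" for g g'
    unfolding ve_def vf_def using that
    by (auto intro!: Bochner_Integration.integral_cong simp: indicator_def)
  have inR: "norm x < R" if "x \<in> region" for x using that R(2) by auto
  \<comment> \<open>A vertical derivative has vanishing vertical line integrals, so only the first
    term survives, and its vertical primitive is -\<psi>.\<close>
  have E: "(LINT x|lborel. p x * dd e \<psi> x) = - (LINT x|lborel. u x * \<psi> x)" if \<psi>: "\<psi> \<in> test_functions region" for \<psi>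
  proof -
    have s: "smooth \<psi>" by (rule test_smooth[OF \<psi>])
    have A0: "lint e (- 4 * R) (4 * R) (dd e \<psi>) x = 0" if "norm x < 3 * R" for x
      using lint_dd[OF s, of "- 4 * R" "4 * R" e x] R0 norm_shift_e[OF that, of "4 * R"] norm_shift_e[OF that, of "- 4 * R"]
      by (simp add: test_far[OF \<psi>])
    have M0: "lint f (- 2 * R) 0 (lint e (- 4 * R) (4 * R) (dd e \<psi>)) x = 0" if "x \<in> region" for x
      by (rule lint_eq_0, rule A0, rule norm_shift_f[OF inR[OF that]]) (use R0 in auto)
    have L: "lint e 0 (3 * R) (dd e \<psi>) x = - \<psi> x" if "x \<in> region" for x
    proof -
      have "norm (x + (3 * R) *\<^sub>R e) \<ge> R"
        using norm_triangle_ineq2[of "(3 * R) *\<^sub>R e" "- x"] inR[OF that] R0 by (simp add: add.commute)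
      then show ?thesis using lint_dd[OF s, of 0 "3 * R" e x] R0 by (simp add: test_far[OF \<psi>])
    qed
    have "(LINT x|lborel. vt x * lint f (- 2 * R) 0 (lint e (- 4 * R) (4 * R) (dd e \<psi>)) x) = 0"
      using M0 by (intro integral_eq_zero_AE AE_I2) (auto simp: vt_def vf_def indicator_def)
    moreover have "(LINT x|lborel. ve x * (lint e 0 (3 * R) (dd e \<psi>) x - Th x * lint e (- 4 * R) (4 * R) (dd e \<psi>) x))
       = (LINT x|lborel. u x * (- \<psi> x))"
    proof (rule restrict(1))
      show "lint e 0 (3 * R) (dd e \<psi>) x - Th x * lint e (- 4 * R) (4 * R) (dd e \<psi>) x = - \<psi> x" if "x \<in> region" for x
      proof -
        have "norm x < 3 * R" using inR[OF that] R0 by linarith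
        from A0[OF this] L[OF that] show ?thesis by simp
      qed
    qed (simp add: test_eq_0[OF \<psi>])
    ultimately show ?thesis using int_p[OF test_dd[OF \<psi>, of e]] by simp
  qed
  have F: "(LINT x|lborel. p x * dd f \<psi> x) = - (LINT x|lborel. w x * \<psi> x)" if \<psi>: "\<psi> \<in> test_functions region" for \<psi>
  proof -
    have s: "smooth \<psi>" by (rule test_smooth[OF \<psi>])
    define \<zeta> where "\<zeta> = dd f \<psi>"
    have \<zeta>: "\<zeta> \<in> test_functions region" unfolding \<zeta>_def by (rule test_dd[OF \<psi>])
    define A where "A = lint e (- 4 * R) (4 * R) \<psi>"
    have A\<zeta>: "lint e (- 4 * R) (4 * R) \<zeta> = dd f A"
      unfolding A_def \<zeta>_def by (simp add: fun_eq_iff dd_lint[OF s])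
    have M: "lint f (- 2 * R) 0 (lint e (- 4 * R) (4 * R) \<zeta>) x = lineA \<psi> x" if "x \<in> region" for x
    proof -
      have "lint f (- 2 * R) 0 (dd f A) x = A x - A (x + (- 2 * R) *\<^sub>R f)"
        using R0 lint_dd[of A "- 2 * R" 0 f x] smooth_lint[OF s] by (simp add: A_def)
      \<comment> \<open>For |x| < R the shift by 2R moves the horizontal coordinate beyond R in
        modulus, so the whole vertical line misses the support.\<close>
      moreover have "A (x + (- 2 * R) *\<^sub>R f) = 0"
        unfolding A_def
      proof (rule lint_eq_0, rule test_far[OF \<psi>])
        fix t
        have "\<bar>x \<bullet> f + - 2 * R\<bar> \<ge> R" using norm_ge_coord(1)[of x] inR[OF that] R0 by linarith
        then show "R \<le> norm (x + (- 2 * R) *\<^sub>R f + t *\<^sub>R e)"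
          using norm_ge_coord(1)[of "x + (- 2 * R) *\<^sub>R f + t *\<^sub>R e"] by (simp add: inner_add_left inner_diff_left ff ef)
      qed
      moreover have "A x = lineA \<psi> x"
        unfolding A_def by (rule lineA_lint[OF \<psi>]) (use inR[OF that] R0 in linarith)
      ultimately show ?thesis unfolding A\<zeta> by simp
    qed
    obtain K where K: "K \<in> test_functions region" "\<And>x. dd e K x = - meanfree \<psi> x"
      "\<And>x. x \<in> ball 0 R \<Longrightarrow> K x = lint e 0 (3 * R) (meanfree \<psi>) x"
      using meanfree_primitive(1)[OF \<psi>] by blast
    note h = meanfree_primitive(2)[OF \<psi>]
    have dK: "lint e 0 (3 * R) \<zeta> x - Th x * lint e (- 4 * R) (4 * R) \<zeta> x = dd f K x" if "x \<in> region" for x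
    proof -
      have xb: "x \<in> ball 0 R" using that R(2) by blast
      have "dd f K x = dd f (lint e 0 (3 * R) (meanfree \<psi>)) x"
        by (rule dd_cong_open[OF open_ball xb K(3) smooth_lint[OF smooth_meanfree[OF s]]])
      also have "\<dots> = lint e 0 (3 * R) (meanfree \<zeta>) x"
        by (simp add: dd_lint[OF smooth_meanfree[OF s]] dd_f_meanfree[OF s] \<zeta>_def)
      also have "\<dots> = lint e 0 (3 * R) \<zeta> x - lint e 0 (3 * R) (\<lambda>x. th (x \<bullet> e) * lineA \<zeta> x) x"
        unfolding meanfree_def[abs_def]
        by (rule lint_diff) (intro smooth_continuous_on smooth_mult smooth_th smooth_lineA test_smooth[OF \<zeta>])+
      also have "lint e 0 (3 * R) (\<lambda>x. th (x \<bullet> e) * lineA \<zeta> x) x = Th x * lineA \<zeta> x"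
        unfolding lint_def Th_def lineA_line th'_def mult.assoc[symmetric] by simp
      also have "lineA \<zeta> x = lint e (- 4 * R) (4 * R) \<zeta> x"
        by (rule lineA_lint[OF \<zeta>, symmetric]) (use inR[OF that] R0 in linarith)
      finally show ?thesis by simp
    qed
    have "(LINT x|lborel. ve x * (lint e 0 (3 * R) \<zeta> x - Th x * lint e (- 4 * R) (4 * R) \<zeta> x))
        = (LINT x|lborel. u x * dd f K x)"
      by (rule restrict(1)[OF dK]) (simp_all add: test_eq_0[OF test_dd[OF K(1)]])
    \<comment> \<open>Vanishing rotation trades the horizontal derivative of \<open>K\<close> tested
      with \<open>u\<close> for the vertical one tested with \<open>w\<close>, which is minus the
      mean-free part of \<psi>. The part with \<open>lineA\<close> then cancels against the
      horizontal term of \<open>int_p\<close>.\<close>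
    also have "\<dots> = (LINT x|lborel. w x * dd e K x)" by (rule rot[OF K(1), symmetric])
    also have "\<dots> = (LINT x|lborel. w x * (th (x \<bullet> e) * lineA \<psi> x) - w x * \<psi> x)"
      by (simp add: K(2) meanfree_def right_diff_distrib)
    also have "\<dots> = (LINT x|lborel. w x * (th (x \<bullet> e) * lineA \<psi> x)) - (LINT x|lborel. w x * \<psi> x)"
      by (rule Bochner_Integration.integral_diff[OF integrable_mult_test[OF w(1) h] integrable_mult_test[OF w(1) \<psi>]])
    finally have 1: "(LINT x|lborel. ve x * (lint e 0 (3 * R) \<zeta> x - Th x * lint e (- 4 * R) (4 * R) \<zeta> x))
        = (LINT x|lborel. w x * (th (x \<bullet> e) * lineA \<psi> x)) - (LINT x|lborel. w x * \<psi> x)" .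
    have "(LINT x|lborel. vt x * lint f (- 2 * R) 0 (lint e (- 4 * R) (4 * R) \<zeta>) x)
        = (LINT x|lborel. vf x * (th (x \<bullet> e) * lint f (- 2 * R) 0 (lint e (- 4 * R) (4 * R) \<zeta>) x))"
      by (simp add: vt_def th'_def mult.assoc)
    also have "\<dots> = (LINT x|lborel. w x * (th (x \<bullet> e) * lineA \<psi> x))"
      by (rule restrict(2), simp only: M, rule test_eq_0[OF h])
    finally show ?thesis using 1 int_p[OF \<zeta>] by (simp add: \<zeta>_def)
  qed
  show ?thesis using pm p1 p2 E F by blast
qed

end

subsection \<open>Integer chains and additive functionals\<close>

definition frag_eval :: "('b \<Rightarrow> real) \<Rightarrow> ('b \<Rightarrow>\<^sub>0 int) \<Rightarrow> real" where
  "frag_eval I c = (\<Sum>\<sigma>\<in>Poly_Mapping.keys c. of_int (Poly_Mapping.lookup c \<sigma>) * I \<sigma>)"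

lemma frag_eval_superset:
  assumes "finite K" "Poly_Mapping.keys c \<subseteq> K"
  shows "frag_eval I c = (\<Sum>\<sigma>\<in>K. of_int (Poly_Mapping.lookup c \<sigma>) * I \<sigma>)"
  unfolding frag_eval_def using assms
  by (intro sum.mono_neutral_left) (auto simp: in_keys_iff)

lemma frag_eval_add: "frag_eval I (a + b) = frag_eval I a + frag_eval I b"
proof -
  have "Poly_Mapping.keys (a + b) \<subseteq> Poly_Mapping.keys a \<union> Poly_Mapping.keys b" by (rule keys_add)
  then show ?thesis
    by (simp add: frag_eval_superset[of "Poly_Mapping.keys a \<union> Poly_Mapping.keys b"]
        lookup_add distrib_right sum.distrib)
qed

lemma additive_frag_eval: "Modules.additive (frag_eval I)"
  by (simp add: Modules.additive_def frag_eval_add)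

lemma frag_eval_of [simp]: "frag_eval I (frag_of \<sigma>) = I \<sigma>"
  by (simp add: frag_eval_def)

lemma additive_frag_cmul:
  fixes F :: "('b \<Rightarrow>\<^sub>0 int) \<Rightarrow> real"
  assumes "Modules.additive F" shows "F (frag_cmul k c) = of_int k * F c"
proof (induction k rule: int_induct[where k=0])
  case base then show ?case using additive.zero[OF assms] by simp
next
  case (step1 i) then show ?case
    by (simp add: frag_cmul_distrib additive.add[OF assms] distrib_right)
next
  case (step2 i) then show ?case
    by (simp add: frag_cmul_diff_distrib additive.diff[OF assms] left_diff_distrib)
qed

lemma additive_eq_on_chains:
  assumes "Modules.additive F" "Modules.additive G" "Poly_Mapping.keys c \<subseteq> S" "\<And>\<sigma>. \<sigma> \<in> S \<Longrightarrow> F (frag_of \<sigma>) = (G (frag_of \<sigma>) :: real)"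
  shows "F c = G c"
  using assms(3)
  by (induction c rule: frag_induction)
     (simp_all add: assms(4) additive.zero[OF assms(1)] additive.zero[OF assms(2)]
       additive.diff[OF assms(1)] additive.diff[OF assms(2)])

text \<open>The reals are divisible, so a homomorphism defined on a subgroup extends (Zorn).\<close>

lemma additive_extension:
  fixes B :: "('b \<Rightarrow>\<^sub>0 int) set" and z :: "'i \<Rightarrow> ('b \<Rightarrow>\<^sub>0 int)" and a :: "'i \<Rightarrow> real"
  assumes B: "0 \<in> B" "\<And>x y. x \<in> B \<Longrightarrow> y \<in> B \<Longrightarrow> x - y \<in> B"
    and indep: "\<And>n. (\<Sum>i\<in>I. frag_cmul (n i) (z i)) \<in> B \<Longrightarrow> \<forall>i\<in>I. n i = 0" and fin: "finite I"
  shows "\<exists>F. Modules.additive F \<and> (\<forall>b\<in>B. F b = 0) \<and> (\<forall>i\<in>I. F (z i) = a i)"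
proof -
  \<comment> \<open>Partial homomorphisms are represented by their graphs, which are subgroups of
    the product; the last clause says that the graph is single-valued.\<close>
  define good where "good M \<longleftrightarrow> (0, 0) \<in> M \<and> (\<forall>p\<in>M. \<forall>q\<in>M. p - q \<in> M) \<and> (\<forall>r. (0, r) \<in> M \<longrightarrow> r = 0)"
    for M :: "(('b \<Rightarrow>\<^sub>0 int) \<times> real) set"
  \<comment> \<open>The prescribed values: zero on \<open>B\<close> and \<open>a i\<close> at
    \<open>z i\<close>. Independence modulo \<open>B\<close> makes them consistent.\<close>
  define R0 where "R0 = {(b + (\<Sum>i\<in>I. frag_cmul (n i) (z i)), \<Sum>i\<in>I. of_int (n i) * a i) | b n. b \<in> B}"
  have "good R0"
    unfolding good_def
  proof (intro conjI allI impI ballI)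
    show "(0, 0) \<in> R0" unfolding R0_def using B(1) by (auto intro!: exI[of _ 0] exI[of _ "\<lambda>_. 0"])
    show "p - q \<in> R0" if pq: "p \<in> R0" "q \<in> R0" for p q
    proof -
      obtain b n where p: "p = (b + (\<Sum>i\<in>I. frag_cmul (n i) (z i)), \<Sum>i\<in>I. of_int (n i) * a i)" "b \<in> B"
        using pq(1) unfolding R0_def by blast
      obtain b' n' where q: "q = (b' + (\<Sum>i\<in>I. frag_cmul (n' i) (z i)), \<Sum>i\<in>I. of_int (n' i) * a i)" "b' \<in> B"
        using pq(2) unfolding R0_def by blast
      have "p - q = ((b - b') + (\<Sum>i\<in>I. frag_cmul (n i - n' i) (z i)), \<Sum>i\<in>I. of_int (n i - n' i) * a i)"
        unfolding p q by (simp add: frag_cmul_diff_distrib sum_subtractf left_diff_distrib)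
      then show ?thesis unfolding R0_def using B(2)[OF p(2) q(2)]
        by (intro CollectI exI[of _ "b - b'"] exI[of _ "\<lambda>i. n i - n' i"]) simp
    qed
    show "r = 0" if r: "(0, r) \<in> R0" for r
    proof -
      obtain b n where bn: "b + (\<Sum>i\<in>I. frag_cmul (n i) (z i)) = 0" "b \<in> B" "r = (\<Sum>i\<in>I. of_int (n i) * a i)"
        using r unfolding R0_def by auto
      then have "(\<Sum>i\<in>I. frag_cmul (n i) (z i)) = 0 - b" by (simp add: eq_neg_iff_add_eq_0 add.commute)
      then have "(\<Sum>i\<in>I. frag_cmul (n i) (z i)) \<in> B" using B bn(2) by metis
      then have "\<forall>i\<in>I. n i = 0" by (rule indep)
      then show ?thesis using bn(3) by simp
    qed
  qed
  define \<A> where "\<A> = {M. R0 \<subseteq> M \<and> good M}"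
  have "\<exists>M\<in>\<A>. \<forall>X\<in>\<A>. M \<subseteq> X \<longrightarrow> X = M"
  proof (rule subset_Zorn_nonempty)
    show "\<A> \<noteq> {}" using \<open>good R0\<close> by (auto simp: \<A>_def)
    fix C assume C: "C \<noteq> {}" "subset.chain \<A> C"
    then have CA: "M \<in> C \<Longrightarrow> R0 \<subseteq> M \<and> good M" for M
      by (auto simp: subset.chain_def \<A>_def)
    have "good (\<Union>C)"
      unfolding good_def
    proof (intro conjI allI impI ballI)
      show "(0, 0) \<in> \<Union>C" using C(1) CA unfolding good_def by blast
      show "r = 0" if "(0, r) \<in> \<Union>C" for r using that CA unfolding good_def by blast
      show "p - q \<in> \<Union>C" if pq: "p \<in> \<Union>C" "q \<in> \<Union>C" for p q
      proof -
        obtain M N where MN: "M \<in> C" "N \<in> C" "p \<in> M" "q \<in> N" using pq by blast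
        then have "M \<subseteq> N \<or> N \<subseteq> M" using C(2) unfolding subset.chain_def by blast
        then show ?thesis using MN CA unfolding good_def by (metis UnionI subsetD)
      qed
    qed
    then show "\<Union>C \<in> \<A>" using C(1) CA unfolding \<A>_def by blast
  qed
  then obtain M where MA: "M \<in> \<A>" and max: "\<forall>X\<in>\<A>. M \<subseteq> X \<longrightarrow> X = M" by blast
  then have M: "R0 \<subseteq> M" "good M" by (auto simp: \<A>_def)
  have maxM: "X = M" if "good X" "M \<subseteq> X" for X
    using max that M(1) unfolding \<A>_def by auto
  have M0: "(0, 0) \<in> M" and Mdiff: "\<And>p q. p \<in> M \<Longrightarrow> q \<in> M \<Longrightarrow> p - q \<in> M"
    and Mz: "\<And>r. (0, r) \<in> M \<Longrightarrow> r = 0" using M(2) unfolding good_def by auto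
  have Madd: "p + q \<in> M" if "p \<in> M" "q \<in> M" for p q
    using Mdiff[OF that(1) Mdiff[OF M0 that(2)]] by (simp add: zero_prod_def[symmetric])
  have Mcmul: "(frag_cmul k x, of_int k * r) \<in> M" if "(x, r) \<in> M" for k x r
  proof (induction k rule: int_induct[where k=0])
    case base then show ?case using M0 by simp
  next
    case (step1 i) then show ?case using Madd[OF step1(2) that] by (simp add: frag_cmul_distrib distrib_right)
  next
    case (step2 i) then show ?case using Mdiff[OF step2(2) that] by (simp add: frag_cmul_diff_distrib left_diff_distrib)
  qed
  have uniq: "r = s" if "(x, r) \<in> M" "(x, s) \<in> M" for x r s
    using Mz[of "r - s"] Mdiff[OF that] by simp
  have total: "\<exists>r. (x, r) \<in> M" for x
  proof (rule ccontr)
    assume nx: "\<nexists>r. (x, r) \<in> M"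
    \<comment> \<open>The value to assign to \<open>x\<close>. If a nonzero multiple k x already has
      the value r, it must be r / k, which exists by divisibility; otherwise 0 is as good as any
      number.\<close>
    obtain y where y: "\<And>k r. (frag_cmul k x, r) \<in> M \<Longrightarrow> r = of_int k * y"
    proof (cases "\<exists>k r. k \<noteq> 0 \<and> (frag_cmul k x, r) \<in> M")
      case True
      then obtain k r where k: "k \<noteq> 0" "(frag_cmul k x, r) \<in> M" by blast
      have "s = of_int m * (r / of_int k)" if "(frag_cmul m x, s) \<in> M" for m s
      proof -
        have "of_int k * s = of_int m * r"
          using uniq[OF Mcmul[OF that, of k]] Mcmul[OF k(2), of m] by (simp add: mult.commute)
        then show ?thesis using k(1) by (simp add: field_simps)
      qed
      then show ?thesis using that by blast
    next
      case False
      have "s = of_int m * 0" if "(frag_cmul m x, s) \<in> M" for m s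
      proof -
        have "m = 0" using False that by blast
        then show ?thesis using that Mz[of s] by simp
      qed
      then show ?thesis using that by blast
    qed
    define X where "X = {(d + frag_cmul n x, s + of_int n * y) | d s n. (d, s) \<in> M}"
    have "good X"
      unfolding good_def
    proof (intro conjI allI impI ballI)
      show "(0, 0) \<in> X" unfolding X_def using M0 by (auto intro!: exI[of _ 0])
      show "p - q \<in> X" if pq: "p \<in> X" "q \<in> X" for p q
      proof -
        obtain d s n where p: "p = (d + frag_cmul n x, s + of_int n * y)" "(d, s) \<in> M" using pq unfolding X_def by blast
        obtain d' s' n' where q: "q = (d' + frag_cmul n' x, s' + of_int n' * y)" "(d', s') \<in> M" using pq unfolding X_def by blast
        have "p - q = ((d - d') + frag_cmul (n - n') x, (s - s') + of_int (n - n') * y)"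
          unfolding p q by (simp add: frag_cmul_diff_distrib left_diff_distrib)
        then show ?thesis unfolding X_def using Mdiff[OF p(2) q(2)] by fastforce
      qed
      show "r = 0" if r: "(0, r) \<in> X" for r
      proof -
        obtain d s n where d: "d + frag_cmul n x = 0" "r = s + of_int n * y" "(d, s) \<in> M" using r unfolding X_def by auto
        have "frag_cmul n x = - d" using d(1) by (metis add.inverse_unique)
        then have "(frag_cmul n x, - s) \<in> M"
          using Mdiff[OF M0 d(3)] by simp
        then show ?thesis using y d(2) by fastforce
      qed
    qed
    moreover have "M \<subseteq> X"
    proof
      fix p assume "p \<in> M"
      then show "p \<in> X" unfolding X_def
        by (intro CollectI exI[of _ "fst p"] exI[of _ "snd p"] exI[of _ "0::int"]) simp
    qed
    ultimately have "X = M" by (rule maxM)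
    moreover have "(x, y) \<in> X" unfolding X_def using M0
      by (intro CollectI exI[of _ "0::_ \<Rightarrow>\<^sub>0 int"] exI[of _ "0::real"] exI[of _ "1::int"]) simp
    ultimately show False using nx by blast
  qed
  define F where "F x = (THE r. (x, r) \<in> M)" for x
  have F: "F x = r" if "(x, r) \<in> M" for x r
    unfolding F_def using that uniq by blast
  have FM: "(x, F x) \<in> M" for x using total[of x] F by auto
  have "Modules.additive F"
    unfolding Modules.additive_def using F Madd[OF FM FM] by simp
  moreover have "F b = 0" if "b \<in> B" for b
  proof (rule F)
    have "(b, 0) \<in> R0" unfolding R0_def using that by (auto intro!: exI[of _ b] exI[of _ "\<lambda>_. 0"])
    then show "(b, 0) \<in> M" using M(1) by blast
  qed
  moreover have "F (z i) = a i" if "i \<in> I" for i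
  proof (rule F)
    have "(\<Sum>j\<in>I. frag_cmul (if j = i then 1 else 0) (z j)) = z i" "(\<Sum>j\<in>I. of_int (if j = i then 1 else 0) * a j) = a i"
      using fin that by (simp_all add: if_distrib[of "\<lambda>k. frag_cmul k _"] if_distrib[of real_of_int] sum.delta if_distrib[of "\<lambda>k. k * _"] cong: if_cong)
    then have "(z i, a i) \<in> R0"
      unfolding R0_def using B(1) by (intro CollectI exI[of _ 0] exI[of _ "\<lambda>j. if j = i then 1 else 0"]) simp
    then show "(z i, a i) \<in> M" using M(1) by blast
  qed
  ultimately show ?thesis by blast
qed

subsection \<open>Alexander--Spanier cocycles and singular chains\<close>

text \<open>An Alexander--Spanier 1-cocycle at a fixed scale instead of a germ at the diagonal.
  Values at distant pairs are unconstrained.\<close>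

definition small_cocycle :: "real \<Rightarrow> 'a::metric_space set \<Rightarrow> ('a \<Rightarrow> 'a \<Rightarrow> real) \<Rightarrow> bool" where
  "small_cocycle \<delta> \<Omega> h \<longleftrightarrow> (\<forall>x\<in>\<Omega>. \<forall>y\<in>\<Omega>. \<forall>z\<in>\<Omega>.
     dist x y < \<delta> \<longrightarrow> dist y z < \<delta> \<longrightarrow> dist x z < \<delta> \<longrightarrow> h x y + h y z = h x z)"

lemma small_cocycleD:
  "\<lbrakk>small_cocycle \<delta> \<Omega> h; x \<in> \<Omega>; y \<in> \<Omega>; z \<in> \<Omega>; dist x y < \<delta>; dist y z < \<delta>; dist x z < \<delta>\<rbrakk>
     \<Longrightarrow> h x y + h y z = h x z"
  by (simp add: small_cocycle_def)

lemma small_cocycle_refl: "small_cocycle \<delta> \<Omega> h \<Longrightarrow> x \<in> \<Omega> \<Longrightarrow> \<delta> > 0 \<Longrightarrow> h x x = 0"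
  using small_cocycleD[of \<delta> \<Omega> h x x x] by simp

lemma small_cocycle_lincomb:
  "small_cocycle \<delta> \<Omega> h \<Longrightarrow> small_cocycle \<delta> \<Omega> h' \<Longrightarrow> small_cocycle \<delta> \<Omega> (\<lambda>x y. h x y + a * h' x y)"
  by (auto simp: small_cocycle_def algebra_simps simp flip: distrib_left)

text \<open>The pullback of \<open>h\<close> along \<gamma> is the coboundary of \<open>q\<close> at
  some scale of the parameter. The domain is the unit interval for path sums, and a triangle in the
  proof that boundaries have sum zero.\<close>

definition primitive_along :: "('k::metric_space) set \<Rightarrow> ('k \<Rightarrow> 'a) \<Rightarrow> ('a \<Rightarrow> 'a \<Rightarrow> real) \<Rightarrow> ('k \<Rightarrow> real) \<Rightarrow> bool" where
  "primitive_along K \<gamma> h q \<longleftrightarrow> (\<exists>\<eta>>0. \<forall>s\<in>K. \<forall>t\<in>K. dist s t < \<eta> \<longrightarrow> q t - q s = h (\<gamma> s) (\<gamma> t))"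

text \<open>On a convex set \<open>q t\<close> is the sum of \<open>h\<close> along a fine subdivision of the segment from a base
  point to \<open>t\<close>; moving \<open>t\<close> a little changes each summand by a telescoping difference.\<close>

lemma primitive_along_convex:
  fixes K :: "'k::euclidean_space set" and \<gamma> :: "'k \<Rightarrow> 'a::metric_space"
  assumes K: "convex K" "compact K" and \<gamma>: "continuous_on K \<gamma>" "\<gamma> ` K \<subseteq> \<Omega>"
    and h: "small_cocycle \<delta> \<Omega> h" and \<delta>: "\<delta> > 0"
  shows "\<exists>q. primitive_along K \<gamma> h q"
proof (cases "K = {}")
  case True
  then show ?thesis by (auto simp: primitive_along_def intro!: exI[of _ 1])
next
  case False
  then obtain s0 where s0: "s0 \<in> K" by blast
  have "uniformly_continuous_on K \<gamma>" using compact_uniformly_continuous[OF \<gamma>(1) K(2)] .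
  then obtain \<eta> where \<eta>: "\<eta> > 0" "\<And>s t. s \<in> K \<Longrightarrow> t \<in> K \<Longrightarrow> dist s t < \<eta> \<Longrightarrow> dist (\<gamma> s) (\<gamma> t) < \<delta>"
    unfolding uniformly_continuous_on_def using \<delta> by (metis dist_commute)
  obtain D where D: "\<And>t. t \<in> K \<Longrightarrow> dist s0 t \<le> D"
    using compact_imp_bounded[OF K(2)] by (meson bounded_any_center)
  have D0: "D \<ge> 0" using D[OF s0] by simp
  \<comment> \<open>\<open>N\<close> makes the steps shorter than \<eta> / 2. Together with points
    \<open>s\<close>, \<open>t\<close> closer than \<eta> / 2, this keeps the diagonal of each small
    quadrilateral below \<eta>.\<close>
  obtain N :: nat where N: "D / (\<eta> / 2) < real N" using reals_Archimedean2 by blast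
  have "0 \<le> D / (\<eta> / 2)" using D0 \<eta>(1) by simp
  with N have N0: "real N > 0" by linarith
  have DN: "D / real N < \<eta> / 2" using N \<eta>(1) N0 by (simp add: field_simps)
  define p where "p i t = s0 + (real i / real N) *\<^sub>R (t - s0)" for i t
  have pK: "p i t \<in> K" if "t \<in> K" "i \<le> N" for i t
  proof -
    have "p i t = (1 - real i / real N) *\<^sub>R s0 + (real i / real N) *\<^sub>R t" by (simp add: p_def algebra_simps)
    then show ?thesis using that N0 convexD_alt[OF K(1) s0 that(1), of "real i / real N"] by simp
  qed
  have pN: "p N t = t" "p 0 t = s0" for t using N0 by (simp_all add: p_def)
  have dist_p: "dist (p i s) (p i t) \<le> dist s t" if "i \<le> N" for i s t
  proof -
    have "p i s - p i t = (real i / real N) *\<^sub>R (s - t)" by (simp add: p_def algebra_simps)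
    moreover have "real i / real N \<le> 1" using that N0 by simp
    ultimately show ?thesis
      using mult_right_mono[of "real i / real N" 1 "norm (s - t)"] by (simp add: dist_norm)
  qed
  have step: "dist (p i t) (p (Suc i) t) < \<eta> / 2" if "t \<in> K" for i t
  proof -
    have "p (Suc i) t - p i t = (1 / real N) *\<^sub>R (t - s0)" by (simp add: p_def algebra_simps add_divide_distrib)
    then have "norm (p (Suc i) t - p i t) = norm (t - s0) / real N" using N0 by simp
    then have "dist (p i t) (p (Suc i) t) = dist s0 t / real N"
      by (simp only: dist_norm norm_minus_commute)
    also have "\<dots> \<le> D / real N" using D[OF that] N0 by (simp add: divide_right_mono)
    finally show ?thesis using DN by linarith
  qed
  define q where "q t = (\<Sum>i<N. h (\<gamma> (p i t)) (\<gamma> (p (Suc i) t)))" for t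
  have "q t - q s = h (\<gamma> s) (\<gamma> t)" if st: "s \<in> K" "t \<in> K" "dist s t < \<eta> / 2" for s t
  proof -
    \<comment> \<open>The rungs between the two subdivided segments. The cocycle relation on the two
      halves of a quadrilateral turns a difference of opposite sides into a difference of
      consecutive rungs.\<close>
    define r where "r i = h (\<gamma> (p i s)) (\<gamma> (p i t))" for i
    have "h (\<gamma> (p i t)) (\<gamma> (p (Suc i) t)) - h (\<gamma> (p i s)) (\<gamma> (p (Suc i) s)) = r (Suc i) - r i" if i: "i < N" for i
    proof -
      define A B C E where "A = p i s" and "B = p i t" and "C = p (Suc i) s" and "E = p (Suc i) t"
      have K4: "A \<in> K" "B \<in> K" "C \<in> K" "E \<in> K" using pK st i by (auto simp: A_def B_def C_def E_def)
      have d: "dist A B < \<eta> / 2" "dist C E < \<eta> / 2" "dist A C < \<eta> / 2" "dist B E < \<eta> / 2"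
        using dist_p[of i s t] dist_p[of "Suc i" s t] step st i by (auto simp: A_def B_def C_def E_def)
      have "dist A E < \<eta>" using d dist_triangle[of A E B] by linarith
      then have "h (\<gamma> A) (\<gamma> B) + h (\<gamma> B) (\<gamma> E) = h (\<gamma> A) (\<gamma> E)" "h (\<gamma> A) (\<gamma> C) + h (\<gamma> C) (\<gamma> E) = h (\<gamma> A) (\<gamma> E)"
        using K4 d \<eta> \<gamma>(2) by (auto intro!: small_cocycleD[OF h])
      then show ?thesis by (simp add: r_def A_def B_def C_def E_def)
    qed
    then have "q t - q s = (\<Sum>i<N. r (Suc i) - r i)"
      unfolding q_def sum_subtractf[symmetric] by (intro sum.cong) auto
    also have "\<dots> = r N - r 0" by (rule sum_lessThan_telescope)
    also have "r 0 = 0" using small_cocycle_refl[OF h _ \<delta>] s0 \<gamma>(2) by (auto simp: r_def pN)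
    finally show ?thesis by (simp add: r_def pN)
  qed
  then show ?thesis unfolding primitive_along_def using \<eta>(1) by (intro exI[of _ q] exI[of _ "\<eta> / 2"]) auto
qed

text \<open>Over short parameter steps both primitives have the same increments, and the unit
  interval is a finite chain of such steps.\<close>

lemma primitive_along_unique:
  fixes \<gamma> :: "real \<Rightarrow> 'a"
  assumes "primitive_along {0..1} \<gamma> h q" "primitive_along {0..1} \<gamma> h q'"
  shows "q 1 - q 0 = q' 1 - q' 0"
proof -
  obtain \<eta> \<eta>' where \<eta>: "\<eta> > 0" "\<And>s t. s \<in> {0..1} \<Longrightarrow> t \<in> {0..1} \<Longrightarrow> dist s t < \<eta> \<Longrightarrow> q t - q s = h (\<gamma> s) (\<gamma> t)"
    and \<eta>': "\<eta>' > 0" "\<And>s t. s \<in> {0..1} \<Longrightarrow> t \<in> {0..1} \<Longrightarrow> dist s t < \<eta>' \<Longrightarrow> q' t - q' s = h (\<gamma> s) (\<gamma> t)"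
    using assms unfolding primitive_along_def by metis
  obtain N :: nat where N: "1 / min \<eta> \<eta>' < real N" using reals_Archimedean2 by blast
  have "0 < 1 / min \<eta> \<eta>'" using \<eta>(1) \<eta>'(1) by simp
  with N have N0: "real N > 0" by linarith
  have "1 / real N < m" if "0 < m" "1 / m < real N" for m using that N0 by (simp add: field_simps)
  from this[OF _ N] have N1: "1 / real N < \<eta>" "1 / real N < \<eta>'" using \<eta>(1) \<eta>'(1) by auto
  have "i \<le> N \<Longrightarrow> q (real i / real N) - q' (real i / real N) = q 0 - q' 0" for i
  proof (induction i)
    case (Suc i)
    have in01: "real i / real N \<in> {0..1}" "real (Suc i) / real N \<in> {0..1}" using Suc.prems N0 by auto
    have "real (Suc i) / real N - real i / real N = 1 / real N" by (simp add: add_divide_distrib)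
    then have "real i / real N - real (Suc i) / real N = - (1 / real N)" by linarith
    then have "dist (real i / real N) (real (Suc i) / real N) = 1 / real N"
      unfolding dist_real_def by simp
    then show ?case using Suc \<eta>(2)[OF in01] \<eta>'(2)[OF in01] N1 by simp
  qed simp
  from this[of N] show ?thesis using N0 by simp
qed

text \<open>The analogue of the integral of a closed form. For a continuous path and a cocycle,
  \<open>primitive_along_convex\<close> provides a primitive, and
  \<open>primitive_along_unique\<close> makes the choice immaterial.\<close>

definition path_sum :: "('a \<Rightarrow> 'a \<Rightarrow> real) \<Rightarrow> (real \<Rightarrow> 'a) \<Rightarrow> real" where
  "path_sum h \<gamma> = (SOME r. \<exists>q. primitive_along {0..1} \<gamma> h q \<and> r = q 1 - q 0)"

lemma path_sum_eqI: "primitive_along {0..1} \<gamma> h q \<Longrightarrow> path_sum h \<gamma> = q 1 - q 0"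
  unfolding path_sum_def by (rule some_equality) (auto dest: primitive_along_unique)

lemma primitive_along_compose:
  assumes "primitive_along K \<gamma> h q" "\<And>u. u \<in> L \<Longrightarrow> w u \<in> K" "\<And>u v. u \<in> L \<Longrightarrow> v \<in> L \<Longrightarrow> dist (w u) (w v) \<le> C * dist u v"
  shows "primitive_along L (\<lambda>u. \<gamma> (w u)) h (\<lambda>u. q (w u))"
proof -
  obtain \<eta> where \<eta>: "\<eta> > 0" "\<And>s t. s \<in> K \<Longrightarrow> t \<in> K \<Longrightarrow> dist s t < \<eta> \<Longrightarrow> q t - q s = h (\<gamma> s) (\<gamma> t)"
    using assms(1) unfolding primitive_along_def by metis
  have "dist (w u) (w v) < \<eta>" if "u \<in> L" "v \<in> L" "dist u v < \<eta> / (\<bar>C\<bar> + 1)" for u v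
  proof -
    have "dist (w u) (w v) \<le> C * dist u v" using assms(3) that by blast
    also have "\<dots> \<le> (\<bar>C\<bar> + 1) * dist u v" by (intro mult_right_mono) auto
    also have "\<dots> < \<eta>" using that(3) by (simp add: field_simps)
    finally show ?thesis .
  qed
  then show ?thesis unfolding primitive_along_def
    using \<eta> assms(2) by (intro exI[of _ "\<eta> / (\<bar>C\<bar> + 1)"]) auto
qed

lemma primitive_along_lincomb:
  assumes "primitive_along K \<gamma> h q" "primitive_along K \<gamma> h' q'"
  shows "primitive_along K \<gamma> (\<lambda>x y. h x y + a * h' x y) (\<lambda>t. q t + a * q' t)"
proof -
  obtain \<eta> \<eta>' where \<eta>: "\<eta> > 0" "\<And>s t. s \<in> K \<Longrightarrow> t \<in> K \<Longrightarrow> dist s t < \<eta> \<Longrightarrow> q t - q s = h (\<gamma> s) (\<gamma> t)"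
    and \<eta>': "\<eta>' > 0" "\<And>s t. s \<in> K \<Longrightarrow> t \<in> K \<Longrightarrow> dist s t < \<eta>' \<Longrightarrow> q' t - q' s = h' (\<gamma> s) (\<gamma> t)"
    using assms unfolding primitive_along_def by metis
  have "q t + a * q' t - (q s + a * q' s) = h (\<gamma> s) (\<gamma> t) + a * h' (\<gamma> s) (\<gamma> t)"
    if "s \<in> K" "t \<in> K" "dist s t < min \<eta> \<eta>'" for s t
  proof -
    have "q t + a * q' t - (q s + a * q' s) = (q t - q s) + a * (q' t - q' s)" by (simp add: algebra_simps)
    then show ?thesis using \<eta>(2)[OF that(1,2)] \<eta>'(2)[OF that(1,2)] that(3) by simp
  qed
  then show ?thesis unfolding primitive_along_def
    using \<eta>(1) \<eta>'(1) by (intro exI[of _ "min \<eta> \<eta>'"]) auto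
qed

subsection \<open>Singular chains and periods\<close>

text \<open>Standard simplices are sets of functions on the naturals. \<open>edge\<close> and
  \<open>tri\<close> parametrise them by subsets of Euclidean spaces, where convexity and uniform
  continuity are at hand.\<close>

definition edge :: "real \<Rightarrow> nat \<Rightarrow> real" where
  "edge t i = (if i = 0 then 1 - t else if i = 1 then t else 0)"

definition tri :: "real \<times> real \<Rightarrow> nat \<Rightarrow> real" where
  "tri p i = (if i = 0 then 1 - fst p - snd p else if i = 1 then fst p else if i = 2 then snd p else 0)"

definition unit_triangle :: "(real \<times> real) set" where
  "unit_triangle = {p. 0 \<le> fst p \<and> 0 \<le> snd p \<and> fst p + snd p \<le> 1}"

abbreviation simplex_top :: "nat \<Rightarrow> (nat \<Rightarrow> real) topology" where
  "simplex_top p \<equiv> subtopology (powertop_real UNIV) (standard_simplex p)"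

lemma edge_in: "t \<in> {0..1} \<Longrightarrow> edge t \<in> standard_simplex 1"
  by (auto simp: edge_def standard_simplex_def)

lemma tri_in: "p \<in> unit_triangle \<Longrightarrow> tri p \<in> standard_simplex 2"
  by (auto simp: tri_def standard_simplex_def unit_triangle_def numeral_2_eq_2)

lemma simplex1_eq_edge: "x \<in> standard_simplex 1 \<Longrightarrow> x 1 \<in> {0..1} \<and> x = edge (x 1)"
  by (auto simp: edge_def standard_simplex_def fun_eq_iff)

lemma simplex2_in_triangle: "x \<in> standard_simplex 2 \<Longrightarrow> (x 1, x 2) \<in> unit_triangle"
proof -
  assume "x \<in> standard_simplex 2"
  then have "0 \<le> x 0" "0 \<le> x 1" "0 \<le> x 2" "x 0 + x 1 + x 2 = 1"
    by (auto simp: standard_simplex_def numeral_2_eq_2)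
  then show ?thesis by (simp add: unit_triangle_def)
qed

lemma continuous_map_edge: "continuous_map (top_of_set {0..1}) (simplex_top 1) edge"
proof -
  have "continuous_on {0..1} (\<lambda>t. edge t k)" for k
    unfolding edge_def by (cases "k = 0"; cases "k = 1") (simp_all add: continuous_intros)
  then show ?thesis
    using edge_in by (auto simp: continuous_map_in_subtopology continuous_map_componentwise_UNIV)
qed

lemma continuous_map_tri: "continuous_map (top_of_set unit_triangle) (simplex_top 2) tri"
proof -
  have "continuous_on unit_triangle (\<lambda>t. tri t k)" for k
    unfolding tri_def by (cases "k = 0"; cases "k = 1"; cases "k = 2") (simp_all add: continuous_intros)
  then show ?thesis
    using tri_in by (auto simp: continuous_map_in_subtopology continuous_map_componentwise_UNIV)
qed

lemma singular_simplex_edge: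
  assumes "singular_simplex 1 (top_of_set \<Omega>) \<sigma>"
  shows "continuous_on {0..1} (\<lambda>t. \<sigma> (edge t))" "(\<lambda>t. \<sigma> (edge t)) ` {0..1} \<subseteq> \<Omega>"
proof -
  have "continuous_map (top_of_set {0..1}) (top_of_set \<Omega>) (\<sigma> \<circ> edge)"
    using assms by (intro continuous_map_compose[OF continuous_map_edge]) (simp add: singular_simplex_def)
  then show "continuous_on {0..1} (\<lambda>t. \<sigma> (edge t))" "(\<lambda>t. \<sigma> (edge t)) ` {0..1} \<subseteq> \<Omega>"
    by (auto simp: continuous_map_in_subtopology o_def)
qed

lemma singular_simplex_tri:
  assumes "singular_simplex 2 (top_of_set \<Omega>) \<sigma>"
  shows "continuous_on unit_triangle (\<lambda>t. \<sigma> (tri t))" "(\<lambda>t. \<sigma> (tri t)) ` unit_triangle \<subseteq> \<Omega>"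
proof -
  have "continuous_map (top_of_set unit_triangle) (top_of_set \<Omega>) (\<sigma> \<circ> tri)"
    using assms by (intro continuous_map_compose[OF continuous_map_tri]) (simp add: singular_simplex_def)
  then show "continuous_on unit_triangle (\<lambda>t. \<sigma> (tri t))" "(\<lambda>t. \<sigma> (tri t)) ` unit_triangle \<subseteq> \<Omega>"
    by (auto simp: continuous_map_in_subtopology o_def)
qed

text \<open>Singular simplices are extensional, hence the restriction; it makes simplices of paths
  that agree on the unit interval equal.\<close>

definition simplex_of_path :: "(real \<Rightarrow> 'a) \<Rightarrow> (nat \<Rightarrow> real) \<Rightarrow> 'a" where
  "simplex_of_path \<gamma> = restrict (\<lambda>x. \<gamma> (x 1)) (standard_simplex 1)"

lemma singular_simplex_restrictI:
  assumes "continuous_map (simplex_top p) (top_of_set K) g" "continuous_on K G" "G ` K \<subseteq> \<Omega>"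
  shows "singular_simplex p (top_of_set \<Omega>) (restrict (\<lambda>x. G (g x)) (standard_simplex p))"
proof -
  have "continuous_map (simplex_top p) (top_of_set \<Omega>) (G \<circ> g)"
    using assms(2,3) by (intro continuous_map_compose[OF assms(1)]) (auto simp: continuous_map_in_subtopology)
  then have "continuous_map (simplex_top p) (top_of_set \<Omega>) (restrict (\<lambda>x. G (g x)) (standard_simplex p))"
    by (rule continuous_map_eq) auto
  then show ?thesis by (simp add: singular_simplex_def)
qed

lemma singular_simplex_of_path:
  assumes "continuous_on {0..1} \<gamma>" "\<gamma> ` {0..1} \<subseteq> \<Omega>"
  shows "singular_simplex 1 (top_of_set \<Omega>) (simplex_of_path \<gamma>)"
  unfolding simplex_of_path_def
proof (rule singular_simplex_restrictI[OF _ assms])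
  show "continuous_map (simplex_top 1) (top_of_set {0..1}) (\<lambda>x. x 1)"
    using simplex1_eq_edge
    by (auto simp: continuous_map_in_subtopology
        intro!: continuous_map_from_subtopology continuous_map_product_projection[where X="\<lambda>_. euclideanreal", simplified])
qed

lemma simplex_of_path_edge: "t \<in> {0..1} \<Longrightarrow> simplex_of_path \<gamma> (edge t) = \<gamma> t"
  using edge_in[of t] by (simp add: simplex_of_path_def edge_def)

lemma simplex_of_path_cong:
  "(\<And>t. t \<in> {0..1} \<Longrightarrow> \<gamma> t = \<gamma>' t) \<Longrightarrow> simplex_of_path \<gamma> = simplex_of_path \<gamma>'"
  using simplex1_eq_edge by (auto simp: simplex_of_path_def restrict_def fun_eq_iff)

lemma singular_simplex_eq_of_path:
  assumes "singular_simplex 1 X \<sigma>" shows "simplex_of_path (\<lambda>t. \<sigma> (edge t)) = \<sigma>"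
proof
  fix x
  show "simplex_of_path (\<lambda>t. \<sigma> (edge t)) x = \<sigma> x"
  proof (cases "x \<in> standard_simplex 1")
    case True
    then show ?thesis using simplex1_eq_edge[OF True] by (simp add: simplex_of_path_def)
  next
    case False
    then show ?thesis using assms by (simp add: simplex_of_path_def singular_simplex_def extensional_def)
  qed
qed

lemma face_of_triangle:
  "singular_face 2 0 \<tau> = simplex_of_path (\<lambda>t. \<tau> (tri (1 - t, t)))"
  "singular_face 2 1 \<tau> = simplex_of_path (\<lambda>t. \<tau> (tri (0, t)))"
  "singular_face 2 2 \<tau> = simplex_of_path (\<lambda>t. \<tau> (tri (t, 0)))"
proof -
  have face: "singular_face 2 k \<tau> = simplex_of_path (\<lambda>t. \<tau> (tri (g t)))"
    if g: "\<And>t. simplical_face k (edge t) = tri (g t)" for k g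
  proof -
    have "(\<tau> \<circ> simplical_face k) x = \<tau> (tri (g (x 1)))" if "x \<in> standard_simplex 1" for x
      using simplex1_eq_edge[OF that] g by (metis comp_apply)
    then show ?thesis
      unfolding singular_face_def simplex_of_path_def
      by (simp del: One_nat_def add: One_nat_def[symmetric]) (rule restrict_ext, simp)
  qed
  show "singular_face 2 0 \<tau> = simplex_of_path (\<lambda>t. \<tau> (tri (1 - t, t)))"
    "singular_face 2 1 \<tau> = simplex_of_path (\<lambda>t. \<tau> (tri (0, t)))"
    "singular_face 2 2 \<tau> = simplex_of_path (\<lambda>t. \<tau> (tri (t, 0)))"
    by (rule face; auto simp: fun_eq_iff simplical_face_def edge_def tri_def)+
qed

lemma boundary_of_triangle:
  "chain_boundary 2 (frag_of \<tau>) = frag_of (simplex_of_path (\<lambda>t. \<tau> (tri (1 - t, t))))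
     - frag_of (simplex_of_path (\<lambda>t. \<tau> (tri (0, t)))) + frag_of (simplex_of_path (\<lambda>t. \<tau> (tri (t, 0))))"
proof -
  have "{..2::nat} = {0, 1, 2}" by auto
  then show ?thesis
    by (simp add: chain_boundary_of face_of_triangle del: One_nat_def)
qed

definition point_simplex :: "'a \<Rightarrow> (nat \<Rightarrow> real) \<Rightarrow> 'a" where
  "point_simplex x = restrict (\<lambda>_. x) (standard_simplex 0)"

lemma boundary_of_edge:
  "chain_boundary 1 (frag_of \<sigma>) = frag_of (point_simplex (\<sigma> (edge 1))) - frag_of (point_simplex (\<sigma> (edge 0)))"
proof -
  have "singular_face 1 0 \<sigma> = point_simplex (\<sigma> (edge 1))" "singular_face 1 1 \<sigma> = point_simplex (\<sigma> (edge 0))"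
    unfolding singular_face_def point_simplex_def
    by (auto intro!: restrict_ext arg_cong[where f=\<sigma>] simp: standard_simplex_0 simplical_face_def edge_def fun_eq_iff)
  moreover have "{..1::nat} = {0, 1}" by auto
  ultimately show ?thesis by (simp add: chain_boundary_of)
qed

lemma boundary_simplex_of_path:
  "chain_boundary 1 (frag_of (simplex_of_path \<gamma>)) = frag_of (point_simplex (\<gamma> 1)) - frag_of (point_simplex (\<gamma> 0))"
  by (simp only: boundary_of_edge simplex_of_path_edge atLeastAtMost_iff zero_le_one order_refl simp_thms)

section \<open>Sums of a cocycle along singular chains\<close>

definition chain_sum :: "('a \<Rightarrow> 'a \<Rightarrow> real) \<Rightarrow> 'a chain \<Rightarrow> real" where
  "chain_sum h = frag_eval (\<lambda>\<sigma>. path_sum h (\<lambda>t. \<sigma> (edge t)))"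

lemma additive_chain_sum: "Modules.additive (chain_sum h)"
  unfolding chain_sum_def by (rule additive_frag_eval)

lemma chain_sum_of: "chain_sum h (frag_of \<sigma>) = path_sum h (\<lambda>t. \<sigma> (edge t))"
  by (simp add: chain_sum_def)

lemma path_sum_cong:
  assumes "\<And>t. t \<in> {0..1} \<Longrightarrow> \<gamma> t = \<gamma>' t" shows "path_sum h \<gamma> = path_sum h \<gamma>'"
proof -
  have "primitive_along {0..1} \<gamma> h q \<longleftrightarrow> primitive_along {0..1} \<gamma>' h q" for q
    unfolding primitive_along_def using assms by simp
  then show ?thesis by (simp add: path_sum_def)
qed

lemma chain_sum_path: "chain_sum h (frag_of (simplex_of_path \<gamma>)) = path_sum h \<gamma>"
  unfolding chain_sum_of by (rule path_sum_cong) (rule simplex_of_path_edge)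

lemma convex_triangle: "convex unit_triangle" and compact_triangle: "compact unit_triangle"
proof -
  have eq: "unit_triangle = {p. (1, 0) \<bullet> p \<ge> 0} \<inter> {p. (0, 1) \<bullet> p \<ge> 0} \<inter> {p. (1, 1) \<bullet> p \<le> 1}"
    by (auto simp: unit_triangle_def inner_prod_def)
  show "convex unit_triangle"
    unfolding eq by (intro convex_Int convex_halfspace_le convex_halfspace_ge)
  have "closed unit_triangle"
    unfolding unit_triangle_def by (intro closed_Collect_conj closed_Collect_le continuous_intros)
  moreover have "unit_triangle \<subseteq> cbox (0, 0) (1, 1)"
    by (auto simp: unit_triangle_def cbox_Pair_eq)
  ultimately show "compact unit_triangle"
    by (metis bounded_cbox bounded_subset compact_eq_bounded_closed)
qed

text \<open>Stokes' theorem: a triangle is convex, so the pulled-back cocycle has a primitive on all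
  of it, and the increments of this primitive along the three edges cancel.\<close>

lemma chain_sum_boundary:
  assumes h: "small_cocycle \<delta> \<Omega> h" "\<delta> > 0" and c: "singular_relboundary 1 (top_of_set \<Omega>) {} c"
  shows "chain_sum h c = 0"
proof -
  obtain d where d: "singular_chain 2 (top_of_set \<Omega>) d" "chain_boundary 2 d = c"
    using c unfolding singular_boundary by (auto simp: numeral_2_eq_2)
  have add: "Modules.additive (\<lambda>d. chain_sum h (chain_boundary 2 d))"
    by (simp add: Modules.additive_def chain_boundary_add additive.add[OF additive_chain_sum])
  have zero: "chain_sum h (chain_boundary 2 (frag_of \<tau>)) = 0" if sx: "singular_simplex 2 (top_of_set \<Omega>) \<tau>" for \<tau>
  proof -
    obtain q where q: "primitive_along unit_triangle (\<lambda>t. \<tau> (tri t)) h q"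
      using primitive_along_convex[OF convex_triangle compact_triangle singular_simplex_tri[OF sx] h] by blast
    have e: "path_sum h (\<lambda>t. \<tau> (tri (g t))) = q (g 1) - q (g 0)"
      if "\<And>u. u \<in> {0..1} \<Longrightarrow> g u \<in> unit_triangle" "\<And>u v. dist (g u) (g v) \<le> 2 * dist u v" for g
      by (rule path_sum_eqI[OF primitive_along_compose[OF q that]])
    have n: "dist (a, b) (a', b') \<le> \<bar>a - a'\<bar> + \<bar>b - b'\<bar>" for a b a' b' :: real
      using sqrt_sum_squares_le_sum_abs[of "a - a'" "b - b'"] by (simp add: dist_Pair_Pair dist_real_def)
    have "path_sum h (\<lambda>t. \<tau> (tri (1 - t, t))) = q (1 - 1, 1) - q (1 - 0, 0)"
      by (rule e) (auto simp: unit_triangle_def dist_real_def intro!: order_trans[OF n])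
    moreover have "path_sum h (\<lambda>t. \<tau> (tri (0, t))) = q (0, 1) - q (0, 0)"
      by (rule e) (auto simp: unit_triangle_def dist_real_def intro!: order_trans[OF n])
    moreover have "path_sum h (\<lambda>t. \<tau> (tri (t, 0))) = q (1, 0) - q (0, 0)"
      by (rule e) (auto simp: unit_triangle_def dist_real_def intro!: order_trans[OF n])
    ultimately show ?thesis
      unfolding boundary_of_triangle
      by (simp add: additive.add[OF additive_chain_sum] additive.diff[OF additive_chain_sum] chain_sum_path)
  qed
  have "Modules.additive (\<lambda>d :: ((nat \<Rightarrow> real) \<Rightarrow> 'a) \<Rightarrow>\<^sub>0 int. 0::real)" by (simp add: Modules.additive_def)
  from additive_eq_on_chains[OF add this, of d "singular_simplex_set 2 (top_of_set \<Omega>)"] zero d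
  show ?thesis by (simp add: singular_chain_def)
qed

lemma chain_sum_lincomb:
  assumes "small_cocycle \<delta> \<Omega> h" "small_cocycle \<delta> \<Omega> h'" "\<delta> > 0" "singular_chain 1 (top_of_set \<Omega>) c"
  shows "chain_sum (\<lambda>x y. h x y + a * h' x y) c = chain_sum h c + a * chain_sum h' c"
proof -
  have "Modules.additive (\<lambda>c. chain_sum h c + a * chain_sum h' c)"
    by (simp add: Modules.additive_def additive.add[OF additive_chain_sum] algebra_simps)
  then show ?thesis
  proof (rule additive_eq_on_chains[OF additive_chain_sum])
    show "Poly_Mapping.keys c \<subseteq> singular_simplex_set 1 (top_of_set \<Omega>)" using assms(4) by (simp add: singular_chain_def)
    fix \<sigma> assume "\<sigma> \<in> singular_simplex_set 1 (top_of_set \<Omega>)"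
    then have \<sigma>: "singular_simplex 1 (top_of_set \<Omega>) \<sigma>" by simp
    obtain q q' where q: "primitive_along {0..1} (\<lambda>t. \<sigma> (edge t)) h q" and q': "primitive_along {0..1} (\<lambda>t. \<sigma> (edge t)) h' q'"
      using primitive_along_convex[OF convex_real_interval(5) compact_Icc singular_simplex_edge[OF \<sigma>]] assms(1-3) by meson
    show "chain_sum (\<lambda>x y. h x y + a * h' x y) (frag_of \<sigma>) = chain_sum h (frag_of \<sigma>) + a * chain_sum h' (frag_of \<sigma>)"
      unfolding chain_sum_of path_sum_eqI[OF q] path_sum_eqI[OF q'] path_sum_eqI[OF primitive_along_lincomb[OF q q']]
      by (simp add: algebra_simps)
  qed
qed

text \<open>The sum along an edge is the difference of \<open>s\<close> at its end points, so on
  chains the sum factors through the boundary. Any positive \<delta> will do, which makes the loss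
  of scale in the analysis harmless.\<close>

lemma chain_sum_coboundary:
  assumes "\<And>x y. x \<in> \<Omega> \<Longrightarrow> y \<in> \<Omega> \<Longrightarrow> dist x y < \<delta> \<Longrightarrow> h x y = s y - s x" "\<delta> > 0"
    and c: "singular_relcycle 1 (top_of_set \<Omega>) {} c"
  shows "chain_sum h c = 0"
proof -
  have c': "singular_chain 1 (top_of_set \<Omega>) c" "chain_boundary 1 c = 0" using c by (auto simp: singular_cycle)
  \<comment> \<open>The function that is 1 at index 0 is the only point of the standard
    0-simplex.\<close>
  let ?G = "\<lambda>c. frag_eval (\<lambda>\<rho>. s (\<rho> (\<lambda>j. if j = 0 then 1 else 0))) (chain_boundary 1 c)"
  have add: "Modules.additive ?G"
    by (simp add: Modules.additive_def chain_boundary_add frag_eval_add)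
  have "chain_sum h c = ?G c"
  proof (rule additive_eq_on_chains[OF additive_chain_sum add])
    show "Poly_Mapping.keys c \<subseteq> singular_simplex_set 1 (top_of_set \<Omega>)" using c' by (simp add: singular_chain_def)
    fix \<sigma> assume "\<sigma> \<in> singular_simplex_set 1 (top_of_set \<Omega>)"
    then have \<sigma>: "singular_simplex 1 (top_of_set \<Omega>) \<sigma>" by simp
    have "uniformly_continuous_on {0..1} (\<lambda>t. \<sigma> (edge t))"
      by (rule compact_uniformly_continuous[OF singular_simplex_edge(1)[OF \<sigma>] compact_Icc])
    then obtain \<eta> where \<eta>: "\<eta> > 0" "\<And>u v. u \<in> {0..1} \<Longrightarrow> v \<in> {0..1} \<Longrightarrow> dist u v < \<eta> \<Longrightarrow> dist (\<sigma> (edge u)) (\<sigma> (edge v)) < \<delta>"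
      unfolding uniformly_continuous_on_def using assms(2) by (metis dist_commute)
    have "primitive_along {0..1} (\<lambda>t. \<sigma> (edge t)) h (\<lambda>t. s (\<sigma> (edge t)))"
      unfolding primitive_along_def
      using \<eta> assms(1) singular_simplex_edge(2)[OF \<sigma>] by (intro exI[of _ \<eta>]) (auto simp: image_subset_iff)
    from path_sum_eqI[OF this]
    show "chain_sum h (frag_of \<sigma>) = ?G (frag_of \<sigma>)"
      by (simp add: chain_sum_of boundary_of_edge additive.diff[OF additive_frag_eval] point_simplex_def standard_simplex_0
        del: One_nat_def)
  qed
  then show ?thesis using c'(2) additive.zero[OF additive_frag_eval] by simp
qed

text \<open>Take for \<open>s\<close> the sum along any path from a base point. The paths to
  \<open>x\<close> and to \<open>y\<close> close up through a short path from \<open>x\<close> to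
  \<open>y\<close>, along which the sum is \<open>h x y\<close>.\<close>

lemma coboundary_if_chain_sum_zero:
  fixes \<Omega> :: "'a::real_normed_vector set"
  assumes h: "small_cocycle \<delta> \<Omega> h" "\<delta> > 0" and pc: "path_connected \<Omega>"
    and paths: "\<And>x y. x \<in> \<Omega> \<Longrightarrow> y \<in> \<Omega> \<Longrightarrow> dist x y < \<eta> \<Longrightarrow>
      \<exists>\<gamma>. path \<gamma> \<and> path_image \<gamma> \<subseteq> \<Omega> \<inter> ball x (\<delta> / 2) \<and> pathstart \<gamma> = x \<and> pathfinish \<gamma> = y"
    and zero: "\<And>c. singular_relcycle 1 (top_of_set \<Omega>) {} c \<Longrightarrow> chain_sum h c = 0"
  shows "\<exists>s. \<forall>x\<in>\<Omega>. \<forall>y\<in>\<Omega>. dist x y < \<eta> \<longrightarrow> h x y = s y - s x"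
proof (cases "\<Omega> = {}")
  case False
  then obtain x0 where x0: "x0 \<in> \<Omega>" by blast
  have "\<exists>g. path g \<and> path_image g \<subseteq> \<Omega> \<and> pathstart g = x0 \<and> pathfinish g = y" if "y \<in> \<Omega>" for y
    using pc x0 that unfolding path_connected_def by blast
  then obtain g where g: "\<And>y. y \<in> \<Omega> \<Longrightarrow> path (g y) \<and> path_image (g y) \<subseteq> \<Omega> \<and> pathstart (g y) = x0 \<and> pathfinish (g y) = y"
    by metis
  have chain: "singular_chain 1 (top_of_set \<Omega>) (frag_of (simplex_of_path p))" if "path p" "path_image p \<subseteq> \<Omega>" for p
    using that singular_simplex_of_path[of p \<Omega>] by (simp add: singular_chain_of path_def path_image_def)
  have "h x y = path_sum h (g y) - path_sum h (g x)" if xy: "x \<in> \<Omega>" "y \<in> \<Omega>" "dist x y < \<eta>" for x y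
  proof -
    obtain \<gamma> where \<gamma>: "path \<gamma>" "path_image \<gamma> \<subseteq> \<Omega> \<inter> ball x (\<delta> / 2)" "pathstart \<gamma> = x" "pathfinish \<gamma> = y"
      using paths[OF xy] by blast
    have "\<gamma> t \<in> \<Omega> \<inter> ball x (\<delta> / 2)" if "t \<in> {0..1}" for t
      using \<gamma>(2) that unfolding path_image_def by blast
    then have in\<gamma>: "\<gamma> t \<in> \<Omega>" "dist x (\<gamma> t) < \<delta> / 2" if "t \<in> {0..1}" for t
      using that by auto
    \<comment> \<open>Any two points of the ball of radius \<delta> / 2 are closer than \<delta>, so
      along the short path \<open>h x\<close> itself is a primitive.\<close>
    have "primitive_along {0..1} \<gamma> h (\<lambda>t. h x (\<gamma> t))"
      unfolding primitive_along_def
    proof (intro exI[of _ 1] conjI ballI impI)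
      fix s t :: real assume st: "s \<in> {0..1}" "t \<in> {0..1}"
      have "dist (\<gamma> s) (\<gamma> t) < \<delta>" using in\<gamma>(2)[OF st(1)] in\<gamma>(2)[OF st(2)] dist_triangle3[of "\<gamma> s" "\<gamma> t" x] by linarith
      then show "h x (\<gamma> t) - h x (\<gamma> s) = h (\<gamma> s) (\<gamma> t)"
        using small_cocycleD[OF h(1) xy(1) in\<gamma>(1)[OF st(1)] in\<gamma>(1)[OF st(2)]] in\<gamma>(2)[OF st(1)] in\<gamma>(2)[OF st(2)] h(2) by simp
    qed simp
    from path_sum_eqI[OF this] have ps: "path_sum h \<gamma> = h x y"
      using \<gamma>(3,4) small_cocycle_refl[OF h(1) xy(1) h(2)] by (simp add: pathstart_def pathfinish_def)
    define c where "c = frag_of (simplex_of_path (g x)) + frag_of (simplex_of_path \<gamma>) - frag_of (simplex_of_path (g y))"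
    have "singular_relcycle 1 (top_of_set \<Omega>) {} c"
      unfolding singular_cycle c_def
    proof (intro conjI singular_chain_diff singular_chain_add chain)
      show "chain_boundary 1 (frag_of (simplex_of_path (g x)) + frag_of (simplex_of_path \<gamma>) - frag_of (simplex_of_path (g y))) = 0"
        unfolding chain_boundary_diff chain_boundary_add boundary_simplex_of_path
        using g[OF xy(1)] g[OF xy(2)] \<gamma>(3,4) by (simp add: pathstart_def pathfinish_def)
    qed (use g[OF xy(1)] g[OF xy(2)] \<gamma> in auto)
    from zero[OF this] show ?thesis
      unfolding c_def additive.diff[OF additive_chain_sum] additive.add[OF additive_chain_sum] chain_sum_path ps by simp
  qed
  then show ?thesis by (intro exI[of _ "\<lambda>y. path_sum h (g y)"]) simp
qed simp

subsection \<open>Cocycles with prescribed periods\<close>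

declare One_nat_def [simp del]

text \<open>A nonempty contractible set is homotopy equivalent to a point, whose first homology
  vanishes; that the class of a cycle is trivial means that it bounds.\<close>

lemma cycle_boundary_contractible:
  assumes "contractible (Q :: 'a::real_normed_vector set)" "singular_relcycle 1 (top_of_set Q) {} c"
  shows "singular_relboundary 1 (top_of_set Q) {} c"
proof -
  have "trivial_group (homology_group 1 (top_of_set Q))"
  proof (cases "Q = {}")
    case True
    then show ?thesis by (intro trivial_homology_group_empty) simp
  next
    case False
    then have "top_of_set Q \<noteq> trivial_topology" by (metis null_topspace_iff_trivial topspace_euclidean_subtopology)
    then obtain a where a: "a \<in> Q" "top_of_set Q homotopy_equivalent_space subtopology (top_of_set Q) {a}"
      using contractible_eq_homotopy_equivalent_singleton_subtopology[of "top_of_set Q"] assms(1) by auto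
    have "trivial_group (homology_group 1 (subtopology (top_of_set Q) {a}))"
      using a(1) by (intro homology_dimension_axiom[of _ a]) auto
    then show ?thesis
      using homotopy_equivalent_space_imp_isomorphic_homology_groups[OF a(2), of 1]
      by (simp add: isomorphic_group_triviality)
  qed
  then have "carrier (homology_group 1 (top_of_set Q)) = {singular_relboundary_set 1 (top_of_set Q) {}}"
    using one_relative_homology_group[of 1 "top_of_set Q" "{}"] by (simp add: trivial_group_def)
  moreover have "homologous_rel_set 1 (top_of_set Q) {} c \<in> carrier (homology_group 1 (top_of_set Q))"
    using carrier_relative_homology_group[of 1 "top_of_set Q" "{}"] assms(2) by simp
  ultimately have "homologous_rel_set 1 (top_of_set Q) {} c \<in> {singular_relboundary_set 1 (top_of_set Q) {}}"
    by (simp only:)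
  then have "homologous_rel_set 1 (top_of_set Q) {} c = singular_relboundary_set 1 (top_of_set Q) {}"
    by (rule singletonD)
  then show ?thesis by (simp only: homologous_rel_set_eq_relboundary)
qed

definition subpath1 :: "(real \<Rightarrow> 'a) \<Rightarrow> real \<Rightarrow> real \<Rightarrow> (nat \<Rightarrow> real) \<Rightarrow> 'a" where
  "subpath1 \<gamma> a b = simplex_of_path (\<lambda>u. \<gamma> (a + u * (b - a)))"

lemma segment_in_01: "\<lbrakk>a \<in> {0..1}; b \<in> {0..1}; u \<in> {0..1}\<rbrakk> \<Longrightarrow> a + u * (b - a) \<in> {0..1::real}"
proof -
  assume *: "a \<in> {0..1}" "b \<in> {0..1}" "u \<in> {0..1}"
  have "a + u * (b - a) = (1 - u) * a + u * b" by (simp add: algebra_simps)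
  moreover have "(1 - u) * a + u * b \<le> 1" using * convex_bound_le[of a 1 b "1 - u" u] by auto
  moreover have "0 \<le> (1 - u) * a + u * b" using * by (intro add_nonneg_nonneg mult_nonneg_nonneg) auto
  ultimately show ?thesis by simp
qed

text \<open>The linear map \<open>G\<close> sends the corners of the unit triangle to 0,
  \<open>s\<close> and \<open>t\<close>; composing it with \<gamma> gives a degenerate 2-simplex
  with these faces. A functional that kills boundaries is thus additive along subpaths.\<close>

lemma subpath_triangle_boundary:
  assumes g: "continuous_on {0..1} \<gamma>" "\<gamma> ` {0..1} \<subseteq> \<Omega>" and st: "s \<in> {0..1}" "t \<in> {0..1}"
  shows "singular_relboundary 1 (top_of_set \<Omega>) {}
    (frag_of (subpath1 \<gamma> s t) - frag_of (subpath1 \<gamma> 0 t) + frag_of (subpath1 \<gamma> 0 s))"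
proof -
  define G where "G p = s * fst p + t * snd p" for p :: "real \<times> real"
  have G: "G p \<in> {0..1}" if "p \<in> unit_triangle" for p
  proof -
    have p: "0 \<le> fst p" "0 \<le> snd p" "fst p + snd p \<le> 1" using that by (auto simp: unit_triangle_def)
    have "G p \<le> 1 * fst p + 1 * snd p" unfolding G_def using st p by (intro add_mono mult_right_mono) auto
    moreover have "0 \<le> G p" unfolding G_def using st p by (intro add_nonneg_nonneg mult_nonneg_nonneg) auto
    ultimately show ?thesis using p by simp
  qed
  define \<tau> where "\<tau> = restrict (\<lambda>x. (\<gamma> \<circ> G) (x 1, x 2)) (standard_simplex 2)"
  have cm: "continuous_map (simplex_top 2) (top_of_set unit_triangle) (\<lambda>x. (x 1, x 2))"
    using simplex2_in_triangle
    by (auto simp: continuous_map_in_subtopology continuous_map_pairwise o_def simp flip: euclidean_product_topology prod_topology_euclidean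
        intro!: continuous_map_from_subtopology continuous_map_product_projection[where X="\<lambda>_. euclideanreal", simplified])
  have "singular_simplex 2 (top_of_set \<Omega>) \<tau>"
    unfolding \<tau>_def
  proof (rule singular_simplex_restrictI[OF cm])
    show "continuous_on unit_triangle (\<gamma> \<circ> G)"
      using G by (intro continuous_on_compose continuous_on_subset[OF g(1)]) (auto simp: G_def intro!: continuous_intros)
    show "(\<gamma> \<circ> G) ` unit_triangle \<subseteq> \<Omega>" using g(2) G by auto
  qed
  then have "singular_chain 2 (top_of_set \<Omega>) (frag_of \<tau>)" by (simp add: singular_chain_of)
  moreover have "chain_boundary 2 (frag_of \<tau>) =
     frag_of (subpath1 \<gamma> s t) - frag_of (subpath1 \<gamma> 0 t) + frag_of (subpath1 \<gamma> 0 s)"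
  proof -
    have "\<tau> (tri p) = \<gamma> (G p)" if "p \<in> unit_triangle" for p
      using tri_in[OF that] by (simp add: \<tau>_def tri_def)
    then have "simplex_of_path (\<lambda>u. \<tau> (tri (1 - u, u))) = subpath1 \<gamma> s t"
      "simplex_of_path (\<lambda>u. \<tau> (tri (0, u))) = subpath1 \<gamma> 0 t"
      "simplex_of_path (\<lambda>u. \<tau> (tri (u, 0))) = subpath1 \<gamma> 0 s"
      unfolding subpath1_def
      by (auto intro!: simplex_of_path_cong arg_cong[where f=\<gamma>] simp: unit_triangle_def G_def algebra_simps)
    then show ?thesis by (simp add: boundary_of_triangle)
  qed
  ultimately show ?thesis unfolding singular_boundary by (auto simp: numeral_2_eq_2)
qed

text \<open>Let \<open>h x y\<close> be the value of \<open>F\<close> on a short path from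
  \<open>x\<close> to \<open>y\<close>. Loops near \<open>x\<close> lie in a contractible set and
  bound, so the path does not matter and the cocycle relation holds. The halves of \<rho> ensure
  that three short paths joining nearby points stay within \<rho> of \<open>x\<close>.\<close>

lemma cocycle_of_functional:
  fixes \<Omega> :: "'a::real_normed_vector set"
  assumes F: "Modules.additive F" "\<And>c. singular_relboundary 1 (top_of_set \<Omega>) {} c \<Longrightarrow> F c = (0::real)"
    and Q: "\<And>x. x \<in> \<Omega> \<Longrightarrow> \<exists>Q\<subseteq>\<Omega>. \<Omega> \<inter> ball x \<rho> \<subseteq> Q \<and> contractible Q"
    and paths: "\<And>x y. x \<in> \<Omega> \<Longrightarrow> y \<in> \<Omega> \<Longrightarrow> dist x y < \<delta> \<Longrightarrow>
      \<exists>\<gamma>. path \<gamma> \<and> path_image \<gamma> \<subseteq> \<Omega> \<inter> ball x (\<rho> / 2) \<and> pathstart \<gamma> = x \<and> pathfinish \<gamma> = y"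
    and \<delta>: "0 < \<delta>" "\<delta> \<le> \<rho> / 2"
  shows "\<exists>h. small_cocycle \<delta> \<Omega> h \<and> (\<forall>c. singular_chain 1 (top_of_set \<Omega>) c \<longrightarrow> chain_sum h c = F c)"
proof -
  define P where "P x y = (SOME \<gamma>. path \<gamma> \<and> path_image \<gamma> \<subseteq> \<Omega> \<inter> ball x (\<rho> / 2) \<and> pathstart \<gamma> = x \<and> pathfinish \<gamma> = y)" for x y
  have P: "path (P x y)" "path_image (P x y) \<subseteq> \<Omega> \<inter> ball x (\<rho> / 2)" "pathstart (P x y) = x" "pathfinish (P x y) = y"
    if "x \<in> \<Omega>" "y \<in> \<Omega>" "dist x y < \<delta>" for x y
    using someI_ex[OF paths[OF that]] unfolding P_def by auto
  define h where "h x y = F (frag_of (simplex_of_path (P x y)))" for x y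
  have chainQ: "singular_chain 1 (top_of_set K) (frag_of (simplex_of_path p))" if "path p" "path_image p \<subseteq> K" for p K
    using that singular_simplex_of_path[of p K] by (simp add: singular_chain_of path_def path_image_def)
  have cycle0: "F c = 0" if xc: "x \<in> \<Omega>" "singular_chain 1 (top_of_set (\<Omega> \<inter> ball x \<rho>)) c" "chain_boundary 1 c = 0" for x c
  proof -
    obtain Q where Q: "Q \<subseteq> \<Omega>" "\<Omega> \<inter> ball x \<rho> \<subseteq> Q" "contractible Q" using Q[OF xc(1)] by blast
    have "singular_relcycle 1 (top_of_set Q) {} c"
      using xc(3) singular_chain_mono[OF xc(2) Q(2)] by (simp add: singular_cycle)
    then have "singular_relboundary 1 (top_of_set Q) {} c" by (rule cycle_boundary_contractible[OF Q(3)])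
    then show ?thesis using F(2) singular_boundary_mono[OF Q(1)] by blast
  qed
  have hF: "h x y = F (frag_of (simplex_of_path \<gamma>))"
    if xy: "x \<in> \<Omega>" "y \<in> \<Omega>" "dist x y < \<delta>" and \<gamma>: "path \<gamma>" "path_image \<gamma> \<subseteq> \<Omega> \<inter> ball x \<rho>" "pathstart \<gamma> = x" "pathfinish \<gamma> = y"
    for x y \<gamma>
  proof -
    have "path_image (P x y) \<subseteq> \<Omega> \<inter> ball x \<rho>" using P(2)[OF xy] \<delta> by (auto simp: subset_iff)
    then have "F (frag_of (simplex_of_path (P x y)) - frag_of (simplex_of_path \<gamma>)) = 0"
      using P[OF xy] \<gamma> by (intro cycle0[OF xy(1)] singular_chain_diff chainQ)
        (simp_all add: chain_boundary_diff boundary_simplex_of_path pathstart_def pathfinish_def)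
    then show ?thesis by (simp add: h_def additive.diff[OF F(1)])
  qed
  have coc: "small_cocycle \<delta> \<Omega> h"
    unfolding small_cocycle_def
  proof (intro ballI impI)
    fix x y z assume xyz: "x \<in> \<Omega>" "y \<in> \<Omega>" "z \<in> \<Omega>" "dist x y < \<delta>" "dist y z < \<delta>" "dist x z < \<delta>"
    have "ball y (\<rho> / 2) \<subseteq> ball x \<rho>"
    proof
      fix w assume "w \<in> ball y (\<rho> / 2)"
      then show "w \<in> ball x \<rho>" using xyz(4) \<delta> dist_triangle[of x w y] by simp
    qed
    then have i: "path_image (P x y) \<subseteq> \<Omega> \<inter> ball x \<rho>" "path_image (P x z) \<subseteq> \<Omega> \<inter> ball x \<rho>" "path_image (P y z) \<subseteq> \<Omega> \<inter> ball x \<rho>"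
      using P(2)[of x y] P(2)[of x z] P(2)[of y z] xyz \<delta> subset_ball[of "\<rho> / 2" \<rho> x] by auto
    have "F (frag_of (simplex_of_path (P x y)) + frag_of (simplex_of_path (P y z)) - frag_of (simplex_of_path (P x z))) = 0"
      using P[of x y] P[of y z] P[of x z] xyz i
      by (intro cycle0[OF xyz(1)] singular_chain_diff singular_chain_add chainQ)
        (simp_all add: chain_boundary_diff chain_boundary_add boundary_simplex_of_path pathstart_def pathfinish_def)
    then show "h x y + h y z = h x z" by (simp add: h_def additive.diff[OF F(1)] additive.add[OF F(1)])
  qed
  have "chain_sum h c = F c" if "singular_chain 1 (top_of_set \<Omega>) c" for c
  proof (rule additive_eq_on_chains[OF additive_chain_sum F(1)])
    show "Poly_Mapping.keys c \<subseteq> singular_simplex_set 1 (top_of_set \<Omega>)" using that by (simp add: singular_chain_def)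
    fix \<sigma> assume "\<sigma> \<in> singular_simplex_set 1 (top_of_set \<Omega>)"
    then have \<sigma>: "singular_simplex 1 (top_of_set \<Omega>) \<sigma>" by simp
    define \<gamma> where "\<gamma> t = \<sigma> (edge t)" for t
    have \<gamma>: "continuous_on {0..1} \<gamma>" "\<gamma> ` {0..1} \<subseteq> \<Omega>"
      using singular_simplex_edge[OF \<sigma>] by (simp_all add: \<gamma>_def[abs_def])
    \<comment> \<open>\<open>F\<close> on the initial piece of \<gamma>: by additivity along
      subpaths its increments are the values of \<open>F\<close> on short subpaths, hence those of
      \<open>h\<close>.\<close>
    define q where "q t = F (frag_of (subpath1 \<gamma> 0 t))" for t
    have qdiff: "q t - q s = F (frag_of (subpath1 \<gamma> s t))" if "s \<in> {0..1}" "t \<in> {0..1}" for s t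
      using F(2)[OF subpath_triangle_boundary[OF \<gamma> that]]
      by (simp add: q_def additive.add[OF F(1)] additive.diff[OF F(1)])
    have "uniformly_continuous_on {0..1} \<gamma>"
      by (rule compact_uniformly_continuous[OF \<gamma>(1) compact_Icc])
    then obtain \<eta> where \<eta>: "\<eta> > 0" "\<And>u v. u \<in> {0..1} \<Longrightarrow> v \<in> {0..1} \<Longrightarrow> dist u v < \<eta> \<Longrightarrow> dist (\<gamma> u) (\<gamma> v) < \<delta>"
      unfolding uniformly_continuous_on_def using \<delta>(1) by (metis dist_commute)
    have "primitive_along {0..1} \<gamma> h q"
      unfolding primitive_along_def
    proof (intro exI[of _ \<eta>] conjI ballI impI)
      fix s t :: real assume st: "s \<in> {0..1}" "t \<in> {0..1}" "dist s t < \<eta>"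
      define p where "p u = \<gamma> (s + u * (t - s))" for u
      have near: "\<gamma> (s + u * (t - s)) \<in> \<Omega> \<inter> ball (\<gamma> s) \<rho>" if "u \<in> {0..1}" for u
      proof -
        have "dist s (s + u * (t - s)) = u * dist s t" using that by (simp add: dist_real_def abs_mult abs_minus_commute)
        also have "\<dots> \<le> 1 * dist s t" using that by (intro mult_right_mono) auto
        finally have "dist (\<gamma> s) (\<gamma> (s + u * (t - s))) < \<delta>"
          using st by (intro \<eta>(2) segment_in_01 that) auto
        then show ?thesis using \<gamma>(2) segment_in_01[OF st(1,2) that] \<delta> by auto
      qed
      have "path p"
        unfolding path_def p_def
        by (rule continuous_on_compose2[OF \<gamma>(1)]) (auto intro!: continuous_intros simp del: atLeastAtMost_iff segment_in_01 intro: segment_in_01[OF st(1,2)])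
      moreover have "path_image p \<subseteq> \<Omega> \<inter> ball (\<gamma> s) \<rho>" using near by (auto simp: path_image_def p_def)
      ultimately have "h (\<gamma> s) (\<gamma> t) = F (frag_of (simplex_of_path p))"
        using \<gamma>(2) st \<eta>(2)[OF st] by (intro hF) (auto simp: p_def pathstart_def pathfinish_def)
      then show "q t - q s = h (\<gamma> s) (\<gamma> t)"
        using qdiff[OF st(1,2)] by (simp add: subpath1_def p_def[abs_def])
    qed (rule \<eta>(1))
    from path_sum_eqI[OF this] have "path_sum h \<gamma> = F (frag_of (subpath1 \<gamma> 0 1))" using qdiff[of 0 1] by simp
    also have "subpath1 \<gamma> 0 1 = \<sigma>"
      using singular_simplex_eq_of_path[OF \<sigma>] by (simp add: subpath1_def \<gamma>_def)
    finally show "chain_sum h (frag_of \<sigma>) = F (frag_of \<sigma>)" by (simp add: chain_sum_of \<gamma>_def[abs_def])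
  qed
  with coc show ?thesis by blast
qed

subsection \<open>The rank of the first homology group\<close>

text \<open>Independence of homology classes, restated additively for a family of representing
  cycles so that \<open>additive_extension\<close> can be applied to it.\<close>

definition independent_cycles :: "'a topology \<Rightarrow> 'i set \<Rightarrow> ('i \<Rightarrow> 'a chain) \<Rightarrow> bool" where
  "independent_cycles X I z \<longleftrightarrow> finite I \<and> (\<forall>i\<in>I. singular_relcycle 1 X {} (z i)) \<and>
     (\<forall>n. singular_relboundary 1 X {} (\<Sum>i\<in>I. frag_cmul (n i) (z i)) \<longrightarrow> (\<forall>i\<in>I. n i = 0))"

definition hclass :: "'a topology \<Rightarrow> 'a chain \<Rightarrow> 'a chain set" where
  "hclass X c = homologous_rel_set 1 X {} c"

lemma hclass_hom: "hclass X \<in> hom (relcycle_group 1 X {}) (homology_group 1 X)"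
proof -
  have "(\<lambda>a. {b. homologous_rel 1 X {} a b}) \<in> hom (relcycle_group 1 X {})
      (relcycle_group 1 X {} Mod singular_relboundary_set 1 X {})"
    using normal.r_coset_hom_Mod[OF normal_subgroup_singular_relboundary_relcycle, of 1 X "{}"]
    unfolding right_coset_singular_relboundary .
  then show ?thesis
    using nontrivial_relative_homology_group[of 1 X "{}"] by (simp add: hclass_def[abs_def])
qed

lemma hclass_carrier: "singular_relcycle 1 X {} c \<Longrightarrow> hclass X c \<in> carrier (homology_group 1 X)"
  using hom_in_carrier[OF hclass_hom, of c X] by simp

lemma hclass_mult:
  "singular_relcycle 1 X {} a \<Longrightarrow> singular_relcycle 1 X {} b \<Longrightarrow>
     hclass X a \<otimes>\<^bsub>homology_group 1 X\<^esub> hclass X b = hclass X (a + b)"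
  using hom_mult[OF hclass_hom, of a X b] by simp

lemma hclass_one: "\<one>\<^bsub>homology_group 1 X\<^esub> = hclass X 0"
  using one_relative_homology_group[of 1 X "{}"] homologous_rel_set_eq_relboundary[of 1 X "{}" 0] by (simp add: hclass_def)

lemma hclass_eq_one_iff: "hclass X c = \<one>\<^bsub>homology_group 1 X\<^esub> \<longleftrightarrow> singular_relboundary 1 X {} c"
  using one_relative_homology_group[of 1 X "{}"] homologous_rel_set_eq_relboundary[of 1 X "{}" c] by (simp add: hclass_def)

lemma hclass_int_pow:
  assumes "singular_relcycle 1 X {} c"
  shows "hclass X c [^]\<^bsub>homology_group 1 X\<^esub> (n::int) = hclass X (frag_cmul n c)"
proof -
  interpret G: comm_group "homology_group 1 X" by (rule abelian_homology_group)
  have c: "hclass X c \<in> carrier (homology_group 1 X)" by (rule hclass_carrier[OF assms])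
  have cm: "singular_relcycle 1 X {} (frag_cmul k c)" for k by (rule singular_relcycle_cmul[OF assms])
  show ?thesis
  proof (induction n rule: int_induct[where k=0])
    case base then show ?case by (simp add: hclass_one)
  next
    case (step1 i)
    have "hclass X c [^]\<^bsub>homology_group 1 X\<^esub> (i + 1) = hclass X (frag_cmul i c) \<otimes>\<^bsub>homology_group 1 X\<^esub> hclass X c"
      using step1(2) c G.int_pow_mult[OF c, of i 1] by simp
    then show ?case by (simp only: hclass_mult[OF cm assms]) (simp add: frag_cmul_distrib)
  next
    case (step2 i)
    have "hclass X c [^]\<^bsub>homology_group 1 X\<^esub> (i - 1) \<otimes>\<^bsub>homology_group 1 X\<^esub> hclass X c = hclass X (frag_cmul i c)"
      using step2(2) c G.int_pow_mult[OF c, of "i - 1" 1] by simp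
    also have "\<dots> = hclass X (frag_cmul (i - 1) c) \<otimes>\<^bsub>homology_group 1 X\<^esub> hclass X c"
      by (simp only: hclass_mult[OF cm assms]) (simp add: frag_cmul_diff_distrib)
    finally show ?case using c hclass_carrier[OF cm] G.right_cancel by simp
  qed
qed

lemma hclass_finprod:
  assumes "finite I" "\<And>i. i \<in> I \<Longrightarrow> singular_relcycle 1 X {} (z i)"
  shows "finprod (homology_group 1 X) (\<lambda>i. hclass X (z i) [^]\<^bsub>homology_group 1 X\<^esub> (n i :: int)) I
       = hclass X (\<Sum>i\<in>I. frag_cmul (n i) (z i))"
  using assms
proof (induction I)
  case empty
  interpret G: comm_group "homology_group 1 X" by (rule abelian_homology_group)
  show ?case by (simp add: hclass_one)
next
  case (insert i I)
  interpret G: comm_group "homology_group 1 X" by (rule abelian_homology_group)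
  have "finprod (homology_group 1 X) (\<lambda>i. hclass X (z i) [^]\<^bsub>homology_group 1 X\<^esub> (n i :: int)) (insert i I)
     = hclass X (frag_cmul (n i) (z i)) \<otimes>\<^bsub>homology_group 1 X\<^esub> hclass X (\<Sum>i\<in>I. frag_cmul (n i) (z i))"
    using insert by (subst G.finprod_insert) (auto simp: hclass_int_pow intro!: G.int_pow_closed hclass_carrier singular_relcycle_cmul)
  also have "\<dots> = hclass X (\<Sum>i\<in>insert i I. frag_cmul (n i) (z i))"
    using insert by (subst hclass_mult) (auto intro!: singular_relcycle_cmul singular_relcycle_sum)
  finally show ?case .
qed

lemma int_independent_imp_cycles:
  assumes "int_independent (homology_group 1 X) S"
  shows "\<exists>z. independent_cycles X S z \<and> (\<forall>g\<in>S. hclass X (z g) = g)"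
proof -
  have S: "finite S" "S \<subseteq> carrier (homology_group 1 X)"
    "\<And>n :: _ \<Rightarrow> int. finprod (homology_group 1 X) (\<lambda>g. g [^]\<^bsub>homology_group 1 X\<^esub> n g) S = \<one>\<^bsub>homology_group 1 X\<^esub> \<Longrightarrow> \<forall>g\<in>S. n g = 0"
    using assms unfolding int_independent_def by auto
  have "\<exists>c. singular_relcycle 1 X {} c \<and> hclass X c = g" if "g \<in> S" for g
    using S(2) that carrier_relative_homology_group[of 1 X "{}"] by (auto simp: hclass_def)
  then obtain z where z: "\<And>g. g \<in> S \<Longrightarrow> singular_relcycle 1 X {} (z g) \<and> hclass X (z g) = g" by metis
  have "\<forall>g\<in>S. n g = 0" if "singular_relboundary 1 X {} (\<Sum>i\<in>S. frag_cmul (n i) (z i))" for n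
  proof (rule S(3))
    interpret G: comm_group "homology_group 1 X" by (rule abelian_homology_group)
    have "finprod (homology_group 1 X) (\<lambda>g. g [^]\<^bsub>homology_group 1 X\<^esub> n g) S
       = finprod (homology_group 1 X) (\<lambda>g. hclass X (z g) [^]\<^bsub>homology_group 1 X\<^esub> n g) S"
      using z S(2) by (intro G.finprod_cong') (auto intro!: G.int_pow_closed simp: hclass_carrier)
    also have "\<dots> = hclass X (\<Sum>i\<in>S. frag_cmul (n i) (z i))"
      using z S(1) by (intro hclass_finprod) auto
    also have "\<dots> = \<one>\<^bsub>homology_group 1 X\<^esub>" using that by (simp only: hclass_eq_one_iff)
    finally show "finprod (homology_group 1 X) (\<lambda>g. g [^]\<^bsub>homology_group 1 X\<^esub> n g) S = \<one>\<^bsub>homology_group 1 X\<^esub>" .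
  qed
  then show ?thesis using z S(1) unfolding independent_cycles_def by (intro exI[of _ z]) simp
qed

lemma independent_cycles_imp_int_independent:
  fixes z :: "'a chain set \<Rightarrow> 'a chain"
  assumes "independent_cycles X S z" "\<And>g. g \<in> S \<Longrightarrow> hclass X (z g) = g"
  shows "int_independent (homology_group 1 X) S"
proof -
  interpret G: comm_group "homology_group 1 X" by (rule abelian_homology_group)
  have z: "finite S" "\<And>g. g \<in> S \<Longrightarrow> singular_relcycle 1 X {} (z g)"
    "\<And>n. singular_relboundary 1 X {} (\<Sum>i\<in>S. frag_cmul (n i) (z i)) \<Longrightarrow> \<forall>i\<in>S. n i = 0"
    using assms(1) unfolding independent_cycles_def by auto
  have S: "S \<subseteq> carrier (homology_group 1 X)" using hclass_carrier[OF z(2)] assms(2) by fastforce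
  have "\<forall>g\<in>S. n g = 0" if "finprod (homology_group 1 X) (\<lambda>g. g [^]\<^bsub>homology_group 1 X\<^esub> n g) S = \<one>\<^bsub>homology_group 1 X\<^esub>" for n :: "_ \<Rightarrow> int"
  proof (rule z(3))
    have "hclass X (\<Sum>i\<in>S. frag_cmul (n i) (z i)) = finprod (homology_group 1 X) (\<lambda>g. hclass X (z g) [^]\<^bsub>homology_group 1 X\<^esub> n g) S"
      using hclass_finprod[OF z(1,2)] by simp
    also have "\<dots> = finprod (homology_group 1 X) (\<lambda>g. g [^]\<^bsub>homology_group 1 X\<^esub> n g) S"
      using assms(2) S by (intro G.finprod_cong') (auto intro!: G.int_pow_closed)
    finally show "singular_relboundary 1 X {} (\<Sum>i\<in>S. frag_cmul (n i) (z i))"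
      using that by (simp only: hclass_eq_one_iff[symmetric])
  qed
  then show ?thesis unfolding int_independent_def using z(1) S by blast
qed

text \<open>The bound turns the supremum defining the rank into a maximum. For a set of classes that
  attains it, adjoining one more class creates a relation in which the new coefficient
  \<open>k\<close> is not 0; it need not be a unit.\<close>

lemma betti_number_basis:
  fixes X :: "'a topology"
  assumes bound: "\<And>(S :: 'a chain set set) z. independent_cycles X S z \<Longrightarrow> card S \<le> N"
  shows "\<exists>(S :: 'a chain set set) z. independent_cycles X S z \<and> betti_number 1 X = enat (card S) \<and>
     (\<forall>c. singular_relcycle 1 X {} c \<longrightarrow>
       (\<exists>k n. k \<noteq> 0 \<and> singular_relboundary 1 X {} (frag_cmul k c + (\<Sum>i\<in>S. frag_cmul (n i) (z i)))))"
proof -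
  interpret G: comm_group "homology_group 1 X" by (rule abelian_homology_group)
  define M where "M = card ` {S. int_independent (homology_group 1 X) S}"
  have "int_independent (homology_group 1 X) {}" by (simp add: int_independent_def)
  then have ne: "M \<noteq> {}" by (auto simp: M_def)
  have MN: "m \<le> N" if "m \<in> M" for m
    using that int_independent_imp_cycles bound unfolding M_def by blast
  have fin: "finite M" using MN by (meson finite_nat_set_iff_bounded_le)
  obtain S where S: "int_independent (homology_group 1 X) S" "card S = Max M"
    using Max_in[OF fin ne] unfolding M_def by auto
  obtain z where z: "independent_cycles X S z" "\<And>g. g \<in> S \<Longrightarrow> hclass X (z g) = g"
    using int_independent_imp_cycles[OF S(1)] by blast
  have zS: "finite S" "\<And>g. g \<in> S \<Longrightarrow> singular_relcycle 1 X {} (z g)"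
    "\<And>n. singular_relboundary 1 X {} (\<Sum>i\<in>S. frag_cmul (n i) (z i)) \<Longrightarrow> \<forall>i\<in>S. n i = 0"
    using z(1) unfolding independent_cycles_def by auto
  have "betti_number 1 X = enat (card S)"
    unfolding betti_number_def abelian_rank_def
  proof (rule antisym)
    show "(SUP S\<in>{S. int_independent (homology_group 1 X) S}. enat (card S)) \<le> enat (card S)"
      using Max_ge[OF fin] S(2) by (intro SUP_least) (auto simp: M_def)
    show "enat (card S) \<le> (SUP S\<in>{S. int_independent (homology_group 1 X) S}. enat (card S))"
      using S(1) by (intro SUP_upper) simp
  qed
  moreover have "\<exists>k n. k \<noteq> 0 \<and> singular_relboundary 1 X {} (frag_cmul k c + (\<Sum>i\<in>S. frag_cmul (n i) (z i)))"
    if c: "singular_relcycle 1 X {} c" for c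
  \<comment> \<open>If the class of \<open>c\<close> already belongs to \<open>S\<close>, adjoining
    it changes nothing, and the relation is that \<open>c\<close> is homologous to its
    representative.\<close>
  proof (cases "hclass X c \<in> S")
    case True
    have "(\<Sum>i\<in>S. frag_cmul (if i = hclass X c then -1 else 0) (z i)) = - z (hclass X c)"
      using zS(1) True by (simp add: if_distrib[of "\<lambda>k. frag_cmul k _"] sum.delta cong: if_cong)
    moreover have "singular_relboundary 1 X {} (c - z (hclass X c))"
      using z(2)[OF True] homologous_rel_set_eq[of 1 X "{}" c "z (hclass X c)"] by (simp add: homologous_rel_def hclass_def)
    ultimately show ?thesis
      by (intro exI[of _ 1] exI[of _ "\<lambda>i. if i = hclass X c then -1 else 0"]) simp
  next
    case False
    define S' where "S' = insert (hclass X c) S"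
    define z' where "z' = z(hclass X c := c)"
    show ?thesis
    proof (rule ccontr)
      assume neg: "\<not> ?thesis"
      have sum': "(\<Sum>i\<in>S'. frag_cmul (n i) (z' i)) = frag_cmul (n (hclass X c)) c + (\<Sum>i\<in>S. frag_cmul (n i) (z i))" for n
      proof -
        have "(\<Sum>i\<in>S. frag_cmul (n i) (z' i)) = (\<Sum>i\<in>S. frag_cmul (n i) (z i))"
          using False by (intro sum.cong) (auto simp: z'_def)
        then show ?thesis using zS(1) False by (simp add: S'_def z'_def)
      qed
      have "independent_cycles X S' z'"
        unfolding independent_cycles_def
      proof (intro conjI allI impI)
        show "finite S'" using zS(1) by (simp add: S'_def)
        show "\<forall>i\<in>S'. singular_relcycle 1 X {} (z' i)" using zS(2) c by (auto simp: S'_def z'_def)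
        fix n assume n: "singular_relboundary 1 X {} (\<Sum>i\<in>S'. frag_cmul (n i) (z' i))"
        then have "n (hclass X c) = 0" using neg unfolding sum' by blast
        moreover from this have "\<forall>i\<in>S. n i = 0" using zS(3) n unfolding sum' by simp
        ultimately show "\<forall>i\<in>S'. n i = 0" by (simp add: S'_def)
      qed
      moreover have "hclass X (z' g) = g" if "g \<in> S'" for g
        using that z(2)[of g] by (cases "g = hclass X c") (simp_all add: S'_def z'_def)
      ultimately have "int_independent (homology_group 1 X) S'"
        by (rule independent_cycles_imp_int_independent)
      then have "card S' \<le> card S" using Max_ge[OF fin] S(2) by (auto simp: M_def)
      then show False using zS(1) False by (simp add: S'_def)
    qed
  qed
  ultimately show ?thesis using z(1) by (intro exI[of _ S] exI[of _ z]) simp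
qed

declare One_nat_def [simp]

subsection \<open>Charts of a Lipschitz domain\<close>

text \<open>The constancy theorem and the Poincare lemma with square integrable potentials, stated
  in coordinate derivatives so that charts with different frames can be compared.\<close>

definition good_chart :: "(real^2) set \<Rightarrow> bool" where
  "good_chart Q \<longleftrightarrow> open Q \<and> contractible Q \<and>
     (\<forall>T. distr_linear Q T \<longrightarrow> (\<forall>\<psi>\<in>test_functions Q. \<forall>i. T (pderivative i \<psi>) = 0) \<longrightarrow>
        (\<exists>s. \<forall>\<psi>\<in>test_functions Q. T \<psi> = s * (LINT x|lborel. \<psi> x))) \<and>
     (\<forall>u :: 2 \<Rightarrow> real^2 \<Rightarrow> real.
        (\<forall>i. u i \<in> borel_measurable borel \<and> integrable lborel (u i) \<and> integrable lborel (\<lambda>x. (u i x)\<^sup>2)) \<longrightarrow>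
        (\<forall>\<psi>\<in>test_functions Q. (LINT x|lborel. u 2 x * pderivative 1 \<psi> x) = (LINT x|lborel. u 1 x * pderivative 2 \<psi> x)) \<longrightarrow>
        (\<exists>p. p \<in> borel_measurable borel \<and> integrable lborel p \<and> integrable lborel (\<lambda>x. (p x)\<^sup>2) \<and>
           (\<forall>\<psi>\<in>test_functions Q. \<forall>i. (LINT x|lborel. p x * pderivative i \<psi> x) = - (LINT x|lborel. u i x * \<psi> x))))"

lemma dd_eq_pderivative:
  assumes "smooth \<psi>"
  shows "dd v \<psi> x = v $ 1 * pderivative 1 \<psi> x + v $ 2 * pderivative 2 \<psi> x"
proof -
  have "v = (v $ 1) *\<^sub>R axis 1 1 + (v $ 2) *\<^sub>R axis 2 1"
    by (simp add: vec_eq_iff forall_2 axis_def)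
  then show ?thesis
    using dd_linear_combination[OF assms, of "v $ 1" "axis 1 1" "v $ 2" "axis 2 1" x]
    by (simp add: pderivative_eq_dd)
qed

context graph_chart
begin

lemma pderivative_frame:
  assumes "smooth \<psi>"
  shows "pderivative i \<psi> x = f $ i * dd f \<psi> x + e $ i * dd e \<psi> x"
proof -
  have "axis i 1 = (f $ i) *\<^sub>R f + (e $ i) *\<^sub>R e"
    using expand[of "axis i 1"] by (simp add: inner_axis')
  then show ?thesis
    using dd_linear_combination[OF assms, of "f $ i" f "e $ i" e x] by (simp add: pderivative_eq_dd)
qed

lemma good_chart_region:
  assumes "starlike region" shows "good_chart region"
  unfolding good_chart_def
proof (intro conjI allI impI)
  show "open region" by (rule open_region)
  show "contractible region" by (rule starlike_imp_contractible[OF assms])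
next
  fix T assume T: "distr_linear region T" and z: "\<forall>\<psi>\<in>test_functions region. \<forall>i. T (pderivative i \<psi>) = 0"
  have "T (dd v \<psi>) = 0" if \<psi>: "\<psi> \<in> test_functions region" for v \<psi>
  proof -
    have "dd v \<psi> = (\<lambda>x. v $ 1 * pderivative 1 \<psi> x - (- v $ 2) * pderivative 2 \<psi> x)"
      using dd_eq_pderivative[OF test_smooth[OF \<psi>]] by (simp add: fun_eq_iff)
    then have "T (dd v \<psi>) = T (\<lambda>x. v $ 1 * pderivative 1 \<psi> x - (- v $ 2) * pderivative 2 \<psi> x)" by simp
    also have "\<dots> = T (\<lambda>x. v $ 1 * pderivative 1 \<psi> x) - (- v $ 2) * T (pderivative 2 \<psi>)"
      unfolding pderivative_eq_dd by (rule distr_linear_diff[OF T test_scale[OF test_dd[OF \<psi>]] test_dd[OF \<psi>]])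
    also have "T (\<lambda>x. v $ 1 * pderivative 1 \<psi> x) = v $ 1 * T (pderivative 1 \<psi>)"
      using T test_dd[OF \<psi>] unfolding distr_linear_def pderivative_eq_dd by blast
    finally show ?thesis using z \<psi> by simp
  qed
  then show "\<exists>s. \<forall>\<psi>\<in>test_functions region. T \<psi> = s * (LINT x|lborel. \<psi> x)"
    by (intro zero_gradient_imp_constant[OF T])
next
  fix u :: "2 \<Rightarrow> real^2 \<Rightarrow> real"
  assume u: "\<forall>i. u i \<in> borel_measurable borel \<and> integrable lborel (u i) \<and> integrable lborel (\<lambda>x. (u i x)\<^sup>2)"
    and rot: "\<forall>\<psi>\<in>test_functions region. (LINT x|lborel. u 2 x * pderivative 1 \<psi> x) = (LINT x|lborel. u 1 x * pderivative 2 \<psi> x)"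
  have um [measurable]: "u i \<in> borel_measurable borel" and ui: "integrable lborel (u i)" and u2: "integrable lborel (\<lambda>x. (u i x)\<^sup>2)" for i
    using u by auto
  \<comment> \<open>The component of the field along \<open>v\<close>. In the frame the weak
    rotation only changes by the determinant of the frame, since the symmetric terms cancel.\<close>
  define U where "U v x = u 1 x * v $ 1 + u 2 x * v $ 2" for v :: "real^2" and x
  have Um: "U v \<in> borel_measurable borel" for v unfolding U_def[abs_def] by measurable
  have Ui: "integrable lborel (U v)" for v unfolding U_def[abs_def] using ui by simp
  have U2: "integrable lborel (\<lambda>x. (U v x)\<^sup>2)" for v
    unfolding U_def[abs_def] by (intro square_integrable_add) (simp_all add: power_mult_distrib u2)
  have UK: "(LINT x|lborel. U v x * dd w K x) =
     v $ 1 * w $ 1 * (LINT x|lborel. u 1 x * pderivative 1 K x) + v $ 1 * w $ 2 * (LINT x|lborel. u 1 x * pderivative 2 K x)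
     + v $ 2 * w $ 1 * (LINT x|lborel. u 2 x * pderivative 1 K x) + v $ 2 * w $ 2 * (LINT x|lborel. u 2 x * pderivative 2 K x)"
    if K: "K \<in> test_functions region" for v w K
  proof -
    have i: "integrable lborel (\<lambda>x. u i x * pderivative j K x)" for i j
      unfolding pderivative_eq_dd by (rule integrable_mult_test[OF ui test_dd[OF K]])
    have "U v x * dd w K x = v $ 1 * w $ 1 * (u 1 x * pderivative 1 K x) + v $ 1 * w $ 2 * (u 1 x * pderivative 2 K x)
     + v $ 2 * w $ 1 * (u 2 x * pderivative 1 K x) + v $ 2 * w $ 2 * (u 2 x * pderivative 2 K x)" for x
      by (simp add: U_def dd_eq_pderivative[OF test_smooth[OF K]] algebra_simps)
    then show ?thesis using i by simp
  qed
  have "(LINT x|lborel. U f x * dd e K x) = (LINT x|lborel. U e x * dd f K x)" if K: "K \<in> test_functions region" for K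
    unfolding UK[OF K] using rot K by (simp add: algebra_simps)
  from local_potential[OF Um Um Ui U2 Ui U2 this]
  obtain p where p: "p \<in> borel_measurable borel" "integrable lborel p" "integrable lborel (\<lambda>x. (p x)\<^sup>2)"
    and pE: "\<And>\<psi>. \<psi> \<in> test_functions region \<Longrightarrow> (LINT x|lborel. p x * dd e \<psi> x) = - (LINT x|lborel. U e x * \<psi> x)"
    and pF: "\<And>\<psi>. \<psi> \<in> test_functions region \<Longrightarrow> (LINT x|lborel. p x * dd f \<psi> x) = - (LINT x|lborel. U f x * \<psi> x)"
    by blast
  have "(LINT x|lborel. p x * pderivative i \<psi> x) = - (LINT x|lborel. u i x * \<psi> x)" if \<psi>: "\<psi> \<in> test_functions region" for i \<psi>
  proof -
    have ip: "integrable lborel (\<lambda>x. p x * dd v \<psi> x)" for v by (rule integrable_mult_test[OF p(2) test_dd[OF \<psi>]])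
    have iU: "integrable lborel (\<lambda>x. U v x * \<psi> x)" for v by (rule integrable_mult_test[OF Ui \<psi>])
    have "(LINT x|lborel. p x * pderivative i \<psi> x) = (LINT x|lborel. f $ i * (p x * dd f \<psi> x) + e $ i * (p x * dd e \<psi> x))"
      by (simp add: pderivative_frame[OF test_smooth[OF \<psi>]] algebra_simps)
    also have "\<dots> = - (f $ i * (LINT x|lborel. U f x * \<psi> x) + e $ i * (LINT x|lborel. U e x * \<psi> x))"
      using ip by (simp add: pE[OF \<psi>] pF[OF \<psi>])
    also have "f $ i * (LINT x|lborel. U f x * \<psi> x) + e $ i * (LINT x|lborel. U e x * \<psi> x)
      = (LINT x|lborel. f $ i * (U f x * \<psi> x) + e $ i * (U e x * \<psi> x))" using iU by simp
    also have "\<dots> = (LINT x|lborel. u i x * \<psi> x)"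
    proof -
      have "f $ i * U f x + e $ i * U e x = u i x" for x
      proof -
        let ?w = "vector [u 1 x, u 2 x] :: real^2"
        have "?w $ i = (?w \<bullet> f) * f $ i + (?w \<bullet> e) * e $ i"
          by (subst expand[of ?w]) simp
        moreover have "?w $ i = u i x" using exhaust_2[of i] by auto
        ultimately show ?thesis by (simp add: U_def inner_vec_def sum_2 mult.commute)
      qed
      then have "f $ i * (U f x * \<psi> x) + e $ i * (U e x * \<psi> x) = u i x * \<psi> x" for x
        by (metis distrib_right mult.assoc)
      then show ?thesis by simp
    qed
    finally show ?thesis .
  qed
  with p show "\<exists>p. p \<in> borel_measurable borel \<and> integrable lborel p \<and> integrable lborel (\<lambda>x. (p x)\<^sup>2) \<and>
           (\<forall>\<psi>\<in>test_functions region. \<forall>i. (LINT x|lborel. p x * pderivative i \<psi> x) = - (LINT x|lborel. u i x * \<psi> x))"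
    by blast
qed

end

text \<open>Over a base of half-width \<open>a\<close> the graph varies by at most b/4. Being at
  most b/2 below \<open>z\<close> and not above it at the centre, it stays between t0 - 3b/4 and t0
  + b/4, where t0 is the height of \<open>z\<close>; the region reaches up to t0 + b. One statement
  thus covers points on the graph and points slightly above it.\<close>

lemma good_chart_at:
  fixes f e z :: "real^2"
  assumes fe: "f \<bullet> f = 1" "e \<bullet> e = 1" "f \<bullet> e = 0" and Lip: "L-lipschitz_on UNIV \<phi>"
    and hab: "0 < a" "0 < b" "L * a \<le> b / 4"
    and t0: "z \<bullet> e - b / 2 \<le> \<phi> (z \<bullet> f)" "\<phi> (z \<bullet> f) \<le> z \<bullet> e"
  shows "\<exists>Q. good_chart Q \<and> Q \<subseteq> ball z (a + b) \<inter> {x. \<phi> (x \<bullet> f) < x \<bullet> e} \<and>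
    ball z (min a b) \<inter> {x. \<phi> (x \<bullet> f) < x \<bullet> e} \<subseteq> Q"
proof -
  define s0 where "s0 = z \<bullet> f"
  define t0 where "t0 = z \<bullet> e"
  have L0: "L \<ge> 0" by (rule lipschitz_on_nonneg[OF Lip])
  have lip: "\<bar>\<phi> s - \<phi> s'\<bar> \<le> L * \<bar>s - s'\<bar>" for s s'
    using lipschitz_onD[OF Lip, of s s'] by (simp add: dist_real_def)
  have near: "\<bar>\<phi> s - \<phi> s0\<bar> \<le> b / 4" if "\<bar>s - s0\<bar> \<le> a" for s
    using lip[of s s0] mult_left_mono[OF that L0] hab(3) by linarith
  have \<phi>0: "t0 - b / 2 \<le> \<phi> s0" "\<phi> s0 \<le> t0" using assms(8,9) by (simp_all add: s0_def t0_def)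
  interpret graph_chart f e \<phi> "s0 - a" "s0 + a" "t0 + b / 4" "t0 + b"
  proof
    show "continuous_on UNIV \<phi>" by (rule lipschitz_on_continuous_on[OF Lip])
    show "\<phi> s \<le> t0 + b / 4" if "s0 - a < s" "s < s0 + a" for s
    proof -
      have "\<bar>s - s0\<bar> \<le> a" using that by linarith
      from near[OF this] \<phi>0 show ?thesis by linarith
    qed
  qed (use fe hab in auto)
  have nrm: "norm x \<le> \<bar>x \<bullet> f\<bar> + \<bar>x \<bullet> e\<bar>" for x :: "real^2"
    using norm_triangle_ineq[of "(x \<bullet> f) *\<^sub>R f" "(x \<bullet> e) *\<^sub>R e"] by (simp flip: expand)
  have regionD: "\<bar>x \<bullet> f - s0\<bar> < a" "\<phi> (x \<bullet> f) < x \<bullet> e" "x \<bullet> e < t0 + b" "t0 - b < x \<bullet> e" if "x \<in> region" for x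
  proof -
    show 1: "\<bar>x \<bullet> f - s0\<bar> < a" "\<phi> (x \<bullet> f) < x \<bullet> e" "x \<bullet> e < t0 + b" using that by (auto simp: region_def)
    show "t0 - b < x \<bullet> e" using near[of "x \<bullet> f"] 1 \<phi>0 hab(2) by linarith
  qed
  have "region \<subseteq> ball z (a + b)"
  proof
    fix x assume x: "x \<in> region"
    have "norm (x - z) \<le> \<bar>(x - z) \<bullet> f\<bar> + \<bar>(x - z) \<bullet> e\<bar>" by (rule nrm)
    also have "\<dots> < a + b" using regionD[OF x] by (simp add: inner_diff_left s0_def t0_def)
    finally show "x \<in> ball z (a + b)" by (simp add: dist_norm norm_minus_commute)
  qed
  moreover have "region \<subseteq> {x. \<phi> (x \<bullet> f) < x \<bullet> e}" using regionD by blast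
  moreover have "ball z (min a b) \<inter> {x. \<phi> (x \<bullet> f) < x \<bullet> e} \<subseteq> region"
  proof
    fix x assume x: "x \<in> ball z (min a b) \<inter> {x. \<phi> (x \<bullet> f) < x \<bullet> e}"
    then have "norm (x - z) < a" "norm (x - z) < b" by (auto simp: dist_norm norm_minus_commute)
    then have "\<bar>(x - z) \<bullet> f\<bar> < a" "\<bar>(x - z) \<bullet> e\<bar> < b" using norm_ge_coord[of "x - z"] by linarith+
    then have "\<bar>x \<bullet> f - s0\<bar> < a" "\<bar>x \<bullet> e - t0\<bar> < b" by (simp_all add: s0_def t0_def inner_diff_left)
    then show "x \<in> region" using x by (auto simp: region_def)
  qed
  moreover have "starlike region"
    unfolding starlike_def
  proof (intro bexI ballI subsetI)
    \<comment> \<open>The star centre lies at height t0 + b/2, at least b/4 above every point of the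
      graph over the base. As the graph varies by at most b/4 over half a base, segments from
      \<open>y\<close> to points above the graph stay above it.\<close>
    define y where "y = s0 *\<^sub>R f + (t0 + b / 2) *\<^sub>R e"
    have y: "y \<bullet> f = s0" "y \<bullet> e = t0 + b / 2" by (simp_all add: y_def inner_add_left ff ee fe ef)
    show "y \<in> region" using \<phi>0 hab by (simp add: region_def y)
    fix x w assume x: "x \<in> region" and "w \<in> closed_segment y x"
    then obtain m where l: "0 \<le> m" "m \<le> 1" "w = (1 - m) *\<^sub>R y + m *\<^sub>R x" by (auto simp: closed_segment_def)
    have "w \<bullet> f = (1 - m) * s0 + m * (x \<bullet> f)" and we: "w \<bullet> e = (1 - m) * (t0 + b / 2) + m * (x \<bullet> e)"
      by (simp_all only: l(3) inner_add_left inner_scaleR_left y)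
    then have wf: "w \<bullet> f - s0 = m * (x \<bullet> f - s0)" by (simp add: algebra_simps)
    have "\<bar>w \<bullet> f - s0\<bar> \<le> 1 * \<bar>x \<bullet> f - s0\<bar>" unfolding wf abs_mult using l by (intro mult_right_mono) auto
    then have 1: "\<bar>w \<bullet> f - s0\<bar> < a" using regionD(1)[OF x] by simp
    have "w \<bullet> e \<le> (1 - m) * (t0 + b / 2) + m * (t0 + b)"
      unfolding we using l regionD(3)[OF x] by (intro add_left_mono mult_left_mono) auto
    also have "(1 - m) * (t0 + b / 2) + m * (t0 + b) = t0 + b / 2 + m * (b / 2)"
      by (simp add: field_simps)
    finally have we': "w \<bullet> e \<le> t0 + b / 2 + m * (b / 2)" .
    have 2: "w \<bullet> e < t0 + b \<or> m = 1"
    proof (cases "m = 1")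
      case False
      then have "m * (b / 2) < 1 * (b / 2)" using l hab(2) by (intro mult_strict_right_mono) auto
      then show ?thesis using we' by linarith
    qed simp
    have "w \<bullet> f - x \<bullet> f = (1 - m) * (s0 - x \<bullet> f)" using wf by (simp add: algebra_simps)
    then have "\<bar>w \<bullet> f - x \<bullet> f\<bar> \<le> (1 - m) * a"
      using l regionD(1)[OF x] by (simp add: abs_mult abs_minus_commute mult_left_mono)
    then have "L * \<bar>w \<bullet> f - x \<bullet> f\<bar> \<le> L * ((1 - m) * a)" by (rule mult_left_mono[OF _ L0])
    also have "\<dots> = (1 - m) * (L * a)" by simp
    also have "\<dots> \<le> (1 - m) * (b / 4)" using l hab(3) by (intro mult_left_mono) auto
    finally have "\<phi> (w \<bullet> f) \<le> \<phi> (x \<bullet> f) + (1 - m) * (b / 4)"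
      using lip[of "w \<bullet> f" "x \<bullet> f"] by linarith
    also have "\<dots> = (1 - m) * (\<phi> (x \<bullet> f) + b / 4) + m * \<phi> (x \<bullet> f)" by (simp add: algebra_simps)
    also have "\<dots> \<le> (1 - m) * (t0 + b / 2) + m * \<phi> (x \<bullet> f)"
    proof (intro add_right_mono mult_left_mono)
      show "\<phi> (x \<bullet> f) + b / 4 \<le> t0 + b / 2"
        using near[of "x \<bullet> f"] regionD(1)[OF x] \<phi>0 by linarith
    qed (use l in simp)
    finally have 3: "\<phi> (w \<bullet> f) \<le> (1 - m) * (t0 + b / 2) + m * \<phi> (x \<bullet> f)" .
    have 4: "\<phi> (w \<bullet> f) < w \<bullet> e"
    proof (cases "m = 0")
      case True
      then show ?thesis using \<phi>0 hab(2) by (simp add: l(3) y)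
    next
      case False
      then have "m * \<phi> (x \<bullet> f) < m * (x \<bullet> e)" using l regionD(2)[OF x] by simp
      then show ?thesis using 3 unfolding we by linarith
    qed
    show "w \<in> region"
      using 1 2 4 x l(3) by (auto simp: region_def)
  qed
  ultimately show ?thesis using good_chart_region by blast
qed

lemma chart_near_closure:
  assumes \<Omega>: "bounded_lipschitz_domain \<Omega>" and z: "z \<in> closure \<Omega>" and \<epsilon>: "\<epsilon> > 0"
  shows "\<exists>Q \<rho>. 0 < \<rho> \<and> \<rho> \<le> \<epsilon> \<and> good_chart Q \<and> \<Omega> \<inter> ball z \<rho> \<subseteq> Q \<and> Q \<subseteq> \<Omega> \<inter> ball z \<epsilon>"
proof (cases "z \<in> \<Omega>")
  case True
  have "open \<Omega>" using \<Omega> by (simp add: bounded_lipschitz_domain_def)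
  then obtain r where r: "r > 0" "ball z r \<subseteq> \<Omega>" using True open_contains_ball by blast
  define b where "b = min r \<epsilon> / 2"
  have b: "b > 0" "b + b \<le> r" "b + b \<le> \<epsilon>" using r \<epsilon> by (auto simp: b_def)
  \<comment> \<open>For an interior point the graph is the horizontal line b/2 below
    \<open>z\<close>, the lowest that \<open>good_chart_at\<close> admits, and the chart is a
    rectangle.\<close>
  define \<phi> :: "real \<Rightarrow> real" where "\<phi> = (\<lambda>_. z $ 2 - b / 2)"
  have "\<exists>Q. good_chart Q \<and> Q \<subseteq> ball z (b + b) \<inter> {x. \<phi> (x \<bullet> axis 1 1) < x \<bullet> axis 2 1} \<and>
    ball z (min b b) \<inter> {x. \<phi> (x \<bullet> axis 1 1) < x \<bullet> axis 2 1} \<subseteq> Q"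
  proof (rule good_chart_at)
    show "axis 1 1 \<bullet> (axis 1 1 :: real^2) = 1" "axis 2 1 \<bullet> (axis 2 1 :: real^2) = 1" "axis 1 1 \<bullet> (axis 2 1 :: real^2) = 0"
      by (simp_all add: inner_axis_axis)
    show "0-lipschitz_on UNIV \<phi>" unfolding \<phi>_def by (rule lipschitz_on_constant)
  qed (use b in \<open>simp_all add: \<phi>_def inner_axis\<close>)
  then obtain Q where Q: "good_chart Q" "Q \<subseteq> ball z (b + b)" "ball z b \<inter> {x. \<phi> (x \<bullet> axis 1 1) < x \<bullet> axis 2 1} \<subseteq> Q" by auto
  have "\<phi> (x \<bullet> axis 1 1) < x \<bullet> axis 2 1" if "x \<in> ball z (b / 2)" for x
  proof -
    have "\<bar>x $ 2 - z $ 2\<bar> < b / 2"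
      using that component_le_norm_cart[of "x - z" 2] by (simp add: dist_norm norm_minus_commute)
    then have "z $ 2 - b / 2 < x $ 2" by linarith
    then show ?thesis by (simp add: \<phi>_def inner_axis)
  qed
  moreover have "ball z (b / 2) \<subseteq> ball z b" using b by (intro subset_ball) simp
  ultimately have "\<Omega> \<inter> ball z (b / 2) \<subseteq> Q" using Q(3) by blast
  moreover have "Q \<subseteq> \<Omega> \<inter> ball z \<epsilon>" using Q(2) r(2) b subset_ball[of "b + b" r z] subset_ball[of "b + b" \<epsilon> z] by blast
  ultimately show ?thesis using Q(1) b by (intro exI[of _ Q] exI[of _ "b / 2"]) auto
next
  case False
  then have "z \<in> frontier \<Omega>" using z \<Omega> by (simp add: frontier_def bounded_lipschitz_domain_def interior_open)
  then obtain r L \<phi> and T :: "real^2 \<Rightarrow> real^2" where r: "r > 0" and T: "orthogonal_transformation T" and L: "L-lipschitz_on UNIV \<phi>"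
    and chart: "\<Omega> \<inter> ball z r = {y \<in> ball z r. \<phi> (T y $ 1) < T y $ 2}"
    using \<Omega> unfolding bounded_lipschitz_domain_def by blast
  \<comment> \<open>The preimages of the coordinate axes form the frame in which the coordinates of
    \<open>T x\<close> are inner products with \<open>x\<close>.\<close>
  obtain f e where f: "T f = axis 1 1" and e: "T e = axis 2 1"
    using orthogonal_transformation_surj[OF T] by (metis surjD)
  have inT: "T v \<bullet> T w = v \<bullet> w" for v w using T by (simp add: orthogonal_transformation_def)
  have co: "T x $ 1 = x \<bullet> f" "T x $ 2 = x \<bullet> e" for x
    using inT[of x f] inT[of x e] by (simp_all add: f e inner_axis)
  have fe: "f \<bullet> f = 1" "e \<bullet> e = 1" "f \<bullet> e = 0"
    using inT[of f f] inT[of e e] inT[of f e] by (simp_all add: f e inner_axis_axis)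
  have chart': "x \<in> \<Omega> \<longleftrightarrow> \<phi> (x \<bullet> f) < x \<bullet> e" if "x \<in> ball z r" for x
    using chart that unfolding co by blast
  have cont: "continuous_on UNIV (\<lambda>y::real^2. \<phi> (y \<bullet> f))"
    by (rule continuous_on_compose2[OF lipschitz_on_continuous_on[OF L]]) (auto intro!: continuous_intros)
  \<comment> \<open>A frontier point lies on the graph: strictly below it a neighbourhood would miss
    \<Omega>, and strictly above it \<open>z\<close> would belong to \<Omega>.\<close>
  have "\<not> z \<bullet> e < \<phi> (z \<bullet> f)"
  proof
    assume *: "z \<bullet> e < \<phi> (z \<bullet> f)"
    have U: "open ({y. y \<bullet> e < \<phi> (y \<bullet> f)} \<inter> ball z r)"
      by (intro open_Int open_ball open_Collect_less continuous_intros cont)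
    have "z \<in> {y. y \<bullet> e < \<phi> (y \<bullet> f)} \<inter> ball z r" using * r by simp
    then have "({y. y \<bullet> e < \<phi> (y \<bullet> f)} \<inter> ball z r) \<inter> closure \<Omega> \<noteq> {}"
      using z by blast
    then have "({y. y \<bullet> e < \<phi> (y \<bullet> f)} \<inter> ball z r) \<inter> \<Omega> \<noteq> {}"
      unfolding open_Int_closure_eq_empty[OF U] .
    then obtain y where "y \<in> \<Omega>" "y \<in> ball z r" "y \<bullet> e < \<phi> (y \<bullet> f)" by blast
    then show False using chart'[of y] by simp
  qed
  moreover have "\<not> \<phi> (z \<bullet> f) < z \<bullet> e" using chart'[of z] False r by simp
  ultimately have \<phi>z: "\<phi> (z \<bullet> f) = z \<bullet> e" by simp
  have L0: "L \<ge> 0" by (rule lipschitz_on_nonneg[OF L])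
  define b where "b = min r \<epsilon> / 2"
  \<comment> \<open>The bound b / (4 (L + 1)) gives L a \<le> b/4, also if L = 0; \<open>a\<close>
    at most \<open>b\<close> keeps the chart within distance 2b.\<close>
  define a where "a = min b (b / (4 * (L + 1)))"
  have b: "b > 0" "b + b \<le> r" "b + b \<le> \<epsilon>" using r \<epsilon> by (auto simp: b_def)
  have a: "a > 0" "a \<le> b" using b(1) L0 by (auto simp: a_def)
  have "L * a \<le> (L + 1) * (b / (4 * (L + 1)))"
    using L0 a by (intro mult_mono) (auto simp: a_def)
  also have "\<dots> = b / 4" using L0 by (simp add: divide_simps)
  finally have La: "L * a \<le> b / 4" .
  obtain Q where Q: "good_chart Q" "Q \<subseteq> ball z (a + b)" "Q \<subseteq> {x. \<phi> (x \<bullet> f) < x \<bullet> e}"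
    "ball z (min a b) \<inter> {x. \<phi> (x \<bullet> f) < x \<bullet> e} \<subseteq> Q"
    using good_chart_at[OF fe L a(1) b(1) La, of z] \<phi>z b(1) by auto
  have sub: "ball z (a + b) \<subseteq> ball z r" "ball z (a + b) \<subseteq> ball z \<epsilon>" "ball z (min a b) \<subseteq> ball z r"
    using a b by (auto intro!: subset_ball)
  have "Q \<subseteq> \<Omega> \<inter> ball z \<epsilon>" using Q(2,3) sub chart' by blast
  moreover have "\<Omega> \<inter> ball z (min a b) \<subseteq> Q" using Q(4) sub(3) chart' by blast
  ultimately show ?thesis using Q(1) a b by (intro exI[of _ Q] exI[of _ "min a b"]) auto
qed

text \<open>The Lebesgue number of a cover of the compact closure by chart balls gives one radius
  for all points. Charts are taken of size \<epsilon> / 2 because they are centred at a nearby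
  point, not at \<open>x\<close>.\<close>

lemma uniform_charts:
  assumes \<Omega>: "bounded_lipschitz_domain \<Omega>" and \<epsilon>: "\<epsilon> > 0"
  shows "\<exists>\<eta>>0. \<forall>x\<in>\<Omega>. \<exists>Q. good_chart Q \<and> \<Omega> \<inter> ball x \<eta> \<subseteq> Q \<and> Q \<subseteq> \<Omega> \<inter> ball x \<epsilon>"
proof -
  have "compact (closure \<Omega>)" using \<Omega> by (simp add: bounded_lipschitz_domain_def)
  define chart where "chart z \<rho> Q \<longleftrightarrow> 0 < \<rho> \<and> \<rho> \<le> \<epsilon> / 2 \<and> good_chart Q \<and>
    \<Omega> \<inter> ball z \<rho> \<subseteq> Q \<and> Q \<subseteq> \<Omega> \<inter> ball z (\<epsilon> / 2)" for z \<rho> Q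
  have chart: "\<exists>Q \<rho>. chart z \<rho> Q" if "z \<in> closure \<Omega>" for z
    unfolding chart_def by (rule chart_near_closure[OF \<Omega> that]) (use \<epsilon> in simp)
  define \<G> where "\<G> = {ball z \<rho> | z \<rho>. \<exists>Q. chart z \<rho> Q}"
  obtain \<eta> where \<eta>: "0 < \<eta>" "\<And>x. x \<in> closure \<Omega> \<Longrightarrow> \<exists>G\<in>\<G>. ball x \<eta> \<subseteq> G"
  proof (rule Heine_Borel_lemma[OF \<open>compact (closure \<Omega>)\<close>, of \<G>])
    show "closure \<Omega> \<subseteq> \<Union> \<G>"
    proof
      fix z assume "z \<in> closure \<Omega>"
      then obtain Q \<rho> where c: "chart z \<rho> Q" using chart by blast
      then have "z \<in> ball z \<rho>" by (simp add: chart_def)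
      moreover have "ball z \<rho> \<in> \<G>" using c unfolding \<G>_def by blast
      ultimately show "z \<in> \<Union> \<G>" by blast
    qed
    show "\<And>G. G \<in> \<G> \<Longrightarrow> open G" unfolding \<G>_def by auto
  qed blast
  have "\<exists>Q. good_chart Q \<and> \<Omega> \<inter> ball x \<eta> \<subseteq> Q \<and> Q \<subseteq> \<Omega> \<inter> ball x \<epsilon>" if x: "x \<in> \<Omega>" for x
  proof -
    have "x \<in> closure \<Omega>" using x closure_subset by blast
    from \<eta>(2)[OF this] obtain z \<rho> Q where z: "chart z \<rho> Q" "ball x \<eta> \<subseteq> ball z \<rho>" unfolding \<G>_def by blast
    have Q: "good_chart Q" "\<Omega> \<inter> ball z \<rho> \<subseteq> Q" "Q \<subseteq> \<Omega> \<inter> ball z (\<epsilon> / 2)" and "\<rho> \<le> \<epsilon> / 2"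
      using z(1) by (simp_all add: chart_def)
    have "x \<in> ball z \<rho>" using z(2) \<eta>(1) centre_in_ball by blast
    with \<open>\<rho> \<le> \<epsilon> / 2\<close> have zx: "dist z x < \<epsilon> / 2" by simp
    have "ball z (\<epsilon> / 2) \<subseteq> ball x \<epsilon>"
    proof
      fix w assume "w \<in> ball z (\<epsilon> / 2)"
      then show "w \<in> ball x \<epsilon>" using zx dist_triangle3[of x w z] by simp
    qed
    then show ?thesis using Q z(2) by (intro exI[of _ Q]) blast
  qed
  then show ?thesis using \<eta>(1) by blast
qed

subsection \<open>Weak derivatives\<close>

definition square_integrable :: "(real^2 \<Rightarrow> real) \<Rightarrow> bool" where
  "square_integrable v \<longleftrightarrow> v \<in> borel_measurable borel \<and> integrable lborel v \<and> integrable lborel (\<lambda>x. (v x)\<^sup>2)"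

text \<open>Classes in \<open>L\<^sup>2(\<Omega>)\<close> are replaced by Borel functions on the plane, so that all integrals are
  with respect to \<open>lborel\<close>.\<close>

definition weak_gradient :: "(real^2) set \<Rightarrow> (real^2 \<Rightarrow> real) \<Rightarrow> (2 \<Rightarrow> real^2 \<Rightarrow> real) \<Rightarrow> bool" where
  "weak_gradient Q p v \<longleftrightarrow> (\<forall>\<psi>\<in>test_functions Q. \<forall>i.
     (LINT x|lborel. p x * pderivative i \<psi> x) = - (LINT x|lborel. v i x * \<psi> x))"

definition weak_rot :: "(2 \<Rightarrow> real^2 \<Rightarrow> real) \<Rightarrow> distribution" where
  "weak_rot v \<psi> = (LINT x|lborel. v 1 x * pderivative 2 \<psi> x) - (LINT x|lborel. v 2 x * pderivative 1 \<psi> x)"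

definition represents :: "(real^2) set \<Rightarrow> (real^2 \<Rightarrow> real) \<Rightarrow> (real^2 \<Rightarrow> real) \<Rightarrow> bool" where
  "represents \<Omega> v u \<longleftrightarrow> square_integrable v \<and> u \<in> borel_measurable (lebesgue_on \<Omega>) \<and> (AE x in lebesgue_on \<Omega>. u x = v x)"

lemma test_pderivative: "\<psi> \<in> test_functions Q \<Longrightarrow> pderivative i \<psi> \<in> test_functions Q"
  by (simp add: pderivative_eq_dd test_dd)

lemma good_chart_open: "good_chart Q \<Longrightarrow> open Q"
  and good_chart_contractible: "good_chart Q \<Longrightarrow> contractible Q"
  by (simp_all add: good_chart_def)

lemma good_chart_constant:
  assumes "good_chart Q" "distr_linear Q T" "\<And>\<psi> i. \<psi> \<in> test_functions Q \<Longrightarrow> T (pderivative i \<psi>) = 0"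
  shows "\<exists>s. \<forall>\<psi>\<in>test_functions Q. T \<psi> = s * (LINT x|lborel. \<psi> x)"
  using assms unfolding good_chart_def by blast

lemma good_chart_potential:
  assumes "good_chart Q" "\<And>i. square_integrable (v i)" "\<And>\<psi>. \<psi> \<in> test_functions Q \<Longrightarrow> weak_rot v \<psi> = 0"
  shows "\<exists>p. square_integrable p \<and> weak_gradient Q p v"
proof -
  have "\<forall>\<psi>\<in>test_functions Q. (LINT x|lborel. v 2 x * pderivative 1 \<psi> x) = (LINT x|lborel. v 1 x * pderivative 2 \<psi> x)"
    using assms(3) by (simp add: weak_rot_def)
  then show ?thesis
    using assms(1,2) unfolding good_chart_def square_integrable_def weak_gradient_def by blast
qed

lemma square_integrable_lincomb:
  assumes "square_integrable u" "square_integrable v" shows "square_integrable (\<lambda>x. u x + a * v x)"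
proof -
  have [measurable]: "u \<in> borel_measurable borel" "v \<in> borel_measurable borel"
    using assms by (auto simp: square_integrable_def)
  have "integrable lborel (\<lambda>x. (a * v x)\<^sup>2)" using assms(2) by (simp add: square_integrable_def power_mult_distrib)
  then have "integrable lborel (\<lambda>x. (u x + a * v x)\<^sup>2)"
    using assms by (intro square_integrable_add) (auto simp: square_integrable_def)
  then show ?thesis using assms by (auto simp: square_integrable_def)
qed

lemma square_integrable_test: "\<psi> \<in> test_functions Q \<Longrightarrow> square_integrable \<psi>"
  using test_integrable[OF test_mult[of \<psi> Q \<psi>]] test_integrable[of \<psi> Q] test_measurable[of \<psi> Q] test_smooth[of \<psi> Q]
  by (simp add: square_integrable_def power2_eq_square)

lemma square_integrable_mult_test:
  assumes "square_integrable v" "\<psi> \<in> test_functions Q" shows "square_integrable (\<lambda>x. v x * \<psi> x)"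
proof -
  have [measurable]: "v \<in> borel_measurable borel" "\<psi> \<in> borel_measurable borel"
    using assms test_measurable by (auto simp: square_integrable_def)
  obtain B where "\<And>x. \<bar>\<psi> x\<bar> \<le> B" using test_bounded[OF assms(2)] by blast
  then show ?thesis
    using assms unfolding square_integrable_def
    by (auto intro!: integrable_mult_test[OF _ assms(2)] square_integrable_mult_bounded)
qed

lemma square_integrable_integrable_test:
  "square_integrable v \<Longrightarrow> \<psi> \<in> test_functions Q \<Longrightarrow> integrable lborel (\<lambda>x. v x * \<psi> x)"
  by (simp add: square_integrable_def integrable_mult_test)

lemma integral_lincomb_test:
  assumes "square_integrable u" "square_integrable v" "\<psi> \<in> test_functions Q"
  shows "(LINT x|lborel. (u x + a * v x) * \<psi> x) = (LINT x|lborel. u x * \<psi> x) + a * (LINT x|lborel. v x * \<psi> x)"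
  using square_integrable_integrable_test[OF assms(1,3)] square_integrable_integrable_test[OF assms(2,3)]
  by (simp add: distrib_right mult.assoc)

lemma weak_gradient_lincomb:
  assumes "weak_gradient Q p v" "weak_gradient Q p' v'" "square_integrable p" "square_integrable p'"
    "\<And>i. square_integrable (v i)" "\<And>i. square_integrable (v' i)"
  shows "weak_gradient Q (\<lambda>x. p x + a * p' x) (\<lambda>i x. v i x + a * v' i x)"
  using assms unfolding weak_gradient_def
  by (auto simp: integral_lincomb_test[OF _ _ test_pderivative] integral_lincomb_test)

lemma weak_rot_lincomb:
  assumes "\<And>i. square_integrable (v i)" "\<And>i. square_integrable (v' i)" "\<psi> \<in> test_functions Q"
  shows "weak_rot (\<lambda>i x. v i x + a * v' i x) \<psi> = weak_rot v \<psi> + a * weak_rot v' \<psi>"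
  unfolding weak_rot_def integral_lincomb_test[OF assms(1,2) test_pderivative[OF assms(3)]]
  by (simp add: right_diff_distrib)

lemma pderivative_lincomb:
  "\<phi> \<in> test_functions Q \<Longrightarrow> \<psi> \<in> test_functions Q \<Longrightarrow>
    pderivative i (\<lambda>x. \<phi> x + a * \<psi> x) = (\<lambda>x. pderivative i \<phi> x + a * pderivative i \<psi> x)"
  unfolding pderivative_eq_dd
  using smooth_has_derivative[OF test_smooth[of \<phi> Q]] smooth_has_derivative[OF test_smooth[of \<psi> Q]]
  by (intro ext dd_eqI) (auto intro!: derivative_eq_intros)

lemma distr_linearI:
  assumes "\<And>\<phi> \<psi> a. \<phi> \<in> test_functions Q \<Longrightarrow> \<psi> \<in> test_functions Q \<Longrightarrow> T (\<lambda>x. \<phi> x + a * \<psi> x) = T \<phi> + a * T \<psi>"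
  shows "distr_linear Q T"
proof -
  have T0: "T (\<lambda>x. 0) = 0" using assms[OF test_zero test_zero, of 1] by simp
  show ?thesis
    unfolding distr_linear_def
  proof (intro conjI ballI allI)
    fix \<phi> \<psi> assume "\<phi> \<in> test_functions Q" "\<psi> \<in> test_functions Q"
    then show "T (\<lambda>x. \<phi> x + \<psi> x) = T \<phi> + T \<psi>" using assms[of \<phi> \<psi> 1] by simp
  next
    fix \<phi> a assume "\<phi> \<in> test_functions Q"
    then show "T (\<lambda>x. a * \<phi> x) = a * T \<phi>" using assms[OF test_zero, of \<phi> a] T0 by simp
  qed
qed

lemma distr_linear_weak_rot:
  assumes "\<And>i. square_integrable (v i)" shows "distr_linear Q (weak_rot v)"
proof (rule distr_linearI)
  fix \<phi> \<psi> a assume t: "\<phi> \<in> test_functions Q" "\<psi> \<in> test_functions Q"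
  have "integrable lborel (\<lambda>x. v i x * pderivative j \<phi> x)" "integrable lborel (\<lambda>x. v i x * pderivative j \<psi> x)" for i j
    using t assms by (auto intro!: square_integrable_integrable_test test_pderivative)
  then have "(LINT x|lborel. v i x * (pderivative j \<phi> x + a * pderivative j \<psi> x)) =
      (LINT x|lborel. v i x * pderivative j \<phi> x) + a * (LINT x|lborel. v i x * pderivative j \<psi> x)" for i j
    by (simp add: distrib_left mult.left_commute[of _ a])
  then show "weak_rot v (\<lambda>x. \<phi> x + a * \<psi> x) = weak_rot v \<phi> + a * weak_rot v \<psi>"
    unfolding weak_rot_def pderivative_lincomb[OF t] by (simp add: right_diff_distrib)
qed

text \<open>Both derivatives fall on the test function, where they commute.\<close>

lemma weak_rot_weak_gradient:
  assumes "weak_gradient Q p v" "\<psi> \<in> test_functions Q" shows "weak_rot v \<psi> = 0"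
proof -
  have "pderivative 1 (pderivative 2 \<psi>) = pderivative 2 (pderivative 1 \<psi>)"
    unfolding pderivative_eq_dd using dd_commute[OF test_smooth[OF assms(2)]] by blast
  moreover have h: "(LINT x|lborel. p x * pderivative i (pderivative j \<psi>) x) = - (LINT x|lborel. v i x * pderivative j \<psi> x)" for i j
    using assms(1) test_pderivative[OF assms(2)] unfolding weak_gradient_def by blast
  ultimately show ?thesis using h[of 1 2] h[of 2 1] unfolding weak_rot_def by simp
qed

text \<open>Used on overlaps of charts: constants are compared after multiplication by the integral
  of a common test function, which can be cancelled.\<close>

lemma exists_positive_test:
  assumes "open U" "x \<in> U" shows "\<exists>\<psi>\<in>test_functions U. (LINT x|lborel. \<psi> x) > 0"
proof -
  obtain r where r: "r > 0" "cball x r \<subseteq> U" using assms open_contains_cball by blast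
  define \<psi> where "\<psi> = plateau x (r / 2)"
  have z: "\<psi> y = 0" if "y \<notin> cball x r" for y
    unfolding \<psi>_def using that r(1) by (intro plateau_eq_0) auto
  have t: "\<psi> \<in> test_functions U"
    by (rule test_functionsI[OF _ compact_cball r(2)]) (simp_all add: \<psi>_def smooth_plateau z[unfolded \<psi>_def])
  have "step t \<ge> 0" for t unfolding step_def flat_exp_def by (auto intro!: divide_nonneg_pos simp: field_simps add_pos_pos)
  then have "(LINT x|lborel. \<psi> x) > 0"
    using plateau_eq_1[of "r / 2" x x] r(1)
    by (intro integral_pos_continuous[OF smooth_continuous_on[OF test_smooth[OF t]] test_integrable[OF t], of x])
      (simp_all add: \<psi>_def plateau_def)
  with t show ?thesis by blast
qed

subsection \<open>Borel representatives of square integrable functions\<close>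

lemma regular_distr_eq:
  assumes \<Omega>: "open \<Omega>" and u: "represents \<Omega> v u" and \<psi>: "\<psi> \<in> test_functions \<Omega>"
  shows "regular_distr \<Omega> u \<psi> = (LINT x|lborel. v x * \<psi> x)"
proof -
  have [measurable]: "v \<in> borel_measurable borel" "\<psi> \<in> borel_measurable borel"
    using u test_measurable[OF \<psi>] by (auto simp: represents_def square_integrable_def)
  have \<Omega>': "\<Omega> \<inter> space lebesgue \<in> sets lebesgue" using \<Omega> by (simp add: borel_open)
  have m: "g \<in> borel_measurable (lebesgue_on \<Omega>)" if "g \<in> borel_measurable borel" for g :: "real^2 \<Rightarrow> real"
    using that by (simp add: measurable_completion measurable_restrict_space1)
  have "regular_distr \<Omega> u \<psi> = (LINT x|lebesgue_on \<Omega>. v x * \<psi> x)"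
    unfolding regular_distr_def
  proof (rule integral_cong_AE)
    show "(\<lambda>x. u x * \<psi> x) \<in> borel_measurable (lebesgue_on \<Omega>)" "(\<lambda>x. v x * \<psi> x) \<in> borel_measurable (lebesgue_on \<Omega>)"
      using u m[of \<psi>] m[of v] by (simp_all add: represents_def borel_measurable_times)
    have "AE x in lebesgue_on \<Omega>. u x = v x" using u by (simp add: represents_def)
    then show "AE x in lebesgue_on \<Omega>. u x * \<psi> x = v x * \<psi> x" by eventually_elim simp
  qed
  also have "\<dots> = (LINT x|lebesgue. indicator \<Omega> x *\<^sub>R (v x * \<psi> x))"
    by (rule integral_restrict_space[OF \<Omega>'])
  also have "\<dots> = (LINT x|lebesgue. v x * \<psi> x)"
    using test_eq_0[OF \<psi>] by (intro Bochner_Integration.integral_cong) (auto simp: indicator_def)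
  also have "\<dots> = (LINT x|lborel. v x * \<psi> x)"
    by (rule integral_completion) measurable
  finally show ?thesis .
qed

lemma represents_lincomb:
  assumes "represents \<Omega> v u" "represents \<Omega> v' u'"
  shows "represents \<Omega> (\<lambda>x. v x + a * v' x) (\<lambda>x. u x + a * u' x)"
  using assms unfolding represents_def
  by (auto intro!: square_integrable_lincomb borel_measurable_add borel_measurable_times elim: eventually_elim2)

text \<open>A Lebesgue measurable function agrees almost everywhere with a Borel function, which is
  then set to 0 outside \<Omega>. Integrability follows from |v| \<le> v^2 + 1/4 on the bounded set
  \<Omega>.\<close>

lemma exists_represents:
  fixes u :: "real^2 \<Rightarrow> real"
  assumes \<Omega>: "open \<Omega>" "bounded \<Omega>" and u: "u \<in> borel_measurable (lebesgue_on \<Omega>)" "integrable (lebesgue_on \<Omega>) (\<lambda>x. (u x)\<^sup>2)"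
  shows "\<exists>v. represents \<Omega> v u"
proof -
  have \<Omega>': "\<Omega> \<inter> space lebesgue \<in> sets lebesgue" "\<Omega> \<in> sets lebesgue" using \<Omega> by (simp_all add: borel_open)
  have [measurable]: "\<Omega> \<in> sets borel" using \<Omega> by simp
  define g where "g x = indicator \<Omega> x *\<^sub>R u x" for x
  have g: "g \<in> borel_measurable lebesgue" "integrable lebesgue (\<lambda>x. (g x)\<^sup>2)"
  proof -
    show "g \<in> borel_measurable lebesgue"
      using u(1) borel_measurable_restrict_space_iff[OF \<Omega>'(1), of u] by (simp add: g_def[abs_def])
    have "integrable lebesgue (\<lambda>x. indicator \<Omega> x *\<^sub>R (u x)\<^sup>2)"
      by (rule iffD1[OF integrable_restrict_space[OF \<Omega>'(1)] u(2)])
    moreover have "(\<lambda>x. (g x)\<^sup>2) = (\<lambda>x. indicator \<Omega> x *\<^sub>R (u x)\<^sup>2)" by (auto simp: g_def indicator_def fun_eq_iff)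
    ultimately show "integrable lebesgue (\<lambda>x. (g x)\<^sup>2)" by simp
  qed
  obtain v0 where v0: "v0 \<in> borel_measurable lborel" "AE x in lborel. g x = v0 x"
    using completion_ex_borel_measurable_real[OF g(1)] by blast
  have [measurable]: "v0 \<in> borel_measurable borel" using v0(1) by simp
  define v where "v x = v0 x * indicator \<Omega> x" for x
  have [measurable]: "v \<in> borel_measurable borel" unfolding v_def[abs_def] by measurable
  have AEv: "AE x in lebesgue. g x = v x"
    using AE_completion[OF v0(2)] by eventually_elim (auto simp: v_def g_def indicator_def)
  have "integrable lebesgue (\<lambda>x. (v x)\<^sup>2)"
    by (rule integrable_cong_AE_imp[OF g(2)]) (use AEv in \<open>auto intro: measurable_completion elim: eventually_mono\<close>)
  then have v2: "integrable lborel (\<lambda>x. (v x)\<^sup>2)" by (subst (asm) integrable_completion) auto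
  have "integrable lborel (indicator \<Omega> :: real^2 \<Rightarrow> real)"
    using emeasure_bounded_finite[OF \<Omega>(2)] by (simp add: integrable_indicator_iff)
  with v2 have bd: "integrable lborel (\<lambda>x. (v x)\<^sup>2 + indicator \<Omega> x :: real)" by simp
  have "\<bar>v x\<bar> \<le> (v x)\<^sup>2 + indicator \<Omega> x" for x
  proof (cases "x \<in> \<Omega>")
    case True
    have "0 \<le> (\<bar>v x\<bar> - 1/2)\<^sup>2" by simp
    then have "\<bar>v x\<bar> \<le> (v x)\<^sup>2 + 1/4" by (simp add: power2_eq_square algebra_simps)
    then show ?thesis using True by simp
  qed (simp add: v_def)
  then have "integrable lborel v"
    by (intro Bochner_Integration.integrable_bound[OF bd]) (auto intro: order_trans[OF _ abs_ge_self])
  then have "square_integrable v" using v2 by (simp add: square_integrable_def)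
  moreover have "AE x in lebesgue_on \<Omega>. u x = v x"
    using AEv by (subst AE_restrict_space_iff[OF \<Omega>'(1)]) (auto simp: g_def elim: eventually_mono)
  ultimately show ?thesis using u(1) by (auto simp: represents_def)
qed

lemma square_integrable_imp_L2:
  assumes \<Omega>: "open \<Omega>" and p: "square_integrable p"
  shows "p \<in> L2 \<Omega>" "represents \<Omega> p p"
proof -
  have \<Omega>': "\<Omega> \<inter> space lebesgue \<in> sets lebesgue" using \<Omega> by (simp add: borel_open)
  have [measurable]: "p \<in> borel_measurable borel" "\<Omega> \<in> sets borel" using p \<Omega> by (auto simp: square_integrable_def)
  have m: "p \<in> borel_measurable (lebesgue_on \<Omega>)"
    by (simp add: measurable_completion measurable_restrict_space1)
  then show "represents \<Omega> p p" using p by (simp add: represents_def)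
  have "integrable lborel (\<lambda>x. (p x)\<^sup>2 * indicator \<Omega> x)"
    using p by (intro integrable_real_mult_indicator) (auto simp: square_integrable_def)
  then have "integrable lebesgue (\<lambda>x. indicator \<Omega> x *\<^sub>R (p x)\<^sup>2)"
    by (subst integrable_completion) (auto simp: mult.commute)
  then have "integrable (lebesgue_on \<Omega>) (\<lambda>x. (p x)\<^sup>2)" by (subst integrable_restrict_space[OF \<Omega>'])
  with m show "p \<in> L2 \<Omega>" by (simp add: L2_def)
qed

lemma vec_norm_square: "(norm (x::real^2))\<^sup>2 = (x $ 1)\<^sup>2 + (x $ 2)\<^sup>2"
  by (simp add: norm_vec_def L2_set_def sum_2)

lemma L2_vec_iff:
  fixes u :: "real^2 \<Rightarrow> real^2"
  shows "u \<in> L2 \<Omega> \<longleftrightarrow> (\<forall>i. (\<lambda>x. u x $ i) \<in> L2 \<Omega>)"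
proof
  assume u: "u \<in> L2 \<Omega>"
  then have um: "u \<in> borel_measurable (lebesgue_on \<Omega>)" and ui: "integrable (lebesgue_on \<Omega>) (\<lambda>x. (norm (u x))\<^sup>2)"
    by (auto simp: L2_def)
  have "(\<lambda>x. u x $ i) \<in> L2 \<Omega>" for i
  proof -
    have m: "(\<lambda>x. u x $ i) \<in> borel_measurable (lebesgue_on \<Omega>)"
      by (rule borel_measurable_continuous_on[OF _ um]) (intro continuous_intros)
    have "(u x $ i)\<^sup>2 \<le> (norm (u x))\<^sup>2" for x
      using power_mono[OF component_le_norm_cart[of "u x" i] abs_ge_zero, of 2] by simp
    then have "integrable (lebesgue_on \<Omega>) (\<lambda>x. (u x $ i)\<^sup>2)"
      using m by (intro Bochner_Integration.integrable_bound[OF ui]) auto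
    then show ?thesis using m by (simp add: L2_def)
  qed
  then show "(\<forall>i. (\<lambda>x. u x $ i) \<in> L2 \<Omega>)" by blast
next
  assume "(\<forall>i. (\<lambda>x. u x $ i) \<in> L2 \<Omega>)"
  then have c: "(\<lambda>x. u x $ i) \<in> borel_measurable (lebesgue_on \<Omega>)" "integrable (lebesgue_on \<Omega>) (\<lambda>x. (u x $ i)\<^sup>2)" for i
    by (auto simp: L2_def)
  have "u \<in> borel_measurable (lebesgue_on \<Omega>)"
    using c(1) by (subst borel_measurable_euclidean_space) (auto simp: Basis_vec_def inner_axis)
  then show "u \<in> L2 \<Omega>" using c(2) by (simp add: L2_def vec_norm_square)
qed

subsection \<open>Whitney forms\<close>

text \<open>The scales. Potentials live on \<open>Q0\<close>; their differences are constants on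
  \<open>Q1\<close>, which gives cocycles at scale \<open>\<rho>1\<close>. Points closer than
  \<open>\<rho>2\<close> are joined within half of \<open>\<rho>1\<close>, so vanishing periods give
  coboundaries at scale \<open>\<rho>2\<close>. The supports of the partition have radius 2r, hence
  two that meet have centres within 4r, half of \<open>\<rho>2\<close>. \<open>Q3\<close> is small
  enough for local primitives of Whitney forms. The partition sums to 1 on an open set containing
  the closure.\<close>

locale charted_domain =
  fixes \<Omega> :: "(real^2) set" and \<rho>0 \<rho>1 \<rho>2 \<rho>3 r :: real
    and Q0 Q1 Q3 :: "real^2 \<Rightarrow> (real^2) set" and N :: "(real^2) set" and \<rho> :: "real^2 \<Rightarrow> real^2 \<Rightarrow> real"
  assumes op: "open \<Omega>" and bd: "bounded \<Omega>" and con: "connected \<Omega>" and ne: "\<Omega> \<noteq> {}"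
    and pos: "0 < \<rho>0" "0 < \<rho>1" "0 < \<rho>2" "0 < \<rho>3" "0 < r" and le: "\<rho>1 \<le> \<rho>0 / 2" "\<rho>2 \<le> \<rho>1 / 2" "8 * r = \<rho>2" "\<rho>3 \<le> 4 * r"
    and Q0: "\<And>x. x \<in> \<Omega> \<Longrightarrow> good_chart (Q0 x) \<and> \<Omega> \<inter> ball x \<rho>0 \<subseteq> Q0 x \<and> Q0 x \<subseteq> \<Omega>"
    and Q1: "\<And>x. x \<in> \<Omega> \<Longrightarrow> good_chart (Q1 x) \<and> \<Omega> \<inter> ball x \<rho>1 \<subseteq> Q1 x \<and> Q1 x \<subseteq> \<Omega> \<inter> ball x (\<rho>0 / 2)"
    and Q3: "\<And>x. x \<in> \<Omega> \<Longrightarrow> good_chart (Q3 x) \<and> \<Omega> \<inter> ball x \<rho>3 \<subseteq> Q3 x \<and> Q3 x \<subseteq> \<Omega> \<inter> ball x (4 * r)"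
    and paths: "\<And>x y. x \<in> \<Omega> \<Longrightarrow> y \<in> \<Omega> \<Longrightarrow> dist x y < \<rho>2 \<Longrightarrow>
      \<exists>\<gamma>. path \<gamma> \<and> path_image \<gamma> \<subseteq> \<Omega> \<inter> ball x (\<rho>1 / 2) \<and> pathstart \<gamma> = x \<and> pathfinish \<gamma> = y"
    and N: "finite N" "N \<subseteq> \<Omega>" and cover: "closure \<Omega> \<subseteq> (\<Union>c\<in>N. ball c r)"
    and smooth_\<rho>: "\<And>c. c \<in> N \<Longrightarrow> smooth (\<rho> c)"
    and supp: "\<And>c x. c \<in> N \<Longrightarrow> dist c x \<ge> 2 * r \<Longrightarrow> \<rho> c x = 0"
    and sum1: "\<And>x. x \<in> (\<Union>c\<in>N. ball c r) \<Longrightarrow> (\<Sum>c\<in>N. \<rho> c x) = 1"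
begin

definition d\<rho> :: "2 \<Rightarrow> real^2 \<Rightarrow> real^2 \<Rightarrow> real" where "d\<rho> i c = pderivative i (\<rho> c)"

lemma \<Omega>_cover: "x \<in> \<Omega> \<Longrightarrow> x \<in> (\<Union>c\<in>N. ball c r)"
  using cover closure_subset by blast

lemma sum_\<rho>: "x \<in> \<Omega> \<Longrightarrow> (\<Sum>c\<in>N. \<rho> c x) = 1"
  by (rule sum1[OF \<Omega>_cover])

lemma sum_d\<rho>: assumes "x \<in> \<Omega>" shows "(\<Sum>c\<in>N. d\<rho> i c x) = 0"
proof -
  have "(\<Sum>c\<in>N. d\<rho> i c x) = dd (axis i 1) (\<lambda>x. \<Sum>c\<in>N. \<rho> c x) x"
    unfolding d\<rho>_def pderivative_eq_dd by (rule dd_sum[symmetric]) (rule smooth_\<rho>)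
  also have "\<dots> = dd (axis i 1) (\<lambda>x. 1) x"
    by (rule dd_cong_open[OF _ \<Omega>_cover[OF assms]]) (auto simp: sum1 intro!: open_UN)
  finally show ?thesis by simp
qed

lemma smooth_d\<rho>: "c \<in> N \<Longrightarrow> smooth (d\<rho> i c)"
  by (simp add: d\<rho>_def smooth_\<rho> smooth_pderivative)

lemma \<rho>_near: "c \<in> N \<Longrightarrow> \<rho> c x \<noteq> 0 \<Longrightarrow> dist c x \<le> 2 * r"
  using supp[of c x] by (cases "dist c x \<ge> 2 * r") auto

lemma d\<rho>_near: assumes "c \<in> N" "d\<rho> i c x \<noteq> 0" shows "dist c x \<le> 2 * r"
proof (rule ccontr)
  assume "\<not> ?thesis"
  then have "x \<in> - cball c (2 * r)" by simp
  moreover have "\<rho> c y = 0" if "y \<in> - cball c (2 * r)" for y using that supp[OF assms(1), of y] by simp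
  ultimately have "dd (axis i 1) (\<rho> c) x = 0" by (intro dd_eq_0_open[of "- cball c (2 * r)"]) auto
  then show False using assms(2) by (simp add: d\<rho>_def pderivative_eq_dd)
qed

lemma \<rho>_test: "c \<in> N \<Longrightarrow> \<rho> c \<in> test_functions UNIV"
  by (rule test_functionsI[OF smooth_\<rho> compact_cball[of c "2 * r"]]) (auto simp: supp)

definition whitney :: "(real^2 \<Rightarrow> real^2 \<Rightarrow> real) \<Rightarrow> 2 \<Rightarrow> real^2 \<Rightarrow> real" where
  "whitney h i x = (\<Sum>c\<in>N. \<Sum>d\<in>N. h d c * (\<rho> d x * d\<rho> i c x))"

text \<open>A smooth primitive of \<open>whitney h\<close> on the part of \<Omega> within 4r of
  \<open>z\<close>, see \<open>whitney_potential\<close>; it interpolates the values of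
  \<open>h z\<close> at the centres.\<close>

definition potential :: "(real^2 \<Rightarrow> real^2 \<Rightarrow> real) \<Rightarrow> real^2 \<Rightarrow> real^2 \<Rightarrow> real" where
  "potential h z x = (\<Sum>c\<in>N. h z c * \<rho> c x)"

lemma whitney_test: "whitney h i \<in> test_functions UNIV"
  unfolding whitney_def[abs_def] d\<rho>_def
  by (intro test_sum test_scale test_mult test_pderivative \<rho>_test smooth_\<rho>)

lemma whitney_lincomb: "whitney (\<lambda>x y. h x y + a * h' x y) i x = whitney h i x + a * whitney h' i x"
  by (simp add: whitney_def sum.distrib sum_distrib_left algebra_simps)

lemma whitney_sq: "square_integrable (whitney h i)"
  by (rule square_integrable_test[OF whitney_test])

lemma potential_test: "potential h z \<in> test_functions UNIV"
  unfolding potential_def[abs_def] by (intro test_sum test_scale \<rho>_test)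

text \<open>Splitting \<open>h d c\<close> factors the double sum; the sum of the \<rho> is 1 and
  the sum of their derivatives is 0, so one product survives. It is used with \<open>s\<close> a
  global primitive of \<open>h\<close> and with \<open>s = h z\<close>.\<close>

lemma whitney_of_difference:
  assumes x: "x \<in> \<Omega>"
    and h: "\<And>c d. c \<in> N \<Longrightarrow> d \<in> N \<Longrightarrow> dist c x \<le> 2 * r \<Longrightarrow> dist d x \<le> 2 * r \<Longrightarrow> h d c = s c - s d"
  shows "whitney h i x = (\<Sum>c\<in>N. s c * d\<rho> i c x)"
proof -
  have t: "h d c * (\<rho> d x * d\<rho> i c x) = (s c * d\<rho> i c x) * \<rho> d x - d\<rho> i c x * (s d * \<rho> d x)" if "c \<in> N" "d \<in> N" for c d
  proof (cases "\<rho> d x = 0 \<or> d\<rho> i c x = 0")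
    case False
    then have e: "h d c = s c - s d" using h \<rho>_near d\<rho>_near that by blast
    show ?thesis unfolding e by (simp add: algebra_simps)
  qed auto
  have "whitney h i x = (\<Sum>c\<in>N. \<Sum>d\<in>N. (s c * d\<rho> i c x) * \<rho> d x - d\<rho> i c x * (s d * \<rho> d x))"
    unfolding whitney_def by (intro sum.cong refl t)
  also have "\<dots> = (\<Sum>c\<in>N. s c * d\<rho> i c x) * (\<Sum>d\<in>N. \<rho> d x) - (\<Sum>c\<in>N. d\<rho> i c x) * (\<Sum>d\<in>N. s d * \<rho> d x)"
    by (simp add: sum_subtractf sum_product)
  finally show ?thesis by (simp add: sum_\<rho>[OF x] sum_d\<rho>[OF x])
qed

lemma pderivative_combination:
  "pderivative i (\<lambda>x. \<Sum>c\<in>N. s c * \<rho> c x) x = (\<Sum>c\<in>N. s c * d\<rho> i c x)"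
proof -
  have "pderivative i (\<lambda>x. \<Sum>c\<in>N. s c * \<rho> c x) x = (\<Sum>c\<in>N. dd (axis i 1) (\<lambda>x. s c * \<rho> c x) x)"
    unfolding pderivative_eq_dd by (rule dd_sum) (intro smooth_mult smooth_const smooth_\<rho>)
  also have "\<dots> = (\<Sum>c\<in>N. s c * d\<rho> i c x)"
    by (intro sum.cong refl) (simp add: dd_mult smooth_\<rho> d\<rho>_def pderivative_eq_dd)
  finally show ?thesis .
qed

lemma whitney_potential:
  assumes h: "small_cocycle \<rho>1 \<Omega> h" and z: "z \<in> \<Omega>" and x: "x \<in> \<Omega>" "dist z x < 4 * r"
  shows "whitney h i x = pderivative i (potential h z) x"
proof -
  have "h d c = h z c - h z d" if "c \<in> N" "d \<in> N" "dist c x \<le> 2 * r" "dist d x \<le> 2 * r" for c d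
  proof -
    \<comment> \<open>Each centre is within 2r of \<open>x\<close>, hence within 6r of
      \<open>z\<close>, and 8r is at most half of \<open>\<rho>1\<close>.\<close>
    have "dist z c < \<rho>1" "dist z d < \<rho>1" "dist d c < \<rho>1"
      using that(3,4) x(2) dist_triangle[of z c x] dist_triangle[of z d x] dist_triangle[of d c x] le pos
      by (simp_all add: dist_commute)
    then have "h z d + h d c = h z c" using that N(2) z by (intro small_cocycleD[OF h]) auto
    then show ?thesis by simp
  qed
  from whitney_of_difference[OF x(1) this] show ?thesis
    unfolding potential_def[abs_def] pderivative_combination by simp
qed

lemma weak_gradient_smooth:
  assumes "smooth p" "\<And>x i. x \<in> Q \<Longrightarrow> pderivative i p x = v i x"
  shows "weak_gradient Q p v"
  unfolding weak_gradient_def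
proof (intro ballI allI)
  fix \<psi> i assume \<psi>: "\<psi> \<in> test_functions Q"
  have "(LINT x|lborel. p x * pderivative i \<psi> x) = - (LINT x|lborel. pderivative i p x * \<psi> x)"
    unfolding pderivative_eq_dd by (rule integral_by_parts_test[OF \<psi> assms(1)])
  also have "(LINT x|lborel. pderivative i p x * \<psi> x) = (LINT x|lborel. v i x * \<psi> x)"
  proof (rule Bochner_Integration.integral_cong[OF refl])
    show "pderivative i p x * \<psi> x = v i x * \<psi> x" for x
      using assms(2)[of x i] test_eq_0[OF \<psi>, of x] by (cases "x \<in> Q") auto
  qed
  finally show "(LINT x|lborel. p x * pderivative i \<psi> x) = - (LINT x|lborel. v i x * \<psi> x)" .
qed

text \<open>Near each point the form is the gradient of a smooth potential, so its classical
  rotation vanishes; integration by parts carries this over to test functions.\<close>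

lemma weak_rot_whitney:
  assumes h: "small_cocycle \<rho>1 \<Omega> h" and \<psi>: "\<psi> \<in> test_functions \<Omega>"
  shows "weak_rot (whitney h) \<psi> = 0"
proof -
  have eq: "pderivative j (whitney h i) x = pderivative j (pderivative i (potential h x)) x" if x: "x \<in> \<Omega>" for i j x
    unfolding pderivative_eq_dd
  proof (rule dd_cong_open[of "\<Omega> \<inter> ball x (4 * r)"])
    show "open (\<Omega> \<inter> ball x (4 * r))" "x \<in> \<Omega> \<inter> ball x (4 * r)" using op x pos by auto
    show "smooth (dd (axis i 1) (potential h x))" by (intro smooth_dd test_smooth[OF potential_test])
    show "whitney h i y = dd (axis i 1) (potential h x) y" if "y \<in> \<Omega> \<inter> ball x (4 * r)" for y
      using whitney_potential[OF h x, of y i] that by (simp add: pderivative_eq_dd)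
  qed
  have parts: "(LINT x|lborel. whitney h i x * pderivative j \<psi> x) = - (LINT x|lborel. pderivative j (whitney h i) x * \<psi> x)" for i j
    unfolding pderivative_eq_dd by (rule integral_by_parts_test[OF \<psi> test_smooth[OF whitney_test]])
  have "(LINT x|lborel. pderivative 2 (whitney h 1) x * \<psi> x) = (LINT x|lborel. pderivative 1 (whitney h 2) x * \<psi> x)"
  proof (rule Bochner_Integration.integral_cong[OF refl])
    fix x
    show "pderivative 2 (whitney h 1) x * \<psi> x = pderivative 1 (whitney h 2) x * \<psi> x"
    proof (cases "x \<in> \<Omega>")
      case True
      have "pderivative 2 (pderivative 1 (potential h x)) x = pderivative 1 (pderivative 2 (potential h x)) x"
        unfolding pderivative_eq_dd by (rule dd_commute[OF test_smooth[OF potential_test]])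
      then show ?thesis by (simp add: eq[OF True])
    qed (simp add: test_eq_0[OF \<psi>])
  qed
  then show ?thesis by (simp add: weak_rot_def parts)
qed

text \<open>Only the values of \<open>s\<close> at the centres enter. Centres whose supports share a
  point are within 4r, less than \<open>\<rho>2\<close>, so interpolating \<open>s\<close> by the
  partition gives a potential.\<close>

lemma whitney_coboundary:
  assumes "\<And>x y. x \<in> \<Omega> \<Longrightarrow> y \<in> \<Omega> \<Longrightarrow> dist x y < \<rho>2 \<Longrightarrow> h x y = s y - s x"
  shows "\<exists>p. square_integrable p \<and> weak_gradient \<Omega> p (whitney h)"
proof -
  let ?p = "\<lambda>x. \<Sum>c\<in>N. s c * \<rho> c x"
  have t: "?p \<in> test_functions UNIV" by (intro test_sum test_scale \<rho>_test)
  have "weak_gradient \<Omega> ?p (whitney h)"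
  proof (rule weak_gradient_smooth[OF test_smooth[OF t]])
    fix x i assume x: "x \<in> \<Omega>"
    have "h d c = s c - s d" if "c \<in> N" "d \<in> N" "dist c x \<le> 2 * r" "dist d x \<le> 2 * r" for c d
      using that N(2) dist_triangle[of d c x] le pos by (intro assms) (auto simp: dist_commute)
    from whitney_of_difference[OF x this] show "pderivative i ?p x = whitney h i x"
      by (simp add: pderivative_combination)
  qed
  then show ?thesis using square_integrable_test[OF t] by blast
qed

lemma weak_gradient_mono: "weak_gradient Q p v \<Longrightarrow> Q' \<subseteq> Q \<Longrightarrow> weak_gradient Q' p v"
  unfolding weak_gradient_def using test_mono by blast

lemma potentials_differ_by_constant:
  assumes "good_chart Q" "weak_gradient Q p v" "weak_gradient Q p' v" "square_integrable p" "square_integrable p'"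
  shows "\<exists>s. \<forall>\<psi>\<in>test_functions Q. (LINT x|lborel. p x * \<psi> x) - (LINT x|lborel. p' x * \<psi> x) = s * (LINT x|lborel. \<psi> x)"
proof (rule good_chart_constant[OF assms(1)])
  show "distr_linear Q (\<lambda>\<psi>. (LINT x|lborel. p x * \<psi> x) - (LINT x|lborel. p' x * \<psi> x))"
    using distr_linear_integral[of p Q] distr_linear_integral[of p' Q] assms(4,5)
    by (auto simp: square_integrable_def distr_linear_def algebra_simps)
  show "(LINT x|lborel. p x * pderivative i \<psi> x) - (LINT x|lborel. p' x * pderivative i \<psi> x) = 0" if "\<psi> \<in> test_functions Q" for \<psi> i
    using assms(2,3) that by (simp add: weak_gradient_def)
qed

text \<open>On each \<open>Q3 z\<close> the global potential \<open>p\<close> and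
  \<open>potential h z\<close> have the same gradient and differ by a constant \<open>s z\<close>.
  On overlaps the local potentials of \<open>x\<close> and \<open>y\<close> differ by
  \<open>h x y\<close>, so \<open>h\<close> is the coboundary of \<open>s\<close>. The scale
  \<open>\<rho>3\<close> makes the overlap nonempty.\<close>

lemma coboundary_if_whitney_gradient:
  assumes h: "small_cocycle \<rho>1 \<Omega> h" and p: "square_integrable p" "weak_gradient \<Omega> p (whitney h)"
  shows "\<exists>s. \<forall>x\<in>\<Omega>. \<forall>y\<in>\<Omega>. dist x y < \<rho>3 \<longrightarrow> h x y = s y - s x"
proof -
  have pot: "weak_gradient (Q3 z) (potential h z) (whitney h)" if "z \<in> \<Omega>" for z
  proof (rule weak_gradient_smooth[OF test_smooth[OF potential_test]])
    show "pderivative i (potential h z) x = whitney h i x" if "x \<in> Q3 z" for x i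
    proof -
      have "x \<in> \<Omega> \<inter> ball z (4 * r)" using Q3[OF \<open>z \<in> \<Omega>\<close>] that by blast
      then show ?thesis using whitney_potential[OF h \<open>z \<in> \<Omega>\<close>, of x i] by simp
    qed
  qed
  have "\<exists>s. \<forall>\<psi>\<in>test_functions (Q3 z). (LINT x|lborel. p x * \<psi> x) - (LINT x|lborel. potential h z x * \<psi> x) = s * (LINT x|lborel. \<psi> x)"
    if "z \<in> \<Omega>" for z
    using Q3[OF that] by (intro potentials_differ_by_constant[OF _ weak_gradient_mono[OF p(2)] pot[OF that] p(1) square_integrable_test[OF potential_test]]) auto
  then obtain s where s: "\<And>z \<psi>. z \<in> \<Omega> \<Longrightarrow> \<psi> \<in> test_functions (Q3 z) \<Longrightarrow>
      (LINT x|lborel. p x * \<psi> x) - (LINT x|lborel. potential h z x * \<psi> x) = s z * (LINT x|lborel. \<psi> x)"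
    by metis
  have "h x y = s y - s x" if xy: "x \<in> \<Omega>" "y \<in> \<Omega>" "dist x y < \<rho>3" for x y
  proof -
    have "y \<in> Q3 x \<inter> Q3 y" using Q3[OF xy(1)] Q3[OF xy(2)] xy pos by auto
    moreover have "open (Q3 x \<inter> Q3 y)" using Q3 xy good_chart_open by blast
    ultimately obtain \<psi> where \<psi>: "\<psi> \<in> test_functions (Q3 x \<inter> Q3 y)" "(LINT x|lborel. \<psi> x) > 0"
      using exists_positive_test by blast
    have \<psi>x: "\<psi> \<in> test_functions (Q3 x)" and \<psi>y: "\<psi> \<in> test_functions (Q3 y)" using \<psi>(1) test_mono by blast+
    have eq: "potential h y w * \<psi> w = potential h x w * \<psi> w - h x y * \<psi> w" for w
    proof (cases "w \<in> Q3 x \<inter> Q3 y")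
      case True
      then have w: "w \<in> \<Omega>" "dist x w < 4 * r" "dist y w < 4 * r" using Q3[OF xy(1)] Q3[OF xy(2)] by auto
      have "h y c * \<rho> c w = h x c * \<rho> c w - h x y * \<rho> c w" if "c \<in> N" for c
      proof (cases "\<rho> c w = 0")
        case False
        then have "dist c w \<le> 2 * r" using \<rho>_near that by blast
        then have "dist x c < \<rho>1" "dist y c < \<rho>1" "dist x y < \<rho>1"
          using w dist_triangle[of x c w] dist_triangle[of y c w] xy(3) le pos by (simp_all add: dist_commute)
        then have "h x y + h y c = h x c" using xy that N(2) by (intro small_cocycleD[OF h]) auto
        then have "h y c = h x c - h x y" by simp
        then show ?thesis by (simp add: left_diff_distrib)
      qed simp
      then have "potential h y w = potential h x w - h x y * (\<Sum>c\<in>N. \<rho> c w)"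
        by (simp add: potential_def sum_subtractf sum_distrib_left)
      then show ?thesis by (simp add: sum_\<rho>[OF w(1)] left_diff_distrib)
    qed (simp add: test_eq_0[OF \<psi>(1)])
    have "integrable lborel (\<lambda>w. potential h x w * \<psi> w)"
      by (rule square_integrable_integrable_test[OF square_integrable_test[OF potential_test] \<psi>x])
    then have "(LINT w|lborel. potential h y w * \<psi> w) = (LINT w|lborel. potential h x w * \<psi> w) - h x y * (LINT w|lborel. \<psi> w)"
      unfolding eq using test_integrable[OF \<psi>x] by simp
    then have "(s y - s x) * (LINT x|lborel. \<psi> x) = h x y * (LINT x|lborel. \<psi> x)"
      using s[OF xy(1) \<psi>x] s[OF xy(2) \<psi>y] by (simp add: left_diff_distrib)
    then show ?thesis using \<psi>(2) by simp
  qed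
  then show ?thesis by (intro exI[of _ s]) simp
qed

text \<open>Local potentials on two neighbouring charts differ by a constant; these constants form the
  cocycle, and gluing the potentials with the partition of unity leaves the Whitney form as error.\<close>

lemma rot_free_decomposition:
  assumes v: "\<And>i. square_integrable (v i)" and rot: "\<And>\<psi>. \<psi> \<in> test_functions \<Omega> \<Longrightarrow> weak_rot v \<psi> = 0"
  shows "\<exists>h p. small_cocycle \<rho>1 \<Omega> h \<and> square_integrable p \<and> weak_gradient \<Omega> p (\<lambda>i x. v i x + 1 * whitney h i x)"
proof -
  have "\<exists>p. square_integrable p \<and> weak_gradient (Q0 z) p v" if "z \<in> \<Omega>" for z
    using Q0[OF that] by (intro good_chart_potential v rot) (auto intro: test_mono)
  then obtain pp where pp: "\<And>z. z \<in> \<Omega> \<Longrightarrow> square_integrable (pp z)" "\<And>z. z \<in> \<Omega> \<Longrightarrow> weak_gradient (Q0 z) (pp z) v"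
    by metis
  have Q1Q0: "Q1 z \<subseteq> Q0 x" if zx: "z \<in> \<Omega>" "x \<in> \<Omega>" "dist z x < \<rho>0 / 2" for z x
  proof
    fix w assume "w \<in> Q1 z"
    then have "w \<in> \<Omega>" "dist z w < \<rho>0 / 2" using Q1[OF zx(1)] by auto
    then have "w \<in> \<Omega> \<inter> ball x \<rho>0" using zx(3) dist_triangle3[of x w z] by simp
    then show "w \<in> Q0 x" using Q0[OF zx(2)] by blast
  qed
  \<comment> \<open>The constant value on \<open>Q1 z\<close> of the potential of \<open>x\<close>
    minus that of \<open>z\<close>. \<open>Q1 z\<close> lies in both charts \<open>Q0\<close> when
    the points are closer than half of \<open>\<rho>0\<close>.\<close>
  define h where "h z x = (SOME s. \<forall>\<psi>\<in>test_functions (Q1 z).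
      (LINT w|lborel. pp x w * \<psi> w) - (LINT w|lborel. pp z w * \<psi> w) = s * (LINT w|lborel. \<psi> w))" for z x
  have h: "(LINT w|lborel. pp x w * \<psi> w) - (LINT w|lborel. pp z w * \<psi> w) = h z x * (LINT w|lborel. \<psi> w)"
    if zx: "z \<in> \<Omega>" "x \<in> \<Omega>" "dist z x < \<rho>0 / 2" and \<psi>: "\<psi> \<in> test_functions (Q1 z)" for z x \<psi>
  proof -
    have g: "good_chart (Q1 z)" using Q1[OF zx(1)] by simp
    have zz: "dist z z < \<rho>0 / 2" using pos by simp
    have "\<exists>s. \<forall>\<psi>\<in>test_functions (Q1 z). (LINT w|lborel. pp x w * \<psi> w) - (LINT w|lborel. pp z w * \<psi> w) = s * (LINT w|lborel. \<psi> w)"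
      by (rule potentials_differ_by_constant[OF g weak_gradient_mono[OF pp(2)[OF zx(2)] Q1Q0[OF zx]]
          weak_gradient_mono[OF pp(2)[OF zx(1)] Q1Q0[OF zx(1) zx(1) zz]] pp(1)[OF zx(2)] pp(1)[OF zx(1)]])
    from someI_ex[OF this] \<psi> show ?thesis unfolding h_def by blast
  qed
  have coc: "small_cocycle \<rho>1 \<Omega> h"
    unfolding small_cocycle_def
  proof (intro ballI impI)
    fix x y z assume xyz: "x \<in> \<Omega>" "y \<in> \<Omega>" "z \<in> \<Omega>" "dist x y < \<rho>1" "dist y z < \<rho>1" "dist x z < \<rho>1"
    have "y \<in> Q1 x \<inter> Q1 y" using Q1[OF xyz(1)] Q1[OF xyz(2)] xyz pos by auto
    moreover have "open (Q1 x \<inter> Q1 y)" using Q1 xyz good_chart_open by blast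
    ultimately obtain \<psi> where \<psi>: "\<psi> \<in> test_functions (Q1 x \<inter> Q1 y)" "(LINT x|lborel. \<psi> x) > 0"
      using exists_positive_test by blast
    have \<psi>x: "\<psi> \<in> test_functions (Q1 x)" and \<psi>y: "\<psi> \<in> test_functions (Q1 y)" using \<psi>(1) test_mono by blast+
    have "(h x y + h y z) * (LINT x|lborel. \<psi> x) = h x z * (LINT x|lborel. \<psi> x)"
      using h[OF xyz(1,2) _ \<psi>x] h[OF xyz(2,3) _ \<psi>y] h[OF xyz(1,3) _ \<psi>x] xyz le by (simp add: distrib_right)
    then show "h x y + h y z = h x z" using \<psi>(2) by simp
  qed
  define p where "p x = (\<Sum>c\<in>N. pp c x * \<rho> c x)" for x
  have NO: "c \<in> \<Omega>" if "c \<in> N" for c using that N(2) by blast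
  have sqp: "square_integrable (\<lambda>x. pp c x * \<rho> c x)" if "c \<in> N" for c
    using that by (intro square_integrable_mult_test[OF pp(1) \<rho>_test] NO)
  have "square_integrable (\<lambda>x. \<Sum>c\<in>M. pp c x * \<rho> c x)" if "finite M" "M \<subseteq> N" for M
    using that
  proof (induction M)
    case empty
    then show ?case using square_integrable_test[OF test_zero] by simp
  next
    case (insert c M)
    then show ?case using square_integrable_lincomb[OF sqp[of c], of "\<lambda>x. \<Sum>c\<in>M. pp c x * \<rho> c x" 1] by simp
  qed
  then have p: "square_integrable p" using N(1) by (simp add: p_def[abs_def])
  have "weak_gradient \<Omega> p (\<lambda>i x. v i x + 1 * whitney h i x)"
    unfolding weak_gradient_def
  proof (intro ballI allI)
    fix \<psi> i assume \<psi>: "\<psi> \<in> test_functions \<Omega>"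
    have s\<psi>: "smooth \<psi>" by (rule test_smooth[OF \<psi>])
    have \<rho>\<psi>: "(\<lambda>x. \<rho> c x * \<psi> x) \<in> test_functions \<Omega>" if "c \<in> N" for c by (rule test_mult[OF \<psi> smooth_\<rho>[OF that]])
    have d\<rho>\<psi>: "(\<lambda>x. d\<rho> i c x * \<psi> x) \<in> test_functions \<Omega>" if "c \<in> N" for c by (rule test_mult[OF \<psi> smooth_d\<rho>[OF that]])
    define X where "X d c x = \<rho> d x * (d\<rho> i c x * \<psi> x)" for d c x
    have X1: "X d c \<in> test_functions (Q1 d)" if "d \<in> N" "c \<in> N" for d c
      unfolding X_def
    proof (rule test_mult_local[OF d\<rho>\<psi>[OF that(2)] smooth_\<rho>[OF that(1)] closed_cball[of d "2 * r"]])
      show "\<Omega> \<inter> cball d (2 * r) \<subseteq> Q1 d" using Q1[OF NO[OF that(1)]] le pos by (auto simp: subset_iff)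
    qed (use supp that in auto)
    have X0: "X d c \<in> test_functions \<Omega>" if "d \<in> N" "c \<in> N" for d c
      unfolding X_def by (rule test_mult[OF d\<rho>\<psi>[OF that(2)] smooth_\<rho>[OF that(1)]])
    have ippX: "integrable lborel (\<lambda>x. pp z x * X d c x)" if "z \<in> \<Omega>" "d \<in> N" "c \<in> N" for z d c
      by (rule square_integrable_integrable_test[OF pp(1)[OF that(1)] X0[OF that(2,3)]])
    \<comment> \<open>Passing from the potential of \<open>c\<close> to that of \<open>d\<close> on
      the support of \<open>X d c\<close>, which lies in \<open>Q1 d\<close>, costs the constant
      \<open>h d c\<close>. For distant centres the function \<open>X d c\<close> vanishes.\<close>
    have swap: "(LINT x|lborel. pp c x * X d c x) = (LINT x|lborel. pp d x * X d c x) + h d c * (LINT x|lborel. X d c x)"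
      if dc: "d \<in> N" "c \<in> N" for d c
    proof (cases "dist d c < \<rho>0 / 2")
      case True
      show ?thesis using h[OF NO[OF dc(1)] NO[OF dc(2)] True X1[OF dc]] by simp
    next
      case False
      have "X d c x = 0" for x
      proof (rule ccontr)
        assume "X d c x \<noteq> 0"
        then have "dist d x \<le> 2 * r" "dist c x \<le> 2 * r" using \<rho>_near d\<rho>_near dc by (auto simp: X_def)
        then show False using False dist_triangle[of d c x] le pos by (simp add: dist_commute)
      qed
      then show ?thesis by simp
    qed
    have A: "(LINT x|lborel. pp c x * \<rho> c x * pderivative i \<psi> x) =
        - (LINT x|lborel. v i x * (\<rho> c x * \<psi> x)) - (LINT x|lborel. pp c x * (d\<rho> i c x * \<psi> x))" if c: "c \<in> N" for c
    proof -
      have loc: "(\<lambda>x. \<rho> c x * \<psi> x) \<in> test_functions (Q0 c)"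
        by (rule test_mult_local[OF \<psi> smooth_\<rho>[OF c] closed_cball[of c "2 * r"]])
           (use supp c Q0[OF NO[OF c]] le pos in \<open>auto simp: subset_iff\<close>)
      have "pderivative i (\<lambda>x. \<rho> c x * \<psi> x) x = \<rho> c x * pderivative i \<psi> x + d\<rho> i c x * \<psi> x" for x
        unfolding pderivative_eq_dd d\<rho>_def by (rule dd_mult[OF smooth_\<rho>[OF c] s\<psi>])
      then have e: "pp c x * \<rho> c x * pderivative i \<psi> x = pp c x * pderivative i (\<lambda>x. \<rho> c x * \<psi> x) x - pp c x * (d\<rho> i c x * \<psi> x)" for x
        by (simp add: algebra_simps)
      have "(LINT x|lborel. pp c x * \<rho> c x * pderivative i \<psi> x) =
          (LINT x|lborel. pp c x * pderivative i (\<lambda>x. \<rho> c x * \<psi> x) x) - (LINT x|lborel. pp c x * (d\<rho> i c x * \<psi> x))"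
        unfolding e
        by (rule Bochner_Integration.integral_diff[OF square_integrable_integrable_test[OF pp(1)[OF NO[OF c]] test_pderivative[OF loc]]
              square_integrable_integrable_test[OF pp(1)[OF NO[OF c]] d\<rho>\<psi>[OF c]]])
      then show ?thesis using pp(2)[OF NO[OF c]] loc by (simp add: weak_gradient_def)
    qed
    have iv: "integrable lborel (\<lambda>x. v i x * (\<rho> c x * \<psi> x))" if "c \<in> N" for c
      by (rule square_integrable_integrable_test[OF v \<rho>\<psi>[OF that]])
    have split\<psi>: "\<psi> x = (\<Sum>c\<in>N. \<rho> c x * \<psi> x)" for x
      using sum_\<rho>[of x] test_eq_0[OF \<psi>, of x] by (cases "x \<in> \<Omega>") (simp_all flip: sum_distrib_right)
    have S1: "(\<Sum>c\<in>N. (LINT x|lborel. v i x * (\<rho> c x * \<psi> x))) = (LINT x|lborel. v i x * \<psi> x)"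
    proof -
      have "(LINT x|lborel. v i x * \<psi> x) = (LINT x|lborel. (\<Sum>c\<in>N. v i x * (\<rho> c x * \<psi> x)))"
        by (intro Bochner_Integration.integral_cong refl) (subst split\<psi>, simp add: sum_distrib_left)
      also have "\<dots> = (\<Sum>c\<in>N. (LINT x|lborel. v i x * (\<rho> c x * \<psi> x)))" by (rule Bochner_Integration.integral_sum[OF iv])
      finally show ?thesis by simp
    qed
    have S2: "(LINT x|lborel. pp c x * (d\<rho> i c x * \<psi> x)) = (\<Sum>d\<in>N. (LINT x|lborel. pp c x * X d c x))" if c: "c \<in> N" for c
    proof -
      have "pp c x * (d\<rho> i c x * \<psi> x) = (\<Sum>d\<in>N. pp c x * X d c x)" for x
        by (subst split\<psi>) (simp add: X_def sum_distrib_left mult_ac)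
      then show ?thesis using Bochner_Integration.integral_sum[OF ippX[OF NO[OF c] _ c], of N "\<lambda>d. d"] by simp
    qed
    \<comment> \<open>Once the potential no longer depends on \<open>c\<close>, summing over
      \<open>c\<close> meets the sum of the derivatives of the partition, which is 0. Thus only the
      constants from \<open>swap\<close> remain, and they add up to the Whitney form.\<close>
    have S3: "(\<Sum>c\<in>N. (LINT x|lborel. pp d x * X d c x)) = 0" if d: "d \<in> N" for d
    proof -
      have "(\<Sum>c\<in>N. (LINT x|lborel. pp d x * X d c x)) = (LINT x|lborel. (\<Sum>c\<in>N. pp d x * X d c x))"
        by (rule Bochner_Integration.integral_sum[symmetric]) (rule ippX[OF NO[OF d] d])
      also have "\<dots> = (LINT x|(lborel :: (real^2) measure). 0)"
      proof (rule Bochner_Integration.integral_cong[OF refl])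
        fix x
        have "(\<Sum>c\<in>N. pp d x * X d c x) = pp d x * \<rho> d x * \<psi> x * (\<Sum>c\<in>N. d\<rho> i c x)"
          by (simp add: X_def sum_distrib_left mult_ac)
        then show "(\<Sum>c\<in>N. pp d x * X d c x) = 0"
          using sum_d\<rho>[of x i] test_eq_0[OF \<psi>, of x] by (cases "x \<in> \<Omega>") simp_all
      qed
      finally show ?thesis by simp
    qed
    have S4: "(\<Sum>c\<in>N. \<Sum>d\<in>N. h d c * (LINT x|lborel. X d c x)) = (LINT x|lborel. whitney h i x * \<psi> x)"
    proof -
      have "(LINT x|lborel. whitney h i x * \<psi> x) = (LINT x|lborel. (\<Sum>c\<in>N. \<Sum>d\<in>N. h d c * X d c x))"
        by (simp add: whitney_def X_def sum_distrib_right mult.assoc)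
      also have "\<dots> = (\<Sum>c\<in>N. \<Sum>d\<in>N. h d c * (LINT x|lborel. X d c x))"
        using test_integrable[OF X0] by (simp add: Bochner_Integration.integral_sum)
      finally show ?thesis by simp
    qed
    have "(LINT x|lborel. p x * pderivative i \<psi> x) = (\<Sum>c\<in>N. (LINT x|lborel. pp c x * \<rho> c x * pderivative i \<psi> x))"
      unfolding p_def sum_distrib_right
      by (rule Bochner_Integration.integral_sum) (rule square_integrable_integrable_test[OF sqp test_pderivative[OF \<psi>]])
    also have "\<dots> = - (\<Sum>c\<in>N. (LINT x|lborel. v i x * (\<rho> c x * \<psi> x))) - (\<Sum>c\<in>N. \<Sum>d\<in>N. (LINT x|lborel. pp c x * X d c x))"
      using A S2 by (simp add: sum_subtractf sum_negf)
    also have "(\<Sum>c\<in>N. \<Sum>d\<in>N. (LINT x|lborel. pp c x * X d c x))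
        = (\<Sum>c\<in>N. \<Sum>d\<in>N. (LINT x|lborel. pp d x * X d c x)) + (\<Sum>c\<in>N. \<Sum>d\<in>N. h d c * (LINT x|lborel. X d c x))"
      using swap by (simp add: sum.distrib)
    also have "(\<Sum>c\<in>N. \<Sum>d\<in>N. (LINT x|lborel. pp d x * X d c x)) = 0"
      by (subst sum.swap) (simp add: S3)
    finally have "(LINT x|lborel. p x * pderivative i \<psi> x) = - (LINT x|lborel. v i x * \<psi> x) - (LINT x|lborel. whitney h i x * \<psi> x)"
      by (simp add: S1 S4)
    then show "(LINT x|lborel. p x * pderivative i \<psi> x) = - (LINT x|lborel. (v i x + 1 * whitney h i x) * \<psi> x)"
      using integral_lincomb_test[OF v whitney_sq \<psi>, of i 1 h i] by simp
  qed
  with coc p show ?thesis by (intro exI[of _ h] exI[of _ p]) simp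
qed

end

subsection \<open>The function spaces in terms of Borel representatives\<close>

lemma represents_imp_L2:
  assumes \<Omega>: "open \<Omega>" and r: "represents \<Omega> v u"
  shows "u \<in> L2 \<Omega>"
proof -
  have u: "u \<in> borel_measurable (lebesgue_on \<Omega>)" and ae: "AE x in lebesgue_on \<Omega>. u x = v x"
    using r by (auto simp: represents_def)
  have "v \<in> L2 \<Omega>" using r square_integrable_imp_L2(1)[OF \<Omega>] by (simp add: represents_def)
  then have v: "integrable (lebesgue_on \<Omega>) (\<lambda>x. (v x)\<^sup>2)" by (simp add: L2_def)
  have "integrable (lebesgue_on \<Omega>) (\<lambda>x. (u x)\<^sup>2)"
    by (rule integrable_cong_AE_imp[OF v]) (use u ae in \<open>auto elim: eventually_mono\<close>)
  with u show ?thesis by (simp add: L2_def)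
qed

lemma exists_represents_vec:
  fixes u :: "real^2 \<Rightarrow> real^2"
  assumes "open \<Omega>" "bounded \<Omega>" "u \<in> L2 \<Omega>"
  shows "\<exists>v. \<forall>i. represents \<Omega> (v i) (\<lambda>x. u x $ i)"
proof -
  have "(\<lambda>x. u x $ i) \<in> L2 \<Omega>" for i using assms(3) L2_vec_iff by blast
  then have "\<exists>v. represents \<Omega> v (\<lambda>x. u x $ i)" for i
    by (intro exists_represents[OF assms(1,2)]) (simp_all add: L2_def)
  then show ?thesis by metis
qed

lemma grad_H1_iff:
  assumes \<Omega>: "open \<Omega>" "bounded \<Omega>" and v: "\<And>i. represents \<Omega> (v i) (\<lambda>x. u x $ i)"
  shows "u \<in> grad_H1 \<Omega> \<longleftrightarrow> (\<exists>p. square_integrable p \<and> weak_gradient \<Omega> p v)"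
proof -
  have neg: "- a = b \<longleftrightarrow> a = - b" for a b :: real by linarith
  have eq: "has_gradient_distr \<Omega> (regular_distr \<Omega> p) u \<longleftrightarrow> weak_gradient \<Omega> p' v" if "represents \<Omega> p' p" for p p'
    unfolding has_gradient_distr_def eq_distr_def partial_distr_def weak_gradient_def neg
    by (simp add: regular_distr_eq[OF \<Omega>(1) that test_pderivative] regular_distr_eq[OF \<Omega>(1) v]) blast
  have u: "u \<in> L2 \<Omega>" unfolding L2_vec_iff using represents_imp_L2[OF \<Omega>(1) v] by blast
  show ?thesis
  proof
    assume "u \<in> grad_H1 \<Omega>"
    then obtain p where p: "p \<in> L2 \<Omega>" "has_gradient_distr \<Omega> (regular_distr \<Omega> p) u"
      by (auto simp: grad_H1_def H1_def)
    obtain p' where p': "represents \<Omega> p' p" using exists_represents[OF \<Omega>, of p] p(1) by (auto simp: L2_def)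
    then show "\<exists>p. square_integrable p \<and> weak_gradient \<Omega> p v"
      using eq p(2) by (auto simp: represents_def)
  next
    assume "\<exists>p. square_integrable p \<and> weak_gradient \<Omega> p v"
    then obtain p where p: "square_integrable p" "weak_gradient \<Omega> p v" by blast
    have "has_gradient_distr \<Omega> (regular_distr \<Omega> p) u" using eq square_integrable_imp_L2(2)[OF \<Omega>(1) p(1)] p(2) by blast
    then show "u \<in> grad_H1 \<Omega>"
      unfolding grad_H1_def H1_def using u square_integrable_imp_L2(1)[OF \<Omega>(1) p(1)] by blast
  qed
qed

lemma ker_grad_rot_iff:
  assumes \<Omega>: "open \<Omega>" and v: "\<And>i. represents \<Omega> (v i) (\<lambda>x. u x $ i)"
  shows "u \<in> ker_grad_rot \<Omega> \<longleftrightarrow> (\<forall>\<psi>\<in>test_functions \<Omega>. \<forall>i. weak_rot v (pderivative i \<psi>) = 0)"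
proof -
  have rot: "rot_distr \<Omega> u \<psi> = weak_rot v \<psi>" if "\<psi> \<in> test_functions \<Omega>" for \<psi>
    using regular_distr_eq[OF \<Omega> v test_pderivative[OF that]]
    by (simp add: rot_distr_def partial_distr_def weak_rot_def)
  have u: "u \<in> L2 \<Omega>" unfolding L2_vec_iff using represents_imp_L2[OF \<Omega> v] by blast
  have z: "(\<lambda>x. 0) \<in> L2 \<Omega>" by (simp add: L2_def)
  have "has_gradient_distr \<Omega> (rot_distr \<Omega> u) (\<lambda>x. 0) \<longleftrightarrow> (\<forall>\<psi>\<in>test_functions \<Omega>. \<forall>i. weak_rot v (pderivative i \<psi>) = 0)"
    unfolding has_gradient_distr_def eq_distr_def partial_distr_def
    by (auto simp: regular_distr_def rot test_pderivative)
  then show ?thesis using u z by (auto simp: ker_grad_rot_def H_grad_rot_def)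
qed

lemma distr_linear_sum:
  assumes "distr_linear Q T" "finite M" "\<And>c. c \<in> M \<Longrightarrow> \<psi> c \<in> test_functions Q"
  shows "T (\<lambda>x. \<Sum>c\<in>M. \<psi> c x) = (\<Sum>c\<in>M. T (\<psi> c))"
  using assms(2,3)
proof (induction M)
  case empty
  have "\<forall>a. T (\<lambda>x. a * 0) = a * T (\<lambda>x. 0)"
    using assms(1) unfolding distr_linear_def by (intro bspec[OF conjunct2 test_zero[of Q]])
  from spec[OF this, of 0] show ?case by simp
next
  case (insert c M)
  then have "T (\<lambda>x. \<psi> c x + (\<Sum>c\<in>M. \<psi> c x)) = T (\<psi> c) + T (\<lambda>x. \<Sum>c\<in>M. \<psi> c x)"
    using assms(1) test_sum[of M \<psi> Q] unfolding distr_linear_def by simp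
  then show ?case using insert by simp
qed

subsection \<open>Finite families of fields\<close>

lemma sum_apply: "(\<Sum>j\<in>I. f j) x = (\<Sum>j\<in>I. (f j x :: 'b::comm_monoid_add))"
  by (induction I rule: infinite_finite_induct) auto

lemma fields_independent_family:
  fixes e :: "'j \<Rightarrow> real^2 \<Rightarrow> real^2"
  assumes fin: "finite I" and ind: "\<And>t. (\<Sum>j\<in>I. (\<lambda>x. t j *\<^sub>R e j x)) = 0 \<Longrightarrow> \<forall>j\<in>I. t j = 0"
  shows "inj_on e I" "fields.independent (e ` I)"
proof -
  show inj: "inj_on e I"
  proof (rule inj_onI, rule ccontr)
    fix a b assume ab: "a \<in> I" "b \<in> I" "e a = e b" "a \<noteq> b"
    let ?t = "\<lambda>j. if j = a then 1 else if j = b then -1 else 0 :: real"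
    have "(\<Sum>j\<in>I. ?t j *\<^sub>R e j x) = (\<Sum>j\<in>{a, b}. ?t j *\<^sub>R e j x)" for x
      using fin ab by (intro sum.mono_neutral_right) auto
    then have "(\<Sum>j\<in>I. (\<lambda>x. ?t j *\<^sub>R e j x)) = 0" using ab by (simp add: fun_eq_iff sum_apply)
    from ind[OF this] show False using ab(1) by auto
  qed
  show "fields.independent (e ` I)"
  proof (rule fields.independent_if_scalars_zero)
    fix f x assume "(\<Sum>g\<in>e ` I. (\<lambda>x. f g *\<^sub>R g x)) = 0" and x: "x \<in> e ` I"
    then have "(\<Sum>j\<in>I. (\<lambda>x. f (e j) *\<^sub>R e j x)) = 0" by (simp add: sum.reindex[OF inj])
    from ind[OF this] x show "f x = 0" by blast
  qed (use fin in simp)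
qed

lemma fields_span_family:
  assumes "finite I"
  shows "fields.span (e ` I) = range (\<lambda>t. \<Sum>j\<in>I. (\<lambda>x. t j *\<^sub>R e j x))"
proof
  show "range (\<lambda>t. \<Sum>j\<in>I. (\<lambda>x. t j *\<^sub>R e j x)) \<subseteq> fields.span (e ` I)"
    by (rule image_subsetI, rule fields.span_sum, rule fields.span_scale, rule fields.span_base, rule imageI)
  have "fields.subspace (range (\<lambda>t. \<Sum>j\<in>I. (\<lambda>x. t j *\<^sub>R e j x)))"
  proof (rule fields.subspaceI)
    show "0 \<in> range (\<lambda>t. \<Sum>j\<in>I. (\<lambda>x. t j *\<^sub>R e j x))"
      by (rule range_eqI[of _ _ "\<lambda>j. 0"]) (simp add: fun_eq_iff sum_apply)
  next
    fix x y assume "x \<in> range (\<lambda>t. \<Sum>j\<in>I. (\<lambda>x. t j *\<^sub>R e j x))" "y \<in> range (\<lambda>t. \<Sum>j\<in>I. (\<lambda>x. t j *\<^sub>R e j x))"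
    then obtain s t where "x = (\<Sum>j\<in>I. (\<lambda>x. s j *\<^sub>R e j x))" "y = (\<Sum>j\<in>I. (\<lambda>x. t j *\<^sub>R e j x))" by auto
    then show "x + y \<in> range (\<lambda>t. \<Sum>j\<in>I. (\<lambda>x. t j *\<^sub>R e j x))"
      by (intro range_eqI[of _ _ "\<lambda>j. s j + t j"]) (simp add: fun_eq_iff sum_apply scaleR_add_left sum.distrib)
  next
    fix c x assume "x \<in> range (\<lambda>t. \<Sum>j\<in>I. (\<lambda>x. t j *\<^sub>R e j x))"
    then obtain s where "x = (\<Sum>j\<in>I. (\<lambda>x. s j *\<^sub>R e j x))" by auto
    then show "(\<lambda>y. c *\<^sub>R x y) \<in> range (\<lambda>t. \<Sum>j\<in>I. (\<lambda>x. t j *\<^sub>R e j x))"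
      by (intro range_eqI[of _ _ "\<lambda>j. c * s j"]) (simp add: fun_eq_iff sum_apply scaleR_sum_right)
  qed
  moreover have "e ` I \<subseteq> range (\<lambda>t. \<Sum>j\<in>I. (\<lambda>x. t j *\<^sub>R e j x))"
  proof
    fix y assume "y \<in> e ` I"
    then obtain k where k: "k \<in> I" "y = e k" by blast
    have "(\<Sum>j\<in>I. (if j = k then 1 else 0 :: real) *\<^sub>R e j x) = (\<Sum>j\<in>I. if j = k then e j x else 0)" for x
      by (intro sum.cong) auto
    then show "y \<in> range (\<lambda>t. \<Sum>j\<in>I. (\<lambda>x. t j *\<^sub>R e j x))"
      using k assms by (intro range_eqI[of _ _ "\<lambda>j. if j = k then 1 else 0"]) (simp add: fun_eq_iff sum_apply)
  qed
  ultimately show "fields.span (e ` I) \<subseteq> range (\<lambda>t. \<Sum>j\<in>I. (\<lambda>x. t j *\<^sub>R e j x))"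
    by (rule fields.span_minimal[rotated])
qed

subsection \<open>Periods\<close>

lemma small_cocycle_sum:
  "finite S \<Longrightarrow> (\<And>i. i \<in> S \<Longrightarrow> small_cocycle \<delta> \<Omega> (h i)) \<Longrightarrow> small_cocycle \<delta> \<Omega> (\<lambda>x y. \<Sum>i\<in>S. t i * h i x y)"
  by (simp add: small_cocycle_def flip: sum.distrib distrib_left)

lemma chain_sum_sum:
  assumes "finite S" "\<And>i. i \<in> S \<Longrightarrow> small_cocycle \<delta> \<Omega> (h i)" "\<delta> > 0" "singular_chain 1 (top_of_set \<Omega>) c"
  shows "chain_sum (\<lambda>x y. \<Sum>i\<in>S. t i * h i x y) c = (\<Sum>i\<in>S. t i * chain_sum (h i) c)"
  using assms(1,2)
proof (induction S)
  case empty
  have "small_cocycle \<delta> \<Omega> (\<lambda>x y. 0)" by (simp add: small_cocycle_def)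
  from chain_sum_lincomb[OF this this assms(3,4), of 1] show ?case by simp
next
  case (insert i S)
  then have "chain_sum (\<lambda>x y. (\<Sum>i\<in>S. t i * h i x y) + t i * h i x y) c = chain_sum (\<lambda>x y. \<Sum>i\<in>S. t i * h i x y) c + t i * chain_sum (h i) c"
    by (intro chain_sum_lincomb[OF _ _ assms(3,4)] small_cocycle_sum) auto
  then show ?case using insert by (simp add: add.commute)
qed

section \<open>Periods of Whitney forms and the field with constant rotation\<close>

context charted_domain
begin

abbreviation "X \<equiv> top_of_set \<Omega>"

text \<open>A gradient gives a coboundary at scale \<open>\<rho>3\<close>, hence vanishing periods,
  and these give a coboundary at scale \<open>\<rho>2\<close>, hence a gradient. The detour through
  periods regains the lost scale.\<close>

lemma whitney_gradient_iff:
  assumes h: "small_cocycle \<rho>1 \<Omega> h"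
  shows "(\<exists>p. square_integrable p \<and> weak_gradient \<Omega> p (whitney h)) \<longleftrightarrow> (\<forall>c. singular_relcycle 1 X {} c \<longrightarrow> chain_sum h c = 0)"
proof
  assume "\<exists>p. square_integrable p \<and> weak_gradient \<Omega> p (whitney h)"
  then obtain s where "\<And>x y. x \<in> \<Omega> \<Longrightarrow> y \<in> \<Omega> \<Longrightarrow> dist x y < \<rho>3 \<Longrightarrow> h x y = s y - s x"
    using coboundary_if_whitney_gradient[OF h] by blast
  then show "\<forall>c. singular_relcycle 1 X {} c \<longrightarrow> chain_sum h c = 0"
    using chain_sum_coboundary[of \<Omega> \<rho>3 h s] pos by blast
next
  assume z: "\<forall>c. singular_relcycle 1 X {} c \<longrightarrow> chain_sum h c = 0"
  have "path_connected \<Omega>" using op con by (simp add: connected_open_path_connected)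
  from coboundary_if_chain_sum_zero[OF h pos(2) this paths] z
  obtain s where "\<And>x y. x \<in> \<Omega> \<Longrightarrow> y \<in> \<Omega> \<Longrightarrow> dist x y < \<rho>2 \<Longrightarrow> h x y = s y - s x" by blast
  then show "\<exists>p. square_integrable p \<and> weak_gradient \<Omega> p (whitney h)" by (rule whitney_coboundary)
qed

lemma whitney_sum: "whitney (\<lambda>x y. \<Sum>j\<in>S. t j * h j x y) i x = (\<Sum>j\<in>S. t j * whitney (h j) i x)"
  by (induction S rule: infinite_finite_induct)
    (simp_all add: whitney_def distrib_right sum.distrib sum_distrib_left mult.assoc)

text \<open>On \<Omega> this is the linear field of the overview. The factor from the partition
  gives it compact support in the plane, so that it can be treated as a test function like the
  Whitney forms.\<close>

definition rotation :: "2 \<Rightarrow> real^2 \<Rightarrow> real" where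
  "rotation i x = (\<Sum>c\<in>N. \<rho> c x * (x \<bullet> (if i = 1 then axis 2 (- (1 / 2)) else axis 1 (1 / 2))))"

lemma rotation_test: "rotation i \<in> test_functions UNIV"
  unfolding rotation_def[abs_def]
proof (rule test_sum)
  fix c assume "c \<in> N"
  have "(\<lambda>x. (x \<bullet> (if i = 1 then axis 2 (- (1 / 2)) else axis 1 (1 / 2))) * \<rho> c x) \<in> test_functions UNIV"
    by (rule test_mult[OF \<rho>_test[OF \<open>c \<in> N\<close>] smooth_linear[OF bounded_linear_inner_left]])
  then show "(\<lambda>x. \<rho> c x * (x \<bullet> (if i = 1 then axis 2 (- (1 / 2)) else axis 1 (1 / 2)))) \<in> test_functions UNIV"
    by (simp only: mult.commute)
qed

lemma rotation_sq: "square_integrable (rotation i)"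
  by (rule square_integrable_test[OF rotation_test])

lemma pderivative_rotation:
  assumes "x \<in> \<Omega>" shows "pderivative 2 (rotation 1) x = - 1 / 2" "pderivative 1 (rotation 2) x = 1 / 2"
proof -
  have "rotation i y = y \<bullet> (if i = 1 then axis 2 (- (1 / 2)) else axis 1 (1 / 2))" if "y \<in> \<Omega>" for i y
    unfolding rotation_def using sum_\<rho>[OF that] by (simp flip: sum_distrib_right)
  then have "pderivative j (rotation i) x = dd (axis j 1) (\<lambda>y. y \<bullet> (if i = 1 then axis 2 (- (1 / 2)) else axis 1 (1 / 2))) x" for i j
    unfolding pderivative_eq_dd using assms by (intro dd_cong_open[OF op]) (simp_all add: smooth_linear[OF bounded_linear_inner_left])
  also have "dd (axis j 1) (\<lambda>y. y \<bullet> (if i = 1 then axis 2 (- (1 / 2)) else axis 1 (1 / 2))) x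
      = axis j 1 \<bullet> (if i = (1::2) then axis 2 (- (1 / 2)) else axis 1 (1 / 2) :: real^2)" for i j
    by (rule dd_eqI) (auto intro!: derivative_eq_intros)
  finally show "pderivative 2 (rotation 1) x = - 1 / 2" "pderivative 1 (rotation 2) x = 1 / 2"
    by (simp_all add: inner_axis_axis)
qed

lemma weak_rot_rotation:
  assumes \<psi>: "\<psi> \<in> test_functions \<Omega>" shows "weak_rot rotation \<psi> = (LINT x|lborel. \<psi> x)"
proof -
  have parts: "(LINT x|lborel. rotation i x * pderivative j \<psi> x) = - (LINT x|lborel. pderivative j (rotation i) x * \<psi> x)" for i j
    unfolding pderivative_eq_dd by (rule integral_by_parts_test[OF \<psi> test_smooth[OF rotation_test]])
  have "pderivative 2 (rotation 1) x * \<psi> x = - 1 / 2 * \<psi> x" "pderivative 1 (rotation 2) x * \<psi> x = 1 / 2 * \<psi> x" for x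
    using pderivative_rotation[of x] test_eq_0[OF \<psi>, of x] by (cases "x \<in> \<Omega>", simp_all)+
  then show ?thesis unfolding weak_rot_def parts by (simp only:) simp
qed

text \<open>The constancy theorem on each chart gives a number \<open>s x\<close>; overlapping
  charts share it, so it is locally constant on a connected set. The partition of unity splits a
  test function into pieces supported in charts.\<close>

lemma rot_constant:
  assumes v: "\<And>i. square_integrable (v i)" and z: "\<And>\<psi> i. \<psi> \<in> test_functions \<Omega> \<Longrightarrow> weak_rot v (pderivative i \<psi>) = 0"
  shows "\<exists>s. \<forall>\<psi>\<in>test_functions \<Omega>. weak_rot v \<psi> = s * (LINT x|lborel. \<psi> x)"
proof -
  define s where "s x = (SOME s. \<forall>\<psi>\<in>test_functions (Q0 x). weak_rot v \<psi> = s * (LINT x|lborel. \<psi> x))" for x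
  have s: "weak_rot v \<psi> = s x * (LINT x|lborel. \<psi> x)" if x: "x \<in> \<Omega>" and \<psi>: "\<psi> \<in> test_functions (Q0 x)" for x \<psi>
  proof -
    have g: "good_chart (Q0 x)" "Q0 x \<subseteq> \<Omega>" using Q0[OF x] by auto
    have "\<exists>s. \<forall>\<psi>\<in>test_functions (Q0 x). weak_rot v \<psi> = s * (LINT x|lborel. \<psi> x)"
      by (rule good_chart_constant[OF g(1) distr_linear_weak_rot[OF v]]) (rule z[OF test_mono[OF _ g(2)]])
    from someI_ex[OF this] \<psi> show ?thesis unfolding s_def by blast
  qed
  have near: "s x = s y" if xy: "x \<in> \<Omega>" "y \<in> \<Omega>" "dist x y < \<rho>0" for x y
  proof -
    have "y \<in> Q0 x \<inter> Q0 y" using Q0[OF xy(1)] Q0[OF xy(2)] xy pos by auto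
    moreover have "open (Q0 x \<inter> Q0 y)" using Q0 xy good_chart_open by blast
    ultimately obtain \<psi> where \<psi>: "\<psi> \<in> test_functions (Q0 x \<inter> Q0 y)" "(LINT x|lborel. \<psi> x) > 0"
      using exists_positive_test by blast
    have \<psi>x: "\<psi> \<in> test_functions (Q0 x)" and \<psi>y: "\<psi> \<in> test_functions (Q0 y)" using \<psi>(1) test_mono by blast+
    have "s x * (LINT x|lborel. \<psi> x) = s y * (LINT x|lborel. \<psi> x)"
      using s[OF xy(1) \<psi>x] s[OF xy(2) \<psi>y] by (rule trans[OF sym])
    then show ?thesis using \<psi>(2) by simp
  qed
  obtain a where a: "a \<in> \<Omega>" using ne by blast
  have const: "s b = s a" if "b \<in> \<Omega>" for b
  proof (rule connected_local_const[OF con that a], intro ballI)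
    fix x assume "x \<in> \<Omega>"
    then show "\<forall>\<^sub>F y in at x within \<Omega>. s x = s y"
      unfolding eventually_at by (intro exI[of _ \<rho>0] conjI ballI impI pos(1) near) (auto simp: dist_commute)
  qed
  have "weak_rot v \<psi> = s a * (LINT x|lborel. \<psi> x)" if \<psi>: "\<psi> \<in> test_functions \<Omega>" for \<psi>
  proof -
    have loc: "(\<lambda>x. \<rho> c x * \<psi> x) \<in> test_functions (Q0 c)" if c: "c \<in> N" for c
    proof (rule test_mult_local[OF \<psi> smooth_\<rho>[OF c] closed_cball[of c "2 * r"]])
      have "c \<in> \<Omega>" using c N(2) by blast
      then show "\<Omega> \<inter> cball c (2 * r) \<subseteq> Q0 c" using Q0[of c] le pos by (auto simp: subset_iff)
    qed (use supp c in auto)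
    have t: "(\<lambda>x. \<rho> c x * \<psi> x) \<in> test_functions \<Omega>" if "c \<in> N" for c by (rule test_mult[OF \<psi> smooth_\<rho>[OF that]])
    have \<psi>_eq: "\<psi> = (\<lambda>x. \<Sum>c\<in>N. \<rho> c x * \<psi> x)"
    proof
      show "\<psi> x = (\<Sum>c\<in>N. \<rho> c x * \<psi> x)" for x
        using sum_\<rho>[of x] test_eq_0[OF \<psi>, of x] by (cases "x \<in> \<Omega>") (simp_all flip: sum_distrib_right)
    qed
    have "weak_rot v (\<lambda>x. \<Sum>c\<in>N. \<rho> c x * \<psi> x) = (\<Sum>c\<in>N. weak_rot v (\<lambda>x. \<rho> c x * \<psi> x))"
      by (rule distr_linear_sum[OF distr_linear_weak_rot[OF v] N(1) t])
    also have "\<dots> = (\<Sum>c\<in>N. s a * (LINT x|lborel. \<rho> c x * \<psi> x))"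
    proof (rule sum.cong[OF refl])
      fix c assume c: "c \<in> N"
      then have "c \<in> \<Omega>" using N(2) by blast
      then show "weak_rot v (\<lambda>x. \<rho> c x * \<psi> x) = s a * (LINT x|lborel. \<rho> c x * \<psi> x)"
        using s[OF _ loc[OF c]] const by simp
    qed
    also have "\<dots> = s a * (LINT x|lborel. (\<Sum>c\<in>N. \<rho> c x * \<psi> x))"
      using distr_linear_sum[OF distr_linear_integral_1 N(1) t] by (simp add: sum_distrib_left)
    finally show ?thesis by (simp flip: \<psi>_eq)
  qed
  then show ?thesis by blast
qed

text \<open>The cut to the closure matches the encoding of \<open>smooth_fields\<close>, where
  equality of functions is equality on the closure.\<close>

definition field :: "(2 \<Rightarrow> real^2 \<Rightarrow> real) \<Rightarrow> real^2 \<Rightarrow> real^2" where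
  "field v x = (if x \<in> closure \<Omega> then \<chi> i. v i x else 0)"

lemma field_smooth:
  assumes "\<And>i. v i \<in> test_functions UNIV" shows "field v \<in> smooth_fields \<Omega>"
proof -
  have "smooth (\<lambda>x. \<Sum>i\<in>UNIV. v i x *\<^sub>R (axis i 1 :: real^2))"
    by (intro smooth_sum smooth_scaleR smooth_const test_smooth[OF assms])
  moreover have "(\<Sum>i\<in>UNIV. v i x *\<^sub>R (axis i 1 :: real^2)) = (\<chi> i. v i x)" for x
    by (simp add: vec_eq_iff sum_2 axis_def forall_2)
  ultimately have "smooth (\<lambda>x. (\<chi> i. v i x) :: real^2)" by simp
  then show ?thesis unfolding smooth_fields_def field_def[abs_def] by blast
qed

lemma field_represents:
  assumes "square_integrable (v i)" shows "represents \<Omega> (v i) (\<lambda>x. field v x $ i)"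
proof -
  have eq: "field v x $ i = v i x" if "x \<in> \<Omega>" for x using that closure_subset by (auto simp: field_def)
  have r: "represents \<Omega> (v i) (v i)" by (rule square_integrable_imp_L2(2)[OF op assms])
  have "(\<lambda>x. field v x $ i) \<in> borel_measurable (lebesgue_on \<Omega>) \<longleftrightarrow> v i \<in> borel_measurable (lebesgue_on \<Omega>)"
    by (rule measurable_cong) (simp add: eq)
  moreover have "AE x in lebesgue_on \<Omega>. field v x $ i = v i x" by (rule AE_I2) (simp add: eq)
  ultimately show ?thesis using r by (simp add: represents_def)
qed

end

subsection \<open>The fields dual to a basis of cycles\<close>

context charted_domain
begin

text \<open>Independence modulo boundaries lets a functional that kills boundaries be prescribed on
  the cycles; contractibility of \<open>Q0\<close> and short paths in \<open>Q1\<close> turn it into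
  a cocycle.\<close>

lemma dual_cocycles:
  assumes z: "independent_cycles X S z"
  shows "\<exists>h. \<forall>i\<in>S. small_cocycle \<rho>1 \<Omega> (h i) \<and> (\<forall>j\<in>S. chain_sum (h i) (z j) = (if i = j then 1 else 0))"
proof -
  let ?B = "{c. singular_relboundary 1 X {} c}"
  have S: "finite S" and zc: "\<And>i. i \<in> S \<Longrightarrow> singular_relcycle 1 X {} (z i)"
    and ind: "\<And>n. singular_relboundary 1 X {} (\<Sum>i\<in>S. frag_cmul (n i) (z i)) \<Longrightarrow> \<forall>i\<in>S. n i = 0"
    using z by (auto simp: independent_cycles_def)
  have "\<exists>h. small_cocycle \<rho>1 \<Omega> h \<and> (\<forall>j\<in>S. chain_sum h (z j) = (if i = j then 1 else 0))" for i
  proof -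
    have "\<exists>F. Modules.additive F \<and> (\<forall>b\<in>?B. F b = 0) \<and> (\<forall>j\<in>S. F (z j) = (if i = j then 1 else 0 :: real))"
      by (rule additive_extension) (use S ind in \<open>auto intro: singular_relboundary_0 singular_relboundary_diff\<close>)
    then obtain F where F: "Modules.additive F" "\<And>b. singular_relboundary 1 X {} b \<Longrightarrow> F b = 0"
      "\<And>j. j \<in> S \<Longrightarrow> F (z j) = (if i = j then 1 else 0 :: real)" by auto
    have "\<exists>h. small_cocycle \<rho>1 \<Omega> h \<and> (\<forall>c. singular_chain 1 X c \<longrightarrow> chain_sum h c = F c)"
    proof (rule cocycle_of_functional[OF F(1,2) _ _ pos(2) le(1)])
      show "\<exists>Q\<subseteq>\<Omega>. \<Omega> \<inter> ball x \<rho>0 \<subseteq> Q \<and> contractible Q" if "x \<in> \<Omega>" for x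
        using Q0[OF that] good_chart_contractible by blast
      show "\<exists>\<gamma>. path \<gamma> \<and> path_image \<gamma> \<subseteq> \<Omega> \<inter> ball x (\<rho>0 / 2) \<and> pathstart \<gamma> = x \<and> pathfinish \<gamma> = y"
        if xy: "x \<in> \<Omega>" "y \<in> \<Omega>" "dist x y < \<rho>1" for x y
      proof -
        have "path_connected (Q1 x)" using Q1[OF xy(1)] good_chart_contractible contractible_imp_path_connected by blast
        moreover have "x \<in> Q1 x" "y \<in> Q1 x" using Q1[OF xy(1)] xy pos by auto
        ultimately obtain \<gamma> where "path \<gamma>" "path_image \<gamma> \<subseteq> Q1 x" "pathstart \<gamma> = x" "pathfinish \<gamma> = y"
          unfolding path_connected_def by blast
        then show ?thesis using Q1[OF xy(1)] by blast
      qed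
    qed
    then obtain h where h: "small_cocycle \<rho>1 \<Omega> h" "\<And>c. singular_chain 1 X c \<Longrightarrow> chain_sum h c = F c" by blast
    have "chain_sum h (z j) = (if i = j then 1 else 0)" if "j \<in> S" for j
      using h(2) zc[OF that] F(3)[OF that] by (simp add: singular_cycle)
    with h(1) show ?thesis by blast
  qed
  then show ?thesis by metis
qed

lemma combination_represents:
  "represents \<Omega> (\<lambda>x. whitney k i x + t * rotation i x) (\<lambda>x. field (\<lambda>i x. whitney k i x + t * rotation i x) x $ i)"
  by (rule field_represents[where v = "\<lambda>i x. whitney k i x + t * rotation i x"]) (rule square_integrable_lincomb[OF whitney_sq rotation_sq])

text \<open>Testing the rotation removes gradients and Whitney forms and leaves \<open>t\<close>
  times the integral of the test function. What remains is an exact Whitney form.\<close>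

lemma exact_combination:
  assumes k: "small_cocycle \<rho>1 \<Omega> k" and g: "field (\<lambda>i x. whitney k i x + t * rotation i x) \<in> grad_H1 \<Omega>"
  shows "t = 0" "\<And>c. singular_relcycle 1 X {} c \<Longrightarrow> chain_sum k c = 0"
proof -
  have "\<exists>p. square_integrable p \<and> weak_gradient \<Omega> p (\<lambda>i x. whitney k i x + t * rotation i x)"
    by (rule iffD1[OF grad_H1_iff[OF op bd] g]) (rule combination_represents)
  then obtain p where p: "square_integrable p" "weak_gradient \<Omega> p (\<lambda>i x. whitney k i x + t * rotation i x)" by blast
  obtain a where "a \<in> \<Omega>" using ne by blast
  from exists_positive_test[OF op this] obtain \<psi> where \<psi>: "\<psi> \<in> test_functions \<Omega>" "(LINT x|lborel. \<psi> x) > 0" by blast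
  have "weak_rot (\<lambda>i x. whitney k i x + t * rotation i x) \<psi> = 0" by (rule weak_rot_weak_gradient[OF p(2) \<psi>(1)])
  then show t: "t = 0"
    using weak_rot_lincomb[OF whitney_sq rotation_sq \<psi>(1), where a = t] weak_rot_whitney[OF k \<psi>(1)] weak_rot_rotation[OF \<psi>(1)] \<psi>(2)
    by simp
  then have "weak_gradient \<Omega> p (whitney k)" using p(2) by simp
  then show "chain_sum k c = 0" if "singular_relcycle 1 X {} c" for c
    using p(1) that whitney_gradient_iff[OF k] by blast
qed

end

text \<open>Maximality of the family is left to \<open>kernel_decomposition\<close> and
  \<open>direct_sum\<close>: the bound \<open>card_S_le\<close> has to be available for every
  independent family before a maximal one can be chosen.\<close>

locale cycle_basis = charted_domain +
  fixes S :: "'i set" and z and h :: "'i \<Rightarrow> real^2 \<Rightarrow> real^2 \<Rightarrow> real"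
  assumes z: "independent_cycles X S z"
    and h: "\<And>i. i \<in> S \<Longrightarrow> small_cocycle \<rho>1 \<Omega> (h i)"
    and dual: "\<And>i j. i \<in> S \<Longrightarrow> j \<in> S \<Longrightarrow> chain_sum (h i) (z j) = (if i = j then 1 else 0)"
begin

text \<open>\<open>None\<close> indexes the rotation field and accounts for the summand 1 in the
  dimension.\<close>

definition I where "I = insert None (Some ` S)"

definition basis_field :: "'i option \<Rightarrow> real^2 \<Rightarrow> real^2" where
  "basis_field j = (case j of None \<Rightarrow> field rotation | Some i \<Rightarrow> field (whitney (h i)))"

definition combination :: "('i option \<Rightarrow> real) \<Rightarrow> real^2 \<Rightarrow> real^2 \<Rightarrow> real" where
  "combination t x y = (\<Sum>i\<in>S. t (Some i) * h i x y)"

lemma finite_S: "finite S" and z_cycle: "i \<in> S \<Longrightarrow> singular_relcycle 1 X {} (z i)"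
  using z by (auto simp: independent_cycles_def)

lemma finite_I: "finite I" by (simp add: I_def finite_S)

lemma combination_cocycle: "small_cocycle \<rho>1 \<Omega> (combination t)"
  unfolding combination_def[abs_def] by (rule small_cocycle_sum[OF finite_S h])

lemma combination_period: "j \<in> S \<Longrightarrow> chain_sum (combination t) (z j) = t (Some j)"
proof -
  assume j: "j \<in> S"
  have "chain_sum (combination t) (z j) = (\<Sum>i\<in>S. t (Some i) * chain_sum (h i) (z j))"
    unfolding combination_def[abs_def]
    by (rule chain_sum_sum[OF finite_S h pos(2)]) (use z_cycle[OF j] in \<open>auto simp: singular_cycle\<close>)
  also have "\<dots> = (\<Sum>i\<in>S. if i = j then t (Some j) else 0)" by (rule sum.cong) (simp_all add: dual j)
  finally show ?thesis using finite_S j by simp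
qed

lemma basis_combination:
  "(\<Sum>j\<in>I. (\<lambda>x. t j *\<^sub>R basis_field j x)) = field (\<lambda>i x. whitney (combination t) i x + t None * rotation i x)"
proof
  fix x
  have "(\<Sum>j\<in>I. t j *\<^sub>R basis_field j x) = t None *\<^sub>R field rotation x + (\<Sum>i\<in>S. t (Some i) *\<^sub>R field (whitney (h i)) x)"
    using finite_S by (simp add: I_def basis_field_def sum.reindex image_iff)
  also have "\<dots> = field (\<lambda>i x. whitney (combination t) i x + t None * rotation i x) x"
    by (simp add: field_def vec_eq_iff combination_def[abs_def] whitney_sum)
  finally show "(\<Sum>j\<in>I. (\<lambda>x. t j *\<^sub>R basis_field j x)) x = \<dots>" by (simp add: sum_apply)
qed

text \<open>The coefficients are read off from exact fields by duality: rotation gives the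
  coefficient at \<open>None\<close>, the period over \<open>z i\<close> that at
  \<open>Some i\<close>. Independence and directness of the sum both follow.\<close>

lemma grad_H1_combination:
  assumes "field (\<lambda>i x. whitney (combination t) i x + t None * rotation i x) \<in> grad_H1 \<Omega>" "j \<in> I"
  shows "t j = 0"
proof (cases j)
  case None
  then show ?thesis using exact_combination(1)[OF combination_cocycle assms(1)] by simp
next
  case (Some i)
  then have "i \<in> S" using assms(2) by (auto simp: I_def)
  then show ?thesis
    using exact_combination(2)[OF combination_cocycle assms(1) z_cycle] combination_period[of i t] Some by simp
qed

lemma zero_grad_H1: "0 \<in> grad_H1 \<Omega>"
proof -
  have sq: "square_integrable (\<lambda>x. 0)" by (rule square_integrable_test[OF test_zero])
  have "represents \<Omega> (\<lambda>x. 0) (\<lambda>x. (0 :: real^2 \<Rightarrow> real^2) x $ i)" for i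
    using square_integrable_imp_L2(2)[OF op sq] by simp
  moreover have "weak_gradient \<Omega> (\<lambda>x. 0) (\<lambda>i x. 0)" by (simp add: weak_gradient_def)
  ultimately show ?thesis using sq by (intro iffD2[OF grad_H1_iff[OF op bd, of "\<lambda>i x. 0" 0]] exI conjI)
qed

lemma basis_independent: "inj_on basis_field I" "fields.independent (basis_field ` I)"
proof -
  have "\<forall>j\<in>I. t j = 0" if "(\<Sum>j\<in>I. (\<lambda>x. t j *\<^sub>R basis_field j x)) = 0" for t
    using that zero_grad_H1 grad_H1_combination[of t] by (simp add: basis_combination)
  from fields_independent_family[OF finite_I this]
  show "inj_on basis_field I" "fields.independent (basis_field ` I)" by blast+
qed

text \<open>The Whitney fields of a dual family are independent and lie in a span of at most |N|^2
  generators. The partition is fixed, so the bound is the same for every family.\<close>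

lemma card_S_le: "card S \<le> card N * card N"
proof -
  define w where "w = (\<lambda>(d, c). field (\<lambda>i x. \<rho> d x * d\<rho> i c x))"
  have fin: "finite (N \<times> N)" using N(1) by simp
  have "field (whitney (h i)) = (\<Sum>j\<in>N \<times> N. (\<lambda>x. (case j of (d, c) \<Rightarrow> h i d c) *\<^sub>R w j x))" for i
  proof
    fix x
    have "whitney (h i) k x = (\<Sum>d\<in>N. \<Sum>c\<in>N. h i d c * (\<rho> d x * d\<rho> k c x))" for k
      unfolding whitney_def by (rule sum.swap)
    then have "(\<Sum>j\<in>N \<times> N. (case j of (d, c) \<Rightarrow> h i d c) *\<^sub>R w j x) = field (whitney (h i)) x"
      by (simp add: w_def field_def vec_eq_iff sum.cartesian_product split_def)
    then show "field (whitney (h i)) x = (\<Sum>j\<in>N \<times> N. (\<lambda>x. (case j of (d, c) \<Rightarrow> h i d c) *\<^sub>R w j x)) x"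
      by (simp add: sum_apply)
  qed
  then have "field (whitney (h i)) \<in> fields.span (w ` (N \<times> N))" for i
    unfolding fields_span_family[OF fin] by blast
  then have sub: "basis_field ` Some ` S \<subseteq> fields.span (w ` (N \<times> N))" by (auto simp: basis_field_def)
  have "fields.independent (basis_field ` Some ` S)"
    by (rule fields.independent_mono[OF basis_independent(2)]) (auto simp: I_def)
  then have "card (basis_field ` Some ` S) \<le> card (w ` (N \<times> N))"
    using fields.independent_span_bound[OF finite_imageI[OF fin] _ sub] by blast
  also have "card (basis_field ` Some ` S) = card (Some ` S)"
    by (rule card_image[OF inj_on_subset[OF basis_independent(1)]]) (auto simp: I_def)
  also have "\<dots> = card S" by (simp add: card_image)
  also have "card (w ` (N \<times> N)) \<le> card N * card N" using card_image_le[OF fin] by (simp add: card_cartesian_product)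
  finally show ?thesis .
qed

definition H where "H = fields.span (basis_field ` I)"

lemma H_eq: "H = range (\<lambda>t. field (\<lambda>i x. whitney (combination t) i x + t None * rotation i x))"
  unfolding H_def fields_span_family[OF finite_I] basis_combination ..

lemma H_smooth: "H \<subseteq> smooth_fields \<Omega>"
  unfolding H_eq
  using test_add[OF whitney_test test_scale[OF rotation_test]] by (auto intro!: field_smooth)

lemma dim_H: "fields.dim H = card S + 1"
proof -
  have "fields.dim H = card (basis_field ` I)"
    unfolding H_def by (rule fields.dim_span_eq_card_independent[OF basis_independent(2)])
  also have "\<dots> = card I" by (rule card_image[OF basis_independent(1)])
  also have "\<dots> = card S + 1" using finite_S by (simp add: I_def card_image)
  finally show ?thesis .
qed

lemma combination_sq: "square_integrable (\<lambda>x. whitney (combination t) i x + a * rotation i x)"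
  by (rule square_integrable_lincomb[OF whitney_sq rotation_sq])

lemma kernel_decomposition:
  assumes maximal: "\<And>c. singular_relcycle 1 X {} c \<Longrightarrow>
      \<exists>k n. k \<noteq> 0 \<and> singular_relboundary 1 X {} (frag_cmul k c + (\<Sum>i\<in>S. frag_cmul (n i) (z i)))"
    and u: "u \<in> ker_grad_rot \<Omega>"
  shows "\<exists>g\<in>grad_H1 \<Omega>. \<exists>w\<in>H. u = g + w"
proof -
  have "u \<in> L2 \<Omega>" using u by (simp add: ker_grad_rot_def H_grad_rot_def)
  then obtain v where v: "\<And>i. represents \<Omega> (v i) (\<lambda>x. u x $ i)" using exists_represents_vec[OF op bd] by blast
  then have sv: "square_integrable (v i)" for i by (simp add: represents_def)
  have "weak_rot v (pderivative i \<psi>) = 0" if "\<psi> \<in> test_functions \<Omega>" for \<psi> i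
    using iffD1[OF ker_grad_rot_iff[OF op v] u] that by blast
  from rot_constant[OF sv this] obtain s where s: "\<And>\<psi>. \<psi> \<in> test_functions \<Omega> \<Longrightarrow> weak_rot v \<psi> = s * (LINT x|lborel. \<psi> x)"
    by blast
  define v' where "v' i x = v i x + (- s) * rotation i x" for i x
  have sv': "square_integrable (v' i)" for i unfolding v'_def by (rule square_integrable_lincomb[OF sv rotation_sq])
  have "weak_rot v' \<psi> = 0" if "\<psi> \<in> test_functions \<Omega>" for \<psi>
    using weak_rot_lincomb[OF sv rotation_sq that, where a = "- s"] s[OF that] weak_rot_rotation[OF that] by (simp add: v'_def[abs_def])
  from rot_free_decomposition[OF sv' this] obtain f p where f: "small_cocycle \<rho>1 \<Omega> f"
    and p: "square_integrable p" "weak_gradient \<Omega> p (\<lambda>i x. v' i x + 1 * whitney f i x)" by blast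
  \<comment> \<open>The coefficients are the constant rotation of \<open>u\<close> and the negated
    periods of \<open>f\<close>, so that adding \<open>combination t\<close> to \<open>f\<close>
    cancels the periods over all \<open>z j\<close>.\<close>
  define t where "t j = (case j of None \<Rightarrow> s | Some i \<Rightarrow> - chain_sum f (z i))" for j
  define k where "k x y = f x y + 1 * combination t x y" for x y
  have k: "small_cocycle \<rho>1 \<Omega> k" unfolding k_def by (rule small_cocycle_lincomb[OF f combination_cocycle])
  have kz: "chain_sum k (z j) = 0" if "j \<in> S" for j
  proof -
    have "chain_sum k (z j) = chain_sum f (z j) + 1 * chain_sum (combination t) (z j)"
      unfolding k_def[abs_def] using z_cycle[OF that]
      by (intro chain_sum_lincomb[OF f combination_cocycle pos(2)]) (simp add: singular_cycle)
    then show ?thesis using combination_period[OF that] by (simp add: t_def)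
  qed
  have "chain_sum k c = 0" if c: "singular_relcycle 1 X {} c" for c
  proof -
    \<comment> \<open>A nonzero multiple of \<open>c\<close> is, up to a boundary, a combination of
      the \<open>z i\<close>. Boundaries and all \<open>z i\<close> have period 0, and the factor
      \<open>m\<close> cancels in the reals.\<close>
    obtain m n where m: "m \<noteq> 0" "singular_relboundary 1 X {} (frag_cmul m c + (\<Sum>i\<in>S. frag_cmul (n i) (z i)))"
      using maximal[OF c] by blast
    have "chain_sum k (frag_cmul m c + (\<Sum>i\<in>S. frag_cmul (n i) (z i))) = of_int m * chain_sum k c + (\<Sum>i\<in>S. of_int (n i) * chain_sum k (z i))"
      by (simp add: additive.add[OF additive_chain_sum] additive.sum[OF additive_chain_sum] additive_frag_cmul[OF additive_chain_sum])
    also have "(\<Sum>i\<in>S. of_int (n i) * chain_sum k (z i)) = 0" by (simp add: kz)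
    finally show ?thesis using chain_sum_boundary[OF k pos(2) m(2)] m(1) by simp
  qed
  then obtain q where q: "square_integrable q" "weak_gradient \<Omega> q (whitney k)" using whitney_gradient_iff[OF k] by blast
  define w where "w = field (\<lambda>i x. whitney (combination t) i x + t None * rotation i x)"
  have sq: "square_integrable (\<lambda>x. v' i x + 1 * whitney f i x)" for i by (rule square_integrable_lincomb[OF sv' whitney_sq])
  \<comment> \<open>Since \<open>k\<close> is \<open>f\<close> plus the combination, subtracting the
    gradient \<open>whitney k\<close> removes the form of \<open>f\<close> and leaves
    \<open>v\<close> minus the chosen element of \<open>H\<close>.\<close>
  have eq: "v' i x + 1 * whitney f i x + (- 1) * whitney k i x = v i x + (- 1) * (whitney (combination t) i x + t None * rotation i x)" for i x
    by (simp add: k_def[abs_def] v'_def t_def whitney_lincomb[of f 1, simplified])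
  have "weak_gradient \<Omega> (\<lambda>x. p x + (- 1) * q x) (\<lambda>i x. v i x + (- 1) * (whitney (combination t) i x + t None * rotation i x))"
    using weak_gradient_lincomb[OF p(2) q(2) p(1) q(1) sq whitney_sq, where a = "- 1"] unfolding eq .
  moreover have "square_integrable (\<lambda>x. p x + (- 1) * q x)" by (rule square_integrable_lincomb[OF p(1) q(1)])
  moreover have "represents \<Omega> (\<lambda>x. v i x + (- 1) * (whitney (combination t) i x + t None * rotation i x)) (\<lambda>x. (u - w) x $ i)" for i
    using represents_lincomb[OF v[of i] combination_represents[of "combination t" i "t None"], where a = "- 1"]
    by (simp add: w_def)
  ultimately have "u - w \<in> grad_H1 \<Omega>"
    by (intro iffD2[OF grad_H1_iff[OF op bd, of "\<lambda>i x. v i x + (- 1) * (whitney (combination t) i x + t None * rotation i x)" "u - w"]] exI conjI)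
  moreover have "w \<in> H" unfolding H_eq w_def by blast
  ultimately show ?thesis by (intro bexI[of _ "u - w"] bexI[of _ w]) auto
qed

text \<open>The rotation of every element of \<open>H\<close> is a constant, and constants vanish
  against derivatives of test functions.\<close>

lemma kernel_superset:
  assumes g: "g \<in> grad_H1 \<Omega>" and w: "w \<in> H" shows "g + w \<in> ker_grad_rot \<Omega>"
proof -
  obtain t where w: "w = field (\<lambda>i x. whitney (combination t) i x + t None * rotation i x)" using w unfolding H_eq by blast
  have "g \<in> L2 \<Omega>" using g by (simp add: grad_H1_def)
  then obtain v where v: "\<And>i. represents \<Omega> (v i) (\<lambda>x. g x $ i)" using exists_represents_vec[OF op bd] by blast
  then have sv: "square_integrable (v i)" for i by (simp add: represents_def)
  obtain p where p: "square_integrable p" "weak_gradient \<Omega> p v" using iffD1[OF grad_H1_iff[OF op bd v] g] by blast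
  have r: "represents \<Omega> (\<lambda>x. v i x + 1 * (whitney (combination t) i x + t None * rotation i x)) (\<lambda>x. (g + w) x $ i)" for i
    using represents_lincomb[OF v[of i] combination_represents[of "combination t" i "t None"], where a = 1] by (simp add: w)
  have "weak_rot (\<lambda>i x. v i x + 1 * (whitney (combination t) i x + t None * rotation i x)) (pderivative j \<psi>) = 0"
    if \<psi>: "\<psi> \<in> test_functions \<Omega>" for \<psi> j
  proof -
    note \<psi>' = test_pderivative[OF \<psi>]
    have "(LINT x|lborel. pderivative j \<psi> x) = 0" unfolding pderivative_eq_dd by (rule integral_dd_test[OF \<psi>])
    then show ?thesis
      unfolding weak_rot_lincomb[OF sv combination_sq \<psi>'] weak_rot_lincomb[OF whitney_sq rotation_sq \<psi>']
        weak_rot_weak_gradient[OF p(2) \<psi>'] weak_rot_whitney[OF combination_cocycle \<psi>'] weak_rot_rotation[OF \<psi>'] by simp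
  qed
  then show ?thesis
    by (intro iffD2[OF ker_grad_rot_iff[OF op, of "\<lambda>i x. v i x + 1 * (whitney (combination t) i x + t None * rotation i x)"]] r ballI allI)
qed

lemma direct_sum:
  assumes maximal: "\<And>c. singular_relcycle 1 X {} c \<Longrightarrow>
      \<exists>k n. k \<noteq> 0 \<and> singular_relboundary 1 X {} (frag_cmul k c + (\<Sum>i\<in>S. frag_cmul (n i) (z i)))"
  shows "is_direct_sum (ker_grad_rot \<Omega>) (grad_H1 \<Omega>) H"
  unfolding is_direct_sum_def
proof
  show "ker_grad_rot \<Omega> = {v + w |v w. v \<in> grad_H1 \<Omega> \<and> w \<in> H}"
  proof
    show "ker_grad_rot \<Omega> \<subseteq> {v + w |v w. v \<in> grad_H1 \<Omega> \<and> w \<in> H}"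
    proof
      fix u assume "u \<in> ker_grad_rot \<Omega>"
      from kernel_decomposition[OF maximal this] show "u \<in> {v + w |v w. v \<in> grad_H1 \<Omega> \<and> w \<in> H}" by blast
    qed
    show "{v + w |v w. v \<in> grad_H1 \<Omega> \<and> w \<in> H} \<subseteq> ker_grad_rot \<Omega>"
    proof
      fix u assume "u \<in> {v + w |v w. v \<in> grad_H1 \<Omega> \<and> w \<in> H}"
      then obtain g w where "u = g + w" "g \<in> grad_H1 \<Omega>" "w \<in> H" by blast
      then show "u \<in> ker_grad_rot \<Omega>" by (simp add: kernel_superset)
    qed
  qed
  have "w = 0" if w: "w \<in> grad_H1 \<Omega>" "w \<in> H" for w
  proof -
    obtain t where t: "w = (\<Sum>j\<in>I. (\<lambda>x. t j *\<^sub>R basis_field j x))" using w(2) unfolding H_eq basis_combination by blast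
    have "t j = 0" if "j \<in> I" for j
      using grad_H1_combination[OF _ that, of t] w(1) unfolding t basis_combination by blast
    then show ?thesis unfolding t by (simp add: fun_eq_iff sum_apply)
  qed
  then show "grad_H1 \<Omega> \<inter> H = {0}" using zero_grad_H1 fields.span_zero by (auto simp: H_def)
qed

end

section \<open>Choice of the scales, the partition and the cycles\<close>

lemma exists_charted_domain:
  assumes \<Omega>: "bounded_lipschitz_domain \<Omega>"
  shows "\<exists>\<rho>0 \<rho>1 \<rho>2 \<rho>3 r Q0 Q1 Q3 N \<rho>. charted_domain \<Omega> \<rho>0 \<rho>1 \<rho>2 \<rho>3 r Q0 Q1 Q3 N \<rho>"
proof -
  have op: "open \<Omega>" and con: "connected \<Omega>" and ne: "\<Omega> \<noteq> {}" and bd: "bounded \<Omega>"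
    using \<Omega> by (auto simp: bounded_lipschitz_domain_def)
  have charts: "\<exists>\<eta> Q. 0 < \<eta> \<and> \<eta> \<le> \<epsilon> \<and> (\<forall>x\<in>\<Omega>. good_chart (Q x) \<and> \<Omega> \<inter> ball x \<eta> \<subseteq> Q x \<and> Q x \<subseteq> \<Omega> \<inter> ball x \<epsilon>)"
    if \<epsilon>: "\<epsilon> > 0" for \<epsilon>
  proof -
    obtain \<eta> where \<eta>: "\<eta> > 0" "\<forall>x\<in>\<Omega>. \<exists>Q. good_chart Q \<and> \<Omega> \<inter> ball x \<eta> \<subseteq> Q \<and> Q \<subseteq> \<Omega> \<inter> ball x \<epsilon>"
      using uniform_charts[OF \<Omega> \<epsilon>] by blast
    from bchoice[OF \<eta>(2)] obtain Q where Q: "\<And>x. x \<in> \<Omega> \<Longrightarrow> good_chart (Q x) \<and> \<Omega> \<inter> ball x \<eta> \<subseteq> Q x \<and> Q x \<subseteq> \<Omega> \<inter> ball x \<epsilon>"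
      by blast
    \<comment> \<open>Shrinking the radius to at most \<epsilon> provides the inequalities between
      successive scales.\<close>
    have "\<Omega> \<inter> ball x (min \<eta> \<epsilon>) \<subseteq> \<Omega> \<inter> ball x \<eta>" for x by auto
    then have "good_chart (Q x) \<and> \<Omega> \<inter> ball x (min \<eta> \<epsilon>) \<subseteq> Q x \<and> Q x \<subseteq> \<Omega> \<inter> ball x \<epsilon>" if "x \<in> \<Omega>" for x
      using Q[OF that] by (meson order_trans)
    then show ?thesis using \<eta>(1) \<epsilon> by (intro exI[of _ "min \<eta> \<epsilon>"] exI[of _ Q] conjI ballI) auto
  qed
  obtain \<rho>0 Q0 where Q0: "0 < \<rho>0" "\<forall>x\<in>\<Omega>. good_chart (Q0 x) \<and> \<Omega> \<inter> ball x \<rho>0 \<subseteq> Q0 x \<and> Q0 x \<subseteq> \<Omega> \<inter> ball x 1"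
    using charts[of 1] by (simp del: Int_subset_iff) blast
  obtain \<rho>1 Q1 where Q1: "0 < \<rho>1" "\<rho>1 \<le> \<rho>0 / 2" "\<forall>x\<in>\<Omega>. good_chart (Q1 x) \<and> \<Omega> \<inter> ball x \<rho>1 \<subseteq> Q1 x \<and> Q1 x \<subseteq> \<Omega> \<inter> ball x (\<rho>0 / 2)"
    using charts[of "\<rho>0 / 2"] Q0(1) by (simp del: Int_subset_iff) blast
  obtain \<rho>2 Q2 where Q2: "0 < \<rho>2" "\<rho>2 \<le> \<rho>1 / 2" "\<forall>x\<in>\<Omega>. good_chart (Q2 x) \<and> \<Omega> \<inter> ball x \<rho>2 \<subseteq> Q2 x \<and> Q2 x \<subseteq> \<Omega> \<inter> ball x (\<rho>1 / 2)"
    using charts[of "\<rho>1 / 2"] Q1(1) by (simp del: Int_subset_iff) blast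
  define r where "r = \<rho>2 / 8"
  have r: "r > 0" using Q2(1) by (simp add: r_def)
  obtain \<rho>3 Q3 where Q3: "0 < \<rho>3" "\<rho>3 \<le> 4 * r" "\<forall>x\<in>\<Omega>. good_chart (Q3 x) \<and> \<Omega> \<inter> ball x \<rho>3 \<subseteq> Q3 x \<and> Q3 x \<subseteq> \<Omega> \<inter> ball x (4 * r)"
    using charts[of "4 * r"] r by (simp del: Int_subset_iff) blast
  have cl: "closure \<Omega> \<subseteq> (\<Union>c\<in>\<Omega>. ball c r)"
  proof
    fix x assume "x \<in> closure \<Omega>"
    then obtain y where "y \<in> \<Omega>" "dist y x < r" using r closure_approachable by blast
    then show "x \<in> (\<Union>c\<in>\<Omega>. ball c r)" by auto
  qed
  have "compact (closure \<Omega>)" using bd by simp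
  from compactE_image[OF this _ cl] obtain N where N: "N \<subseteq> \<Omega>" "finite N" "closure \<Omega> \<subseteq> (\<Union>c\<in>N. ball c r)" by auto
  obtain \<rho> where \<rho>: "\<forall>c\<in>N. smooth (\<rho> c) \<and> (\<forall>x. dist c x \<ge> 2 * r \<longrightarrow> \<rho> c x = 0)"
    "\<forall>x. (\<Sum>c\<in>N. \<rho> c x) = 1 - (\<Prod>c\<in>N. (1 - plateau c r x))"
    using smooth_partition_of_unity[OF N(2) r] by blast
  have "charted_domain \<Omega> \<rho>0 \<rho>1 \<rho>2 \<rho>3 r Q0 Q1 Q3 N \<rho>"
  proof
    show "good_chart (Q0 x) \<and> \<Omega> \<inter> ball x \<rho>0 \<subseteq> Q0 x \<and> Q0 x \<subseteq> \<Omega>" if "x \<in> \<Omega>" for x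
      using bspec[OF Q0(2) that] by blast
    show "\<exists>\<gamma>. path \<gamma> \<and> path_image \<gamma> \<subseteq> \<Omega> \<inter> ball x (\<rho>1 / 2) \<and> pathstart \<gamma> = x \<and> pathfinish \<gamma> = y"
      if xy: "x \<in> \<Omega>" "y \<in> \<Omega>" "dist x y < \<rho>2" for x y
    proof -
      have "path_connected (Q2 x)" using bspec[OF Q2(3) xy(1)] good_chart_contractible contractible_imp_path_connected by blast
      moreover have "x \<in> Q2 x" "y \<in> Q2 x" using bspec[OF Q2(3) xy(1)] xy Q2(1) by auto
      ultimately obtain \<gamma> where "path \<gamma>" "path_image \<gamma> \<subseteq> Q2 x" "pathstart \<gamma> = x" "pathfinish \<gamma> = y"
        unfolding path_connected_def by blast
      then show ?thesis using bspec[OF Q2(3) xy(1)] by blast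
    qed
    show "(\<Sum>c\<in>N. \<rho> c x) = 1" if "x \<in> (\<Union>c\<in>N. ball c r)" for x
    proof -
      obtain c where c: "c \<in> N" "dist c x < r" using \<open>x \<in> (\<Union>c\<in>N. ball c r)\<close> by auto
      \<comment> \<open>One plateau equal to 1 makes the product in the formula for the partition
        sum vanish.\<close>
      then have "\<exists>c\<in>N. 1 - plateau c r x = 0" using plateau_eq_1[OF r, of c x] by auto
      then have "(\<Prod>c\<in>N. (1 - plateau c r x)) = 0" using N(2) by (simp add: prod_zero)
      then show ?thesis using \<rho>(2) by simp
    qed
  qed (use op con ne bd Q0 Q1 Q2 Q3 N r \<rho> in \<open>auto simp: r_def\<close>)
  then show ?thesis by blast
qed

theorem theorem3p2:
  fixes \<Omega> :: "(real^2) set"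
  assumes "bounded_lipschitz_domain \<Omega>"
  shows "\<exists>H :: (real^2 \<Rightarrow> real^2) set.
           fields.subspace H \<and>
           H \<subseteq> smooth_fields \<Omega> \<and>
           (\<exists>B. finite B \<and> fields.span B = H) \<and>
           enat (fields.dim H) = 1 + betti_number 1 (top_of_set \<Omega>) \<and>
           is_direct_sum (ker_grad_rot \<Omega>) (grad_H1 \<Omega>) H"
proof -
  obtain \<rho>0 \<rho>1 \<rho>2 \<rho>3 r Q0 Q1 Q3 N \<rho> where cd: "charted_domain \<Omega> \<rho>0 \<rho>1 \<rho>2 \<rho>3 r Q0 Q1 Q3 N \<rho>"
    using exists_charted_domain[OF assms] by blast
  interpret charted_domain \<Omega> \<rho>0 \<rho>1 \<rho>2 \<rho>3 r Q0 Q1 Q3 N \<rho> by (rule cd)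
  have basis: "\<exists>h. cycle_basis \<Omega> \<rho>0 \<rho>1 \<rho>2 \<rho>3 r Q0 Q1 Q3 N \<rho> S z h"
    if ind: "independent_cycles X S z" for S :: "(real^2) chain set set" and z
  proof -
    obtain h where "\<forall>i\<in>S. small_cocycle \<rho>1 \<Omega> (h i) \<and> (\<forall>j\<in>S. chain_sum (h i) (z j) = (if i = j then 1 else 0))"
      using dual_cocycles[OF ind] by blast
    then show ?thesis using ind by (intro exI[of _ h] cycle_basis.intro cycle_basis_axioms.intro cd) blast+
  qed
  \<comment> \<open>Every independent family of cycles has a dual family of Whitney fields, whose
    number is limited by the partition; this is where finiteness of the Betti number comes
    from.\<close>
  have bound: "card S \<le> card N * card N" if "independent_cycles X S z" for S :: "(real^2) chain set set" and z
    using basis[OF that] cycle_basis.card_S_le by blast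
  have "\<exists>(S :: (real^2) chain set set) z. independent_cycles X S z \<and> betti_number 1 X = enat (card S) \<and>
     (\<forall>c. singular_relcycle 1 X {} c \<longrightarrow>
       (\<exists>k n. k \<noteq> 0 \<and> singular_relboundary 1 X {} (frag_cmul k c + (\<Sum>i\<in>S. frag_cmul (n i) (z i)))))"
    by (rule betti_number_basis) (rule bound)
  then obtain S :: "(real^2) chain set set" and z where S: "independent_cycles X S z"
    "betti_number 1 X = enat (card S)" and maximal: "\<forall>c. singular_relcycle 1 X {} c \<longrightarrow>
      (\<exists>k n. k \<noteq> 0 \<and> singular_relboundary 1 X {} (frag_cmul k c + (\<Sum>i\<in>S. frag_cmul (n i) (z i))))"
    by blast
  obtain h where "cycle_basis \<Omega> \<rho>0 \<rho>1 \<rho>2 \<rho>3 r Q0 Q1 Q3 N \<rho> S z h" using basis[OF S(1)] by blast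
  then interpret cycle_basis \<Omega> \<rho>0 \<rho>1 \<rho>2 \<rho>3 r Q0 Q1 Q3 N \<rho> S z h .
  have "fields.subspace H" unfolding H_def by (rule fields.subspace_span)
  moreover have "\<exists>B. finite B \<and> fields.span B = H" unfolding H_def using finite_I by blast
  moreover have "enat (fields.dim H) = 1 + betti_number 1 X" by (simp add: dim_H S(2) one_enat_def)
  ultimately show ?thesis using H_smooth direct_sum[OF mp[OF spec[OF maximal]]] by blast
qed

end
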